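(* Let $\mathbf F\in\{\mathbf R,\mathbf C,\mathbf H\}$, $c=\dim_{\mathbf R}\mathbf F$, and assume $n\ge2$ and $N-n\ge2$. Define $g:G_{\mathbf F}(n,N)\to\mathbf R$ by $g(\pi)=\langle\varphi(\pi),E_{12}\rangle$ (equivalently $g(\pi)=2\,\mathrm{Re}\sum_{i=1}^n x_{i1}\bar x_{i2}$ where $e_i=(x_{i1},\dots,x_{iN})^t$ is an orthonormal basis of $\pi$). Let $\tilde e_1,\dots,\tilde e_N$ be the standard basis of $\mathbf F^N$ and $V=\mathrm{span}(\tilde e_3,\dots,\tilde e_N)$. Then $g$ is a Morse–Bott function taking values in $[-1,1]$ whose critical set is the disjoint union of the following four submanifolds: (a) $G_{\mathbf F}(n-2,N-2)=\{\pi:\tilde e_1,\tilde e_2\in\pi\}$, on which $g=0$, with index $c(N-n)$; (b) $G_{\mathbf F}(n,N-2)=\{\pi:\pi\subset V\}$, on which $g=0$, with index $cn$; (c) $g^{-1}(-1)=\widetilde G_{\mathbf F}(n-1,N-2)$, the set of $\pi$ spanned by $(\tilde e_1-\tilde e_2)/\sqrt2$ and an $(n-1)$-dimensional subspace of $V$, with index $0$; (d) $g^{-1}(1)=G_{\mathbf F}(n-1,N-2)$, the set of $\pi$ spanned by $(\tilde e_1+\tilde e_2)/\sqrt2$ and an $(n-1)$-dimensional subspace of $V$, with index $c(N-1)$; and each of these critical submanifolds is nondegenerate.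
   Context: $\mathbf H$ denotes the quaternions; $\bar u$ is conjugation; scalars act on the right of column vectors in $\mathbf F^N$, with inner product $(u,v)=\bar v^tu$. $G_{\mathbf F}(n,N)$ is the Grassmann manifold of $n$-dimensional $\mathbf F$-subspaces of $\mathbf F^N$. $M_{\mathbf F}(N)$ is the real vector space of $N\times N$ matrices $A$ over $\mathbf F$ with $\bar A^t=A$, with inner product $\langle A,B\rangle=\mathrm{Re}\,\mathrm{tr}(AB)$. $\varphi(\pi)=\sum_{i=1}^ne_i\bar e_i^t$ for any orthonormal basis $e_1,\dots,e_n$ of $\pi$. $E_{12}\in M_{\mathbf F}(N)$ is the matrix with entries $1$ in positions $(1,2)$ and $(2,1)$ and $0$ elsewhere. A Morse–Bott function is one whose critical set is a disjoint union of closed submanifolds each nondegenerate (Hessian nondegenerate on the normal bundle); the index is the number of negative eigenvalues of the normal Hessian. *)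

theory Defs
  imports "HOL-Analysis.Analysis"
begin

section \<open>Quaternions, encoded by Cayley-Dickson as pairs of complex numbers\<close>

text \<open>The pair (a,b) stands for a + b j.  R is embedded as (r,0) with r real,
  C as (z,0); hence R, C, H are the subsets scal 1, scal 2, scal 4.\<close>

type_synonym quat = "complex \<times> complex"

definition qmult :: "quat \<Rightarrow> quat \<Rightarrow> quat" where
  "qmult p q = (fst p * fst q - snd p * cnj (snd q), fst p * snd q + snd p * cnj (fst q))"

definition qconj :: "quat \<Rightarrow> quat" where
  "qconj q = (cnj (fst q), - snd q)"

definition qre :: "quat \<Rightarrow> real" where
  "qre q = Re (fst q)"

definition qone :: quat where
  "qone = (1, 0)"

definition qreal :: "real \<Rightarrow> quat" where
  "qreal r = (complex_of_real r, 0)"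

definition scal :: "nat \<Rightarrow> quat set" where
  "scal c = (if c = 1 then {(complex_of_real r, 0) | r. True}
             else if c = 2 then {(z, 0) | z. True} else UNIV)"

definition fvec :: "nat \<Rightarrow> quat ^ ('N::finite) \<Rightarrow> bool" where
  "fvec c v \<longleftrightarrow> (\<forall>i. v $ i \<in> scal c)"

definition vscal :: "quat ^ ('N::finite) \<Rightarrow> quat \<Rightarrow> quat ^ ('N::finite)" where
  "vscal v a = (\<chi> i. qmult (v $ i) a)"

definition finner :: "quat ^ ('N::finite) \<Rightarrow> quat ^ ('N::finite) \<Rightarrow> quat" where
  "finner u v = (\<Sum>i\<in>UNIV. qmult (qconj (v $ i)) (u $ i))"

definition orthonormal :: "nat \<Rightarrow> nat \<Rightarrow> (nat \<Rightarrow> quat ^ ('N::finite)) \<Rightarrow> bool" where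
  "orthonormal c k es \<longleftrightarrow>
     (\<forall>i<k. fvec c (es i)) \<and>
     (\<forall>i<k. \<forall>j<k. finner (es i) (es j) = (if i = j then qone else 0))"

definition spanF :: "nat \<Rightarrow> nat \<Rightarrow> (nat \<Rightarrow> quat ^ ('N::finite)) \<Rightarrow> (quat ^ ('N::finite)) set" where
  "spanF c k es = {(\<Sum>i<k. vscal (es i) (a i)) | a. \<forall>i<k. a i \<in> scal c}"

definition grass :: "nat \<Rightarrow> nat \<Rightarrow> (quat ^ ('N::finite)) set set" where
  "grass c k = {spanF c k es | es. orthonormal c k es}"

type_synonym 'N qmat = "quat ^ 'N ^ 'N"

definition outer :: "quat ^ ('N::finite) \<Rightarrow> ('N::finite) qmat" where
  "outer v = (\<chi> i j. qmult (v $ i) (qconj (v $ j)))"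

definition phi :: "nat \<Rightarrow> nat \<Rightarrow> (quat ^ ('N::finite)) set \<Rightarrow> ('N::finite) qmat" where
  "phi c k \<pi> = (let es = (SOME es. orthonormal c k es \<and> spanF c k es = \<pi>)
                 in \<Sum>i<k. outer (es i))"

definition mprod :: "('N::finite) qmat \<Rightarrow> ('N::finite) qmat \<Rightarrow> ('N::finite) qmat" where
  "mprod A B = (\<chi> i j. \<Sum>l\<in>UNIV. qmult (A $ i $ l) (B $ l $ j))"

definition mtrace :: "('N::finite) qmat \<Rightarrow> quat" where
  "mtrace A = (\<Sum>i\<in>UNIV. A $ i $ i)"

definition hinner :: "('N::finite) qmat \<Rightarrow> ('N::finite) qmat \<Rightarrow> real" where
  "hinner A B = qre (mtrace (mprod A B))"

text \<open>E_12, where i1, i2 play the role of the first two coordinates.\<close>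
definition E12 :: "('N::finite) \<Rightarrow> 'N \<Rightarrow> ('N::finite) qmat" where
  "E12 i1 i2 = (\<chi> i j. if (i = i1 \<and> j = i2) \<or> (i = i2 \<and> j = i1) then qone else 0)"

definition gfun :: "('N::finite) \<Rightarrow> 'N \<Rightarrow> ('N::finite) qmat \<Rightarrow> real" where
  "gfun i1 i2 P = hinner P (E12 i1 i2)"

definition stdb :: "('N::finite) \<Rightarrow> quat ^ ('N::finite)" where
  "stdb i = (\<chi> j. if j = i then qone else 0)"

definition Vsub :: "nat \<Rightarrow> 'N \<Rightarrow> 'N \<Rightarrow> (quat ^ ('N::finite)) set" where
  "Vsub c i1 i2 = {v. fvec c v \<and> v $ i1 = 0 \<and> v $ i2 = 0}"

definition diagv :: "real \<Rightarrow> 'N \<Rightarrow> 'N \<Rightarrow> quat ^ ('N::finite)" where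
  "diagv s i1 i2 = (\<chi> j. if j = i1 then qreal (1 / sqrt 2)
                         else if j = i2 then qreal (s / sqrt 2) else 0)"

definition line_plus :: "nat \<Rightarrow> quat ^ ('N::finite) \<Rightarrow> (quat ^ ('N::finite)) set \<Rightarrow> (quat ^ ('N::finite)) set" where
  "line_plus c u W = {vscal u a + w | a w. a \<in> scal c \<and> w \<in> W}"

fun ddiff :: "'a::real_normed_vector list \<Rightarrow> ('a \<Rightarrow> 'b::real_normed_vector) \<Rightarrow> 'a \<Rightarrow> 'b" where
  "ddiff [] f = f"
| "ddiff (v # vs) f = (\<lambda>x. vector_derivative (\<lambda>t. ddiff vs f (x + t *\<^sub>R v)) (at 0))"

definition smooth_on :: "'a::real_normed_vector set \<Rightarrow> ('a \<Rightarrow> 'b::real_normed_vector) \<Rightarrow> bool" where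
  "smooth_on U f \<longleftrightarrow> (\<forall>vs. continuous_on U (ddiff vs f) \<and>
      (\<forall>v. \<forall>x\<in>U. ((\<lambda>t. ddiff vs f (x + t *\<^sub>R v)) has_vector_derivative ddiff (v # vs) f x) (at 0)))"

definition submanifold :: "nat \<Rightarrow> 'a::euclidean_space set \<Rightarrow> bool" where
  "submanifold k S \<longleftrightarrow> (\<forall>p\<in>S. \<exists>U V (\<psi>::'a \<Rightarrow> 'a) \<psi>' L.
      open U \<and> p \<in> U \<and> open V \<and> smooth_on U \<psi> \<and> smooth_on V \<psi>' \<and>
      \<psi> ` U = V \<and> (\<forall>x\<in>U. \<psi>' (\<psi> x) = x) \<and>
      subspace L \<and> dim L = k \<and> \<psi> ` (S \<inter> U) = L \<inter> V)"

definition smooth_curve :: "'a::euclidean_space set \<Rightarrow> 'a \<Rightarrow> (real \<Rightarrow> 'a) \<Rightarrow> bool" where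
  "smooth_curve S p \<gamma> \<longleftrightarrow> (\<exists>\<epsilon>>0. smooth_on (ball 0 \<epsilon>) \<gamma> \<and> \<gamma> ` ball 0 \<epsilon> \<subseteq> S \<and> \<gamma> 0 = p)"

definition tangent_space :: "'a::euclidean_space set \<Rightarrow> 'a \<Rightarrow> 'a set" where
  "tangent_space S p = {vector_derivative \<gamma> (at 0) | \<gamma>. smooth_curve S p \<gamma>}"

definition critical_set :: "('a::euclidean_space \<Rightarrow> real) \<Rightarrow> 'a set \<Rightarrow> 'a set" where
  "critical_set f M = {p \<in> M. \<forall>\<gamma>. smooth_curve M p \<gamma> \<longrightarrow> vector_derivative (f \<circ> \<gamma>) (at 0) = 0}"

definition hessQ :: "('a::euclidean_space \<Rightarrow> real) \<Rightarrow> 'a set \<Rightarrow> 'a \<Rightarrow> 'a \<Rightarrow> real" where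
  "hessQ f M p v = (SOME h. \<exists>\<gamma>. smooth_curve M p \<gamma> \<and> vector_derivative \<gamma> (at 0) = v \<and>
       h = vector_derivative (\<lambda>t. vector_derivative (f \<circ> \<gamma>) (at t)) (at 0))"

definition hessB :: "('a::euclidean_space \<Rightarrow> real) \<Rightarrow> 'a set \<Rightarrow> 'a \<Rightarrow> 'a \<Rightarrow> 'a \<Rightarrow> real" where
  "hessB f M p u w = (hessQ f M p (u + w) - hessQ f M p u - hessQ f M p w) / 2"

definition normal_space :: "('a \<Rightarrow> 'a \<Rightarrow> real) \<Rightarrow> 'a::euclidean_space set \<Rightarrow> 'a set \<Rightarrow> 'a \<Rightarrow> 'a set" where
  "normal_space ip M C p = {u \<in> tangent_space M p. \<forall>w\<in>tangent_space C p. ip u w = 0}"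

definition nondegenerate_crit :: "('a \<Rightarrow> 'a \<Rightarrow> real) \<Rightarrow> ('a::euclidean_space \<Rightarrow> real) \<Rightarrow> 'a set \<Rightarrow> 'a set \<Rightarrow> bool" where
  "nondegenerate_crit ip f M C \<longleftrightarrow> (\<forall>p\<in>C. \<forall>u\<in>normal_space ip M C p.
      (\<forall>w\<in>normal_space ip M C p. hessB f M p u w = 0) \<longrightarrow> u = 0)"

text \<open>Index: number of negative eigenvalues (with multiplicity) of the normal Hessian,
  i.e. the dimension of the span of its eigenvectors with negative eigenvalues.\<close>
definition crit_index :: "('a \<Rightarrow> 'a \<Rightarrow> real) \<Rightarrow> ('a::euclidean_space \<Rightarrow> real) \<Rightarrow> 'a set \<Rightarrow> 'a set \<Rightarrow> 'a \<Rightarrow> nat" where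
  "crit_index ip f M C p = dim (span {u \<in> normal_space ip M C p. \<exists>lam<0.
      \<forall>w\<in>normal_space ip M C p. hessB f M p u w = lam * ip u w})"

end

theory Submission
  imports Defs
begin

text \<open>Identify a subspace with its orthogonal projector \<open>P\<close> and write \<open>E = E12 = D1 - D2\<close>, where \<open>D1, D2\<close> are
  the projectors onto the lines of \<open>(e1 + e2)/sqrt 2\<close> and \<open>(e1 - e2)/sqrt 2\<close>. The tangent vectors at \<open>P\<close>
  are the off-diagonal hermitian matrices, \<open>u = P u + u P\<close>, so \<open>P\<close> is critical for the linear function
  \<open>g\<close> iff \<open>P\<close> commutes with \<open>E\<close>, that is, iff \<open>P D1 = a D1\<close> and \<open>P D2 = b D2\<close> with
  \<open>a, b \<in> {0, 1}\<close>; the four choices of \<open>(a, b)\<close> are the four critical manifolds, and \<open>g = a - b\<close>.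
  Differentiating \<open>P\<^sup>2 = P\<close> twice along a curve shows that the Hessian acts on the lower block
  \<open>X = (1 - P) u P\<close> by \<open>X \<mapsto> E X - X E\<close>, whose eigenvalues are differences of eigenvalues of \<open>E\<close>. All
  eigenspaces are of the form \<open>{X. X = Q X R}\<close> for projectors \<open>Q, R\<close>, of real dimension
  \<open>c (tr Q) (tr R)\<close>. Charts and curves come from projecting onto the graph of \<open>X\<close>.\<close>

section \<open>Quaternions and quaternionic matrices\<close>

text \<open>Three features shape the proof. All matrices have quaternionic entries, and lying over F
  is the equation \<open>mproj c A = A\<close> for a linear retraction, so one argument serves R, C
  and H, and the equation survives products, inverses and differentiation. Noncommuting entries
  leave no determinant, and only the real part of the trace is cyclic: inverses come from real
  linear algebra, and the trace of a projector replaces its rank. Finally,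
  \<open>submanifold\<close> asks for charts on open sets of the whole matrix space, smooth in the
  sense of iterated directional derivatives. The graph construction parametrises only projectors, so
  the chart keeps the other matrix blocks as deviations from the graph projector, and smoothness
  comes from a class of rational maps. The Grassmannian and the four critical sets are all cut out
  of the projectors of trace n by an equation P K = Z, so charts, tangent spaces and closedness are
  treated once, for \<open>proj_section\<close>.\<close>

lemma bounded_bilinear_qmult: "bounded_bilinear qmult"
  unfolding bilinear_conv_bounded_bilinear[symmetric] bilinear_def
  by (auto intro!: linearI simp: qmult_def algebra_simps scaleR_conv_of_real)

interpretation qmult: bounded_bilinear qmult
  by (rule bounded_bilinear_qmult)

lemma qmult_assoc: "qmult (qmult a b) d = qmult a (qmult b d)"
  by (simp add: qmult_def algebra_simps)

lemma qmult_qone [simp]: "qmult qone a = a" "qmult a qone = a"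
  by (simp_all add: qmult_def qone_def)

lemma qconj_qmult: "qconj (qmult a b) = qmult (qconj b) (qconj a)"
  by (simp add: qmult_def qconj_def algebra_simps)

lemma linear_qconj: "linear qconj"
  by (auto intro!: linearI simp: qconj_def)

lemma linear_qre: "linear qre"
  by (auto intro!: linearI simp: qre_def)

lemma qconj_simps [simp]:
  "qconj (qconj a) = a" "qconj 0 = 0" "qconj qone = qone" "qconj (qreal r) = qreal r"
  by (simp_all add: qconj_def qone_def qreal_def zero_prod_def)

lemma qre_simps [simp]: "qre 0 = 0" "qre qone = 1" "qre (qreal r) = r"
  by (simp_all add: qre_def qone_def qreal_def)

lemma qre_qmult_commute: "qre (qmult a b) = qre (qmult b a)"
  by (simp add: qre_def qmult_def algebra_simps)

lemma qre_qmult_qconj: "qre (qmult a (qconj b)) = a \<bullet> b"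
  by (simp add: qre_def qmult_def qconj_def inner_prod_def inner_complex_def)

lemma qmult_qconj_self: "qmult (qconj a) a = qreal ((norm a)\<^sup>2)" "qmult a (qconj a) = qreal ((norm a)\<^sup>2)"
  by (simp_all add: qreal_def qmult_def qconj_def norm_prod_def cmod_power2 prod_eq_iff complex_eq_iff)
     (simp_all add: power2_eq_square algebra_simps)

lemma qreal_scaleR: "qmult (qreal r) a = r *\<^sub>R a" "qmult a (qreal r) = r *\<^sub>R a"
  by (simp_all add: qreal_def qmult_def scaleR_conv_of_real prod_eq_iff)

lemma qreal_conv_scaleR: "qreal r = r *\<^sub>R qone"
  by (simp add: qreal_def qone_def scaleR_conv_of_real prod_eq_iff)

text \<open>The orthogonal projection of H onto \<open>scal c\<close>. It turns membership in F into
  a linear equation, see \<open>scal_iff\<close>.\<close>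

definition qproj :: "nat \<Rightarrow> quat \<Rightarrow> quat" where
  "qproj c q = (if c = 1 then qreal (qre q) else if c = 2 then (fst q, 0) else q)"

lemma scal_iff: "a \<in> scal c \<longleftrightarrow> qproj c a = a"
  by (cases a) (auto simp: scal_def qproj_def qreal_def qre_def intro: sym)

lemma linear_qproj: "linear (qproj c)"
  by (auto intro!: linearI simp: qproj_def qreal_def qre_def prod_eq_iff scaleR_conv_of_real)

lemma qproj_idem [simp]: "qproj c (qproj c a) = qproj c a"
  by (auto simp: qproj_def)

lemma qproj_simps [simp]: "qproj c qone = qone" "qproj c (qreal r) = qreal r" "qproj c 0 = 0"
  by (auto simp: qproj_def qone_def qreal_def qre_def prod_eq_iff)

lemma qproj_qconj: "qproj c (qconj a) = qconj (qproj c a)"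
  by (auto simp: qproj_def qconj_def qreal_def qre_def)

text \<open>H is the direct sum of F and its orthogonal complement, and both summands are stable
  under multiplication by F.\<close>

lemma qproj_qmult_left: "qproj c a = a \<Longrightarrow> qproj c (qmult a b) = qmult a (qproj c b)"
  by (cases a) (auto simp: qproj_def qmult_def qreal_def qre_def prod_eq_iff complex_eq_iff split: if_splits)

lemma qproj_qmult_right: "qproj c b = b \<Longrightarrow> qproj c (qmult a b) = qmult (qproj c a) b"
  by (cases b) (auto simp: qproj_def qmult_def qreal_def qre_def prod_eq_iff complex_eq_iff split: if_splits)

lemma inner_qproj: "qproj c a \<bullet> b = a \<bullet> qproj c b"
  by (auto simp: qproj_def inner_prod_def inner_complex_def qreal_def qre_def)

lemma inner_qproj_self: "qproj c a \<bullet> a = (norm (qproj c a))\<^sup>2"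
  by (metis inner_qproj power2_norm_eq_inner qproj_idem)

text \<open>The left side is the trace of \<open>qproj c\<close>, so this is the real dimension of
  F; the factor c in every index originates here.\<close>

lemma sum_Basis_qproj:
  assumes "c \<in> {1, 2, 4::nat}"
  shows "(\<Sum>b\<in>Basis. (norm (qproj c b))\<^sup>2) = real c"
proof -
  have B: "(Basis :: quat set) = {(1, 0), (\<i>, 0), (0, 1), (0, \<i>)}"
    by (auto simp: Basis_prod_def Basis_complex_def)
  show ?thesis
    unfolding B using assms by (auto simp: qproj_def qreal_def qre_def norm_prod_def)
qed

section \<open>Algebra of quaternionic matrices\<close>

notation mprod (infixl "\<odot>" 70)

definition mone :: "('N::finite) qmat" where
  "mone = (\<chi> i j. if i = j then qone else 0)"

definition madj :: "('N::finite) qmat \<Rightarrow> 'N qmat" where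
  "madj A = (\<chi> i j. qconj (A $ j $ i))"

definition mproj :: "nat \<Rightarrow> ('N::finite) qmat \<Rightarrow> 'N qmat" where
  "mproj c A = (\<chi> i j. qproj c (A $ i $ j))"

definition rtr :: "('N::finite) qmat \<Rightarrow> real" where
  "rtr A = (\<Sum>i\<in>UNIV. qre (A $ i $ i))"

lemma qre_mtrace: "qre (mtrace A) = rtr A"
  by (simp add: mtrace_def rtr_def linear_sum[OF linear_qre])

lemma hinner_eq_rtr: "hinner A B = rtr (A \<odot> B)"
  by (simp add: hinner_def qre_mtrace)

lemma bounded_bilinear_mprod: "bounded_bilinear (mprod :: 'N::finite qmat \<Rightarrow> _)"
  unfolding bilinear_conv_bounded_bilinear[symmetric] bilinear_def
  by (auto intro!: linearI simp: mprod_def vec_eq_iff sum.distrib scaleR_sum_right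
      qmult.add_left qmult.add_right qmult.scaleR_left qmult.scaleR_right)

interpretation mprod: bounded_bilinear mprod
  by (rule bounded_bilinear_mprod)

lemma mprod_assoc: "A \<odot> B \<odot> C = A \<odot> (B \<odot> C)"
proof -
  have "(\<Sum>l\<in>UNIV. qmult (\<Sum>k\<in>UNIV. qmult (A $ i $ k) (B $ k $ l)) (C $ l $ j))
      = (\<Sum>k\<in>UNIV. qmult (A $ i $ k) (\<Sum>l\<in>UNIV. qmult (B $ k $ l) (C $ l $ j)))" for i j
    unfolding qmult.sum_left qmult.sum_right qmult_assoc by (rule sum.swap)
  then show ?thesis by (simp add: mprod_def vec_eq_iff)
qed

lemma mone_left [simp]: "mone \<odot> A = A"
proof -
  have "(\<Sum>l\<in>UNIV. qmult (if i = l then qone else 0) (A $ l $ j)) = A $ i $ j" for i j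
    by (subst sum.remove[of _ i]) (auto intro!: sum.neutral simp: qmult.zero_left)
  then show ?thesis by (simp add: mprod_def mone_def vec_eq_iff)
qed

lemma linear_madj: "linear madj"
  by (auto intro!: linearI simp: madj_def vec_eq_iff linear_add[OF linear_qconj] linear_scale[OF linear_qconj])

lemma madj_madj [simp]: "madj (madj A) = A"
  by (simp add: madj_def vec_eq_iff)

lemma madj_mone [simp]: "madj mone = mone"
  by (simp add: madj_def mone_def vec_eq_iff)

lemma madj_mprod [simp]: "madj (A \<odot> B) = madj B \<odot> madj A"
  by (simp add: madj_def mprod_def vec_eq_iff qconj_qmult linear_sum[OF linear_qconj])

lemmas madj_linear [simp] = linear_add[OF linear_madj] linear_diff[OF linear_madj]
  linear_neg[OF linear_madj] linear_0[OF linear_madj] linear_scale[OF linear_madj]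

lemma mone_right [simp]: "A \<odot> mone = A"
  by (metis madj_madj madj_mone madj_mprod mone_left)

lemma linear_mproj: "linear (mproj c)"
  by (auto intro!: linearI simp: mproj_def vec_eq_iff linear_add[OF linear_qproj] linear_scale[OF linear_qproj])

lemmas mproj_linear [simp] = linear_add[OF linear_mproj] linear_diff[OF linear_mproj]
  linear_neg[OF linear_mproj] linear_0[OF linear_mproj] linear_scale[OF linear_mproj]

lemma mproj_simps [simp]: "mproj c (mproj c A) = mproj c A" "mproj c mone = mone"
  by (auto simp: mproj_def mone_def vec_eq_iff)

lemma mproj_madj [simp]: "mproj c (madj A) = madj (mproj c A)"
  by (simp add: mproj_def madj_def vec_eq_iff qproj_qconj)

lemma mproj_nth: "mproj c A = A \<longleftrightarrow> (\<forall>i j. qproj c (A $ i $ j) = A $ i $ j)"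
  by (simp add: mproj_def vec_eq_iff)

lemma mproj_mprod_left: "mproj c A = A \<Longrightarrow> mproj c (A \<odot> B) = A \<odot> mproj c B"
  unfolding mproj_nth
  by (simp add: mproj_def mprod_def vec_eq_iff linear_sum[OF linear_qproj] qproj_qmult_left)

lemma mproj_mprod_right: "mproj c B = B \<Longrightarrow> mproj c (A \<odot> B) = mproj c A \<odot> B"
  unfolding mproj_nth
  by (simp add: mproj_def mprod_def vec_eq_iff linear_sum[OF linear_qproj] qproj_qmult_right)

lemma mproj_mprod: "mproj c A = A \<Longrightarrow> mproj c B = B \<Longrightarrow> mproj c (A \<odot> B) = A \<odot> B"
  by (simp add: mproj_mprod_left)

lemma linear_rtr: "linear rtr"
  by (auto intro!: linearI simp: rtr_def sum.distrib sum_distrib_left linear_add[OF linear_qre] linear_scale[OF linear_qre])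

lemmas rtr_linear [simp] = linear_add[OF linear_rtr] linear_diff[OF linear_rtr]
  linear_neg[OF linear_rtr] linear_0[OF linear_rtr] linear_scale[OF linear_rtr, unfolded real_scaleR_def]

lemma rtr_mone [simp]: "rtr (mone :: 'N::finite qmat) = real CARD('N)"
  by (simp add: rtr_def mone_def)

text \<open>The products ab and ba of quaternions differ but have the same real part. The full trace
  is not cyclic over H, so traces are taken through \<open>rtr\<close> throughout.\<close>

lemma rtr_commute: "rtr (A \<odot> B) = rtr (B \<odot> A)"
  unfolding rtr_def mprod_def
  by (simp add: linear_sum[OF linear_qre], subst sum.swap, simp add: qre_qmult_commute)

text \<open>Makes the Euclidean inner product of the matrix type the Frobenius product. It agrees
  with \<open>hinner\<close> when the second argument is hermitian, and the adjoint of a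
  multiplication is multiplication by \<open>madj\<close>.\<close>

lemma rtr_mprod_madj: "rtr (A \<odot> madj B) = A \<bullet> B"
  by (simp add: rtr_def mprod_def madj_def linear_sum[OF linear_qre] qre_qmult_qconj inner_vec_def)

lemma inner_mproj: "mproj c A \<bullet> B = A \<bullet> mproj c B"
  by (simp add: mproj_def inner_vec_def inner_qproj)

lemma inner_madj_left: "(A \<odot> B) \<bullet> C = B \<bullet> (madj A \<odot> C)"
  by (metis madj_madj madj_mprod mprod_assoc rtr_commute rtr_mprod_madj)

lemma inner_madj_right: "(A \<odot> B) \<bullet> C = A \<bullet> (C \<odot> madj B)"
  by (metis madj_madj madj_mprod mprod_assoc rtr_mprod_madj)

text \<open>\<open>malg\<close> nests products to the right, so a rule for A \<odot> B no longer
  matches once a factor follows B; this supplies the form that does.\<close>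

lemma mprod_extend: "A \<odot> B = C \<Longrightarrow> A \<odot> (B \<odot> X) = C \<odot> X"
  by (metis mprod_assoc)

lemmas malg = mprod.add_left mprod.add_right mprod.diff_left mprod.diff_right
  mprod.minus_left mprod.minus_right mprod.zero_left mprod.zero_right
  mprod.scaleR_left mprod.scaleR_right mprod_assoc

section \<open>Inverses and smoothness of rational maps\<close>

definition minvertible :: "('N::finite) qmat \<Rightarrow> bool" where
  "minvertible A \<longleftrightarrow> (\<exists>X. A \<odot> X = mone)"

definition minv :: "('N::finite) qmat \<Rightarrow> 'N qmat" where
  "minv A = (SOME X. A \<odot> X = mone)"

lemma minv_right: "minvertible A \<Longrightarrow> A \<odot> minv A = mone"
  unfolding minvertible_def minv_def by (rule someI_ex)

text \<open>Left multiplication by A is an injective endomorphism of a finite-dimensional real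
  vector space, hence onto; a preimage of \<open>mone\<close> is a right inverse.\<close>

lemma minvertible_if_inj:
  assumes "\<And>Y. A \<odot> Y = 0 \<Longrightarrow> Y = 0"
  shows "minvertible A"
proof -
  have lin: "linear (\<lambda>Y. A \<odot> Y)"
    by (intro linearI) (simp_all add: mprod.add_right mprod.scaleR_right)
  have "inj (\<lambda>Y. A \<odot> Y)"
    using assms by (simp add: linear_injective_0[OF lin])
  then have "surj (\<lambda>Y. A \<odot> Y)"
    using linear_injective_imp_surjective[OF lin] by simp
  then show ?thesis
    unfolding minvertible_def by (metis surjD)
qed

text \<open>A is a left inverse of X, so X acts injectively and has a right inverse Z; then A = A X
  Z = Z.\<close>

lemma mprod_eq_mone_commute:
  assumes "A \<odot> X = mone"
  shows "X \<odot> A = mone"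
proof -
  have "minvertible X"
  proof (rule minvertible_if_inj)
    show "Y = 0" if "X \<odot> Y = 0" for Y
      using mprod_extend[OF assms, of Y] that by (simp add: mprod.zero_right)
  qed
  then obtain Z where Z: "X \<odot> Z = mone"
    unfolding minvertible_def by blast
  have "A = Z"
    using mprod_extend[OF assms, of Z] by (simp add: Z)
  with Z show ?thesis by simp
qed

lemma minv_left: "minvertible A \<Longrightarrow> minv A \<odot> A = mone"
  by (rule mprod_eq_mone_commute[OF minv_right])

lemma minv_unique:
  assumes "A \<odot> X = mone"
  shows "minvertible A" "minv A = X"
proof -
  show *: "minvertible A"
    using assms unfolding minvertible_def by blast
  show "minv A = X"
    using mprod_extend[OF minv_left[OF *], of X] by (simp add: assms)
qed

text \<open>Applying \<open>mproj c\<close> to the equation for the inverse produces another right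
  inverse.\<close>

lemma mproj_minv:
  assumes "minvertible A" "mproj c A = A"
  shows "mproj c (minv A) = minv A"
proof -
  have "A \<odot> mproj c (minv A) = mone"
    using mproj_mprod_left[OF assms(2), of "minv A"] by (simp add: minv_right[OF assms(1)])
  then show ?thesis
    by (rule minv_unique(2)[symmetric])
qed

lemma madj_minv: "minvertible A \<Longrightarrow> minvertible (madj A)" "minvertible A \<Longrightarrow> madj (minv A) = minv (madj A)"
proof -
  have "madj A \<odot> madj (minv A) = mone" if "minvertible A"
    by (subst madj_mprod[symmetric]) (simp add: minv_left[OF that])
  then show "minvertible A \<Longrightarrow> minvertible (madj A)" "minvertible A \<Longrightarrow> madj (minv A) = minv (madj A)"
    by (blast intro: minv_unique(1) minv_unique(2)[symmetric])+
qed

lemma minv_commute: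
  assumes "minvertible A" "A \<odot> X = X \<odot> A"
  shows "minv A \<odot> X = X \<odot> minv A"
proof -
  have "minv A \<odot> (A \<odot> (X \<odot> minv A)) = minv A \<odot> (X \<odot> (A \<odot> minv A))"
    using mprod_extend[OF assms(2), of "minv A"] by (simp only: mprod_assoc)
  then show ?thesis
    by (simp only: mprod_extend[OF minv_left[OF assms(1)]] minv_right[OF assms(1)] mone_left mone_right)
qed

text \<open>A single estimate of Y by A' Y gives both the injectivity of A', hence its
  invertibility, and, for Y = \<open>minv A'\<close>, the bound on the inverse.\<close>

lemma minv_bounded_near:
  fixes A :: "'N::finite qmat"
  assumes "minvertible A"
  obtains e C where "e > 0" "\<And>A'. norm (A' - A) < e \<Longrightarrow> minvertible A' \<and> norm (minv A') \<le> C"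
proof -
  obtain K where K: "K > 0" "\<And>A B :: 'N qmat. norm (A \<odot> B) \<le> norm A * norm B * K"
    using mprod.pos_bounded by blast
  define X where "X = minv A"
  define m where "m = norm X + 1"
  have m: "m > 0" "norm X \<le> m"
    by (simp_all add: m_def add_nonneg_pos)
  \<comment> \<open>The radius is chosen so that the perturbation costs at most
    \<open>norm Y / 2\<close>, which is absorbed on the left.\<close>
  have bound: "norm Y \<le> 2 * m * K * norm (A' \<odot> Y)" if A': "norm (A' - A) < 1 / (2 * m * K * K)" for A' Y
  proof -
    have "norm Y = norm (X \<odot> (A \<odot> Y))"
      by (simp add: X_def mprod_extend[OF minv_left[OF assms]])
    also have "\<dots> \<le> norm X * norm (A \<odot> Y) * K"
      by (rule K)
    also have "\<dots> \<le> m * norm (A \<odot> Y) * K"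
      using m K by (intro mult_right_mono) auto
    also have "norm (A \<odot> Y) \<le> norm (A' \<odot> Y) + norm (A' - A) * norm Y * K"
      using norm_triangle_ineq4[of "A' \<odot> Y" "(A' - A) \<odot> Y"] K(2)[of "A' - A" Y]
      by (simp add: mprod.diff_left)
    also have "norm (A' - A) * norm Y * K \<le> 1 / (2 * m * K * K) * norm Y * K"
      using A' K by (intro mult_right_mono) auto
    finally have "norm Y \<le> m * (norm (A' \<odot> Y) + 1 / (2 * m * K * K) * norm Y * K) * K"
      using m K by simp
    also have "\<dots> = m * norm (A' \<odot> Y) * K + norm Y / 2"
      using m K by (simp add: field_simps)
    finally show ?thesis by (simp add: field_simps)
  qed
  show ?thesis
  proof (rule that[of "1 / (2 * m * K * K)" "2 * m * K * norm (mone :: 'N qmat)"])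
    show "1 / (2 * m * K * K) > 0" using m K by simp
    fix A' assume A': "norm (A' - A) < 1 / (2 * m * K * K)"
    have inv: "minvertible A'"
    proof (rule minvertible_if_inj)
      show "Y = 0" if "A' \<odot> Y = 0" for Y
        using bound[OF A', of Y] that by simp
    qed
    show "minvertible A' \<and> norm (minv A') \<le> 2 * m * K * norm (mone :: 'N qmat)"
      using inv bound[OF A', of "minv A'"] by (simp add: minv_right)
  qed
qed

lemma open_minvertible: "open {A. minvertible A}"
  unfolding open_dist
proof
  fix A :: "'a qmat" assume "A \<in> {A. minvertible A}"
  then show "\<exists>e>0. \<forall>B. dist B A < e \<longrightarrow> B \<in> {A. minvertible A}"
    by simp (metis dist_norm minv_bounded_near)
qed

text \<open>The resolvent identity. Boundedness of \<open>minv\<close> near A turns it into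
  continuity, and continuity turns it into the derivative.\<close>

lemma minv_diff:
  assumes "minvertible A" "minvertible B"
  shows "minv B - minv A = - (minv B \<odot> ((B - A) \<odot> minv A))"
  by (simp add: malg minv_right[OF assms(1)] mprod_extend[OF minv_left[OF assms(2)]])

lemma isCont_minv:
  fixes A :: "'N::finite qmat"
  assumes "minvertible A"
  shows "isCont minv A"
proof -
  obtain K where K: "K > 0" "\<And>A B :: 'N qmat. norm (A \<odot> B) \<le> norm A * norm B * K"
    using mprod.pos_bounded by blast
  obtain e C where e: "e > 0" "\<And>A'. norm (A' - A) < e \<Longrightarrow> minvertible A' \<and> norm (minv A') \<le> C"
    using minv_bounded_near[OF assms] by blast
  have "C \<ge> 0"
    using e(2)[of A] e(1) order_trans[OF norm_ge_zero] by auto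
  have "\<forall>\<^sub>F B in at A. norm (minv B - minv A) \<le> C * (norm (B - A) * norm (minv A) * K) * K"
    unfolding eventually_at dist_norm
  proof (intro exI[of _ e] conjI e ballI impI)
    fix B assume "B \<noteq> A \<and> norm (B - A) < e"
    then have B: "minvertible B" "norm (minv B) \<le> C" using e(2) by blast+
    have "norm (minv B - minv A) \<le> norm (minv B) * norm ((B - A) \<odot> minv A) * K"
      unfolding minv_diff[OF assms B(1)] using K(2) by simp
    also have "\<dots> \<le> C * (norm (B - A) * norm (minv A) * K) * K"
      using B K \<open>C \<ge> 0\<close> by (intro mult_right_mono mult_mono) auto
    finally show "norm (minv B - minv A) \<le> C * (norm (B - A) * norm (minv A) * K) * K" .
  qed
  moreover have "isCont (\<lambda>B. C * (norm (B - A) * norm (minv A) * K) * K) A"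
    by (intro continuous_intros)
  then have "((\<lambda>B. C * (norm (B - A) * norm (minv A) * K) * K) \<longlongrightarrow> 0) (at A)"
    by (simp add: isCont_def)
  ultimately have "((\<lambda>B. minv B - minv A) \<longlongrightarrow> 0) (at A)"
    by (rule Lim_null_comparison)
  then show ?thesis
    unfolding isCont_def using LIM_zero_cancel by blast
qed

lemma minv_has_derivative:
  fixes A :: "'N::finite qmat"
  assumes "minvertible A"
  shows "(minv has_derivative (\<lambda>W. - (minv A \<odot> (W \<odot> minv A)))) (at A)"
  unfolding has_derivative_iff_norm
proof
  show "bounded_linear (\<lambda>W. - (minv A \<odot> (W \<odot> minv A)))"
    by (intro bounded_linear_minus bounded_linear_compose[OF mprod.bounded_linear_right]
        bounded_linear_compose[OF mprod.bounded_linear_left] bounded_linear_ident)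
  obtain K where K: "K > 0" "\<And>A B :: 'N qmat. norm (A \<odot> B) \<le> norm A * norm B * K"
    using mprod.pos_bounded by blast
  have "\<forall>\<^sub>F B in at A. minvertible B"
    using open_minvertible assms unfolding eventually_at_topological by blast
  then have "\<forall>\<^sub>F B in at A. norm (norm (minv B - minv A - - (minv A \<odot> ((B - A) \<odot> minv A))) / norm (B - A))
      \<le> norm (minv A - minv B) * norm (minv A) * K * K"
  proof eventually_elim
    fix B :: "'N qmat" assume B: "minvertible B"
    have "minv B - minv A - - (minv A \<odot> ((B - A) \<odot> minv A)) = (minv A - minv B) \<odot> ((B - A) \<odot> minv A)"
      unfolding minv_diff[OF assms B] by (simp add: mprod.diff_left)
    also have "norm \<dots> \<le> norm (minv A - minv B) * norm ((B - A) \<odot> minv A) * K"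
      by (rule K)
    also have "\<dots> \<le> norm (minv A - minv B) * (norm (B - A) * norm (minv A) * K) * K"
      using K by (intro mult_right_mono mult_left_mono) auto
    finally show "norm (norm (minv B - minv A - - (minv A \<odot> ((B - A) \<odot> minv A))) / norm (B - A))
      \<le> norm (minv A - minv B) * norm (minv A) * K * K"
      using K by (cases "B = A") (simp_all add: divide_simps mult_ac)
  qed
  moreover have "isCont (\<lambda>B. norm (minv A - minv B) * norm (minv A) * K * K) A"
    by (intro continuous_intros isCont_minv assms)
  then have "((\<lambda>B. norm (minv A - minv B) * norm (minv A) * K * K) \<longlongrightarrow> 0) (at A)"
    by (simp add: isCont_def)
  ultimately show "((\<lambda>B. norm (minv B - minv A - - (minv A \<odot> ((B - A) \<odot> minv A))) / norm (B - A)) \<longlongrightarrow> 0) (at A)"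
    by (rule Lim_null_comparison)
qed

text \<open>Functions on \<open>U\<close> built from constants and linear maps by sums, products and inverses. The class
  is closed under directional derivatives, so all its members are smooth.\<close>

inductive rational_on :: "'a::real_normed_vector set \<Rightarrow> ('a \<Rightarrow> 'N::finite qmat) \<Rightarrow> bool" for U where
  const: "rational_on U (\<lambda>x. C)"
| linear: "bounded_linear L \<Longrightarrow> rational_on U L"
| compose: "rational_on U f \<Longrightarrow> bounded_linear L \<Longrightarrow> rational_on U (\<lambda>x. L (f x))"
| add: "rational_on U f \<Longrightarrow> rational_on U h \<Longrightarrow> rational_on U (\<lambda>x. f x + h x)"
| mult: "rational_on U f \<Longrightarrow> rational_on U h \<Longrightarrow> rational_on U (\<lambda>x. f x \<odot> h x)"
| inv: "rational_on U f \<Longrightarrow> \<forall>x\<in>U. minvertible (f x) \<Longrightarrow> rational_on U (\<lambda>x. minv (f x))"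

lemma rational_on_minus: "rational_on U f \<Longrightarrow> rational_on U (\<lambda>x. - f x)"
  using rational_on.compose[of U f uminus] by (simp add: bounded_linear_minus bounded_linear_ident)

lemma rational_on_diff: "rational_on U f \<Longrightarrow> rational_on U h \<Longrightarrow> rational_on U (\<lambda>x. f x - h x)"
  using rational_on.add[of U f "\<lambda>x. - h x"] rational_on_minus[of U h] by simp

lemma rational_on_continuous: "rational_on U f \<Longrightarrow> continuous_on U f"
proof (induction rule: rational_on.induct)
  case (linear L)
  then show ?case by (simp add: linear_continuous_on)
next
  case (compose f L)
  then show ?case
    using bounded_linear.continuous_on by blast
next
  case (mult f h)
  then show ?case by (intro mprod.continuous_on)
next
  case (inv f)
  have "continuous_on (f ` U) minv"
    using inv(2) isCont_minv by (intro continuous_at_imp_continuous_on) auto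
  from continuous_on_compose[OF inv(3) this] show ?case by (simp add: comp_def)
qed (auto intro: continuous_intros)

lemma rational_on_deriv:
  "rational_on U f \<Longrightarrow> \<exists>f'. rational_on U f' \<and>
    (\<forall>x\<in>U. ((\<lambda>t. f (x + t *\<^sub>R v)) has_vector_derivative f' x) (at 0))"
proof (induction rule: rational_on.induct)
  case (const C)
  show ?case
    by (intro exI[of _ "\<lambda>x. 0"] conjI rational_on.const) simp
next
  case (linear L)
  have "((\<lambda>t. x + t *\<^sub>R v) has_vector_derivative v) (at 0)" for x
    using has_vector_derivative_add[OF has_vector_derivative_const
        has_vector_derivative_scaleR[OF DERIV_ident has_vector_derivative_const]] by simp
  then show ?case
    using linear by (intro exI[of _ "\<lambda>x. L v"] conjI rational_on.const ballI)
      (rule bounded_linear.has_vector_derivative)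
next
  case (compose f L)
  then obtain f' where "rational_on U f'"
    "\<forall>x\<in>U. ((\<lambda>t. f (x + t *\<^sub>R v)) has_vector_derivative f' x) (at 0)" by blast
  with compose(2) show ?case
    by (intro exI[of _ "\<lambda>x. L (f' x)"] conjI rational_on.compose[where L = L] ballI
        bounded_linear.has_vector_derivative[of L]) simp_all
next
  case (add f h)
  then obtain f' h' where "rational_on U f'" "rational_on U h'"
    "\<forall>x\<in>U. ((\<lambda>t. f (x + t *\<^sub>R v)) has_vector_derivative f' x) (at 0)"
    "\<forall>x\<in>U. ((\<lambda>t. h (x + t *\<^sub>R v)) has_vector_derivative h' x) (at 0)" by blast
  then show ?case
    by (intro exI[of _ "\<lambda>x. f' x + h' x"]) (auto intro: rational_on.add has_vector_derivative_add)
next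
  case (mult f h)
  then obtain f' h' where fh: "rational_on U f'" "rational_on U h'"
    "\<forall>x\<in>U. ((\<lambda>t. f (x + t *\<^sub>R v)) has_vector_derivative f' x) (at 0)"
    "\<forall>x\<in>U. ((\<lambda>t. h (x + t *\<^sub>R v)) has_vector_derivative h' x) (at 0)" by blast
  have "((\<lambda>t. f (x + t *\<^sub>R v) \<odot> h (x + t *\<^sub>R v)) has_vector_derivative f x \<odot> h' x + f' x \<odot> h x) (at 0)"
    if "x \<in> U" for x
    using mprod.has_vector_derivative[of "\<lambda>t. f (x + t *\<^sub>R v)" "f' x" 0 UNIV "\<lambda>t. h (x + t *\<^sub>R v)" "h' x"]
      fh(3,4) that by simp
  with fh(1,2) mult(1,2) show ?case
    by (intro exI[of _ "\<lambda>x. f x \<odot> h' x + f' x \<odot> h x"]) (auto intro: rational_on.add rational_on.mult)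
next
  case (inv f)
  then obtain f' where f': "rational_on U f'"
    "\<forall>x\<in>U. ((\<lambda>t. f (x + t *\<^sub>R v)) has_vector_derivative f' x) (at 0)" by blast
  have "((\<lambda>t. minv (f (x + t *\<^sub>R v))) has_vector_derivative - (minv (f x) \<odot> (f' x \<odot> minv (f x)))) (at 0)"
    if "x \<in> U" for x
    using vector_derivative_diff_chain_within[of "\<lambda>t. f (x + t *\<^sub>R v)" "f' x" 0 UNIV minv]
      minv_has_derivative[of "f x"] f'(2) inv(2) that
    by (auto simp: comp_def intro: has_derivative_at_withinI)
  moreover have "rational_on U (\<lambda>x. - (minv (f x) \<odot> (f' x \<odot> minv (f x))))"
    by (intro rational_on_minus rational_on.mult rational_on.inv[where f = f] f'(1) inv(1,2))
  ultimately show ?case by blast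
qed

lemma smooth_on_rational:
  assumes "open U" and f: "rational_on U f"
  shows "smooth_on U f"
proof -
  have transfer: "((\<lambda>t. k (x + t *\<^sub>R v)) has_vector_derivative d) (at 0)"
    if "((\<lambda>t. h (x + t *\<^sub>R v)) has_vector_derivative d) (at 0)" "x \<in> U" "\<And>y. y \<in> U \<Longrightarrow> k y = h y"
    for h k :: "'a \<Rightarrow> 'b qmat" and x v d
  proof (rule has_vector_derivative_transform_within_open[OF that(1)])
    show "open ((\<lambda>t. x + t *\<^sub>R v) -` U)"
      by (intro open_vimage \<open>open U\<close> continuous_intros)
  qed (use that in auto)
  \<comment> \<open>Off U the values of \<open>ddiff\<close> are uncontrolled, so they are matched
    with a rational function on U only; \<open>transfer\<close> uses that U is open to carry this
    over to derivatives.\<close>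
  have ex: "\<exists>h. rational_on U h \<and> (\<forall>x\<in>U. ddiff vs f x = h x)" for vs
  proof (induction vs)
    case Nil
    then show ?case using f by auto
  next
    case (Cons v vs)
    then obtain h where h: "rational_on U h" "\<forall>x\<in>U. ddiff vs f x = h x" by blast
    obtain h' where h': "rational_on U h'"
      "\<forall>x\<in>U. ((\<lambda>t. h (x + t *\<^sub>R v)) has_vector_derivative h' x) (at 0)"
      using rational_on_deriv[OF h(1)] by blast
    have "ddiff (v # vs) f x = h' x" if "x \<in> U" for x
      using transfer[of h x v "h' x" "ddiff vs f"] h h' that by (simp add: vector_derivative_at)
    with h'(1) show ?case by blast
  qed
  show ?thesis
    unfolding smooth_on_def
  proof (intro allI conjI ballI)
    fix vs
    obtain h where h: "rational_on U h" "\<forall>x\<in>U. ddiff vs f x = h x" using ex by blast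
    show "continuous_on U (ddiff vs f)"
      using rational_on_continuous[OF h(1)] h(2) by (simp cong: continuous_on_cong_simp)
    fix v x assume x: "x \<in> U"
    obtain h' where h': "rational_on U h'"
      "\<forall>x\<in>U. ((\<lambda>t. h (x + t *\<^sub>R v)) has_vector_derivative h' x) (at 0)"
      using rational_on_deriv[OF h(1)] by blast
    have "((\<lambda>t. ddiff vs f (x + t *\<^sub>R v)) has_vector_derivative h' x) (at 0)"
      using transfer[of h x v "h' x" "ddiff vs f"] h h' x by simp
    then show "((\<lambda>t. ddiff vs f (x + t *\<^sub>R v)) has_vector_derivative ddiff (v # vs) f x) (at 0)"
      by (simp add: vector_derivative_at)
  qed
qed

lemma smooth_on_real_deriv:
  fixes \<gamma> :: "real \<Rightarrow> 'a::real_normed_vector"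
  assumes "smooth_on U \<gamma>" "t \<in> U"
  shows "(\<gamma> has_vector_derivative ddiff [1] \<gamma> t) (at t)"
    "(ddiff [1] \<gamma> has_vector_derivative ddiff [1, 1] \<gamma> t) (at t)"
proof -
  have *: "((\<lambda>s. ddiff vs \<gamma> (t + s)) has_vector_derivative ddiff (1 # vs) \<gamma> t) (at 0)" for vs
    using assms(1)[unfolded smooth_on_def, rule_format, of vs] assms(2) by (auto dest: spec[of _ 1])
  have "(ddiff vs \<gamma> has_vector_derivative ddiff (1 # vs) \<gamma> t) (at t)" for vs
  proof -
    have "((\<lambda>y. y - t) has_vector_derivative 1) (at t)"
      using has_vector_derivative_diff[OF has_vector_derivative_id has_vector_derivative_const] by simp
    from vector_diff_chain_at[OF this, of "\<lambda>s. ddiff vs \<gamma> (t + s)"] *[of vs] show ?thesis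
      by (simp add: comp_def)
  qed
  from this[of "[]"] this[of "[1]"] show
    "(\<gamma> has_vector_derivative ddiff [1] \<gamma> t) (at t)"
    "(ddiff [1] \<gamma> has_vector_derivative ddiff [1, 1] \<gamma> t) (at t)" by simp_all
qed

section \<open>Grassmannians as spaces of projectors\<close>

definition mv :: "('N::finite) qmat \<Rightarrow> quat ^ 'N \<Rightarrow> quat ^ 'N" where
  "mv A x = (\<chi> i. \<Sum>j\<in>UNIV. qmult (A $ i $ j) (x $ j))"

lemma mv_add: "mv (A + B) x = mv A x + mv B x"
  by (simp add: mv_def vec_eq_iff qmult.add_left sum.distrib)

lemma mv_diff: "mv (A - B) x = mv A x - mv B x"
  by (simp add: mv_def vec_eq_iff qmult.diff_left sum_subtractf)

lemma mv_sum: "mv (\<Sum>i\<in>I. A i) x = (\<Sum>i\<in>I. mv (A i) x)"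
  by (induction I rule: infinite_finite_induct)
     (simp_all add: mv_add, simp_all add: mv_def vec_eq_iff qmult.zero_left)

lemma mv_zero_left [simp]: "mv 0 x = 0"
  by (simp add: mv_def vec_eq_iff qmult.zero_left)

lemma mv_zero_right [simp]: "mv A 0 = 0"
  by (simp add: mv_def vec_eq_iff qmult.zero_right)

lemma mv_scaleR: "mv A (r *\<^sub>R x) = r *\<^sub>R mv A x"
  by (simp add: mv_def vec_eq_iff qmult.scaleR_right scaleR_sum_right)

lemma mv_mprod: "mv (A \<odot> B) x = mv A (mv B x)"
proof -
  have "(\<Sum>l\<in>UNIV. qmult (\<Sum>k\<in>UNIV. qmult (A $ i $ k) (B $ k $ l)) (x $ l))
      = (\<Sum>k\<in>UNIV. qmult (A $ i $ k) (\<Sum>l\<in>UNIV. qmult (B $ k $ l) (x $ l)))" for i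
    unfolding qmult.sum_left qmult.sum_right qmult_assoc by (rule sum.swap)
  then show ?thesis by (simp add: mprod_def mv_def vec_eq_iff)
qed

lemma mprod_eq_iff_columns: "A \<odot> B = C \<longleftrightarrow> (\<forall>j. mv A (\<chi> i. B $ i $ j) = (\<chi> i. C $ i $ j))"
  by (auto simp: vec_eq_iff mprod_def mv_def)

lemma fvec_iff: "fvec c x \<longleftrightarrow> (\<forall>i. qproj c (x $ i) = x $ i)"
  by (simp add: fvec_def scal_iff)

lemma fvec_column: "mproj c A = A \<Longrightarrow> fvec c (\<chi> i. A $ i $ j)"
  by (simp add: fvec_iff mproj_nth)

lemma finner_add: "finner (x + y) z = finner x z + finner y z"
  by (simp add: finner_def qmult.add_right sum.distrib)

lemma finner_sum: "finner (\<Sum>i\<in>I. x i) z = (\<Sum>i\<in>I. finner (x i) z)"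
  by (induction I rule: infinite_finite_induct)
     (simp_all add: finner_add, simp_all add: finner_def qmult.zero_right)

lemma finner_vscal: "finner (vscal x a) y = qmult (finner x y) a"
  by (simp add: finner_def vscal_def qmult.sum_left qmult_assoc)

lemma qconj_finner: "qconj (finner x y) = finner y x"
  by (simp add: finner_def linear_sum[OF linear_qconj] qconj_qmult)

lemma finner_self: "finner x x = qreal ((norm x)\<^sup>2)"
proof -
  have "finner x x = (\<Sum>i\<in>UNIV. (norm (x $ i))\<^sup>2) *\<^sub>R qone"
    by (simp add: finner_def qmult_qconj_self qreal_conv_scaleR scaleR_sum_left)
  then show ?thesis
    by (simp add: qreal_conv_scaleR norm_vec_def L2_set_def sum_nonneg)
qed

lemma qproj_finner: "fvec c x \<Longrightarrow> fvec c y \<Longrightarrow> qproj c (finner x y) = finner x y"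
  by (simp add: finner_def fvec_iff linear_sum[OF linear_qproj] qproj_qmult_right qproj_qconj)

lemma vscal_qone [simp]: "vscal x qone = x"
  by (simp add: vscal_def vec_eq_iff)

lemma vscal_zero [simp]: "vscal x 0 = 0"
  by (simp add: vscal_def vec_eq_iff qmult.zero_right)

lemma fvec_vscal: "fvec c x \<Longrightarrow> qproj c a = a \<Longrightarrow> fvec c (vscal x a)"
  by (simp add: fvec_iff vscal_def qproj_qmult_left)

lemma fvec_add: "fvec c x \<Longrightarrow> fvec c y \<Longrightarrow> fvec c (x + y)"
  by (simp add: fvec_iff linear_add[OF linear_qproj])

lemma fvec_sum: "(\<And>i. i \<in> I \<Longrightarrow> fvec c (x i)) \<Longrightarrow> fvec c (\<Sum>i\<in>I. x i)"
  by (simp add: fvec_iff linear_sum[OF linear_qproj])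

lemma mv_outer: "mv (outer u) x = vscal u (finner x u)"
  by (simp add: mv_def outer_def vscal_def finner_def vec_eq_iff qmult.sum_right qmult_assoc)

lemma outer_mprod_outer: "outer u \<odot> outer w = (\<chi> i j. qmult (u $ i) (qmult (finner w u) (qconj (w $ j))))"
  by (simp add: mprod_def outer_def finner_def vec_eq_iff qmult.sum_right qmult.sum_left qmult_assoc)

lemma outer_idem: "finner u u = qone \<Longrightarrow> outer u \<odot> outer u = outer u"
  by (simp add: outer_mprod_outer) (simp add: outer_def)

lemma outer_orthogonal: "finner w u = 0 \<Longrightarrow> outer u \<odot> outer w = 0"
  by (simp add: outer_mprod_outer vec_eq_iff qmult.zero_left qmult.zero_right)

lemma madj_outer [simp]: "madj (outer u) = outer u"
  by (simp add: madj_def outer_def vec_eq_iff qconj_qmult)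

lemma mproj_outer: "fvec c u \<Longrightarrow> mproj c (outer u) = outer u"
  by (simp add: mproj_nth fvec_iff outer_def qproj_qmult_left qproj_qconj)

lemma rtr_outer: "rtr (outer u) = qre (finner u u)"
  by (simp add: rtr_def outer_def finner_def linear_sum[OF linear_qre] qre_qmult_commute)

lemma mprod_outer_fixed: "mv P u = u \<Longrightarrow> P \<odot> outer u = outer u"
proof -
  assume *: "mv P u = u"
  have "(P \<odot> outer u) $ i $ j = qmult (mv P u $ i) (qconj (u $ j))" for i j
    by (simp add: mprod_def outer_def mv_def qmult.sum_left qmult_assoc)
  with * show ?thesis by (simp add: vec_eq_iff outer_def)
qed

section \<open>Projectors and their fixed spaces\<close>

definition projector :: "nat \<Rightarrow> ('N::finite) qmat \<Rightarrow> bool" where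
  "projector c P \<longleftrightarrow> mproj c P = P \<and> madj P = P \<and> P \<odot> P = P"

definition fixspace :: "nat \<Rightarrow> ('N::finite) qmat \<Rightarrow> (quat ^ 'N) set" where
  "fixspace c P = {x. fvec c x \<and> mv P x = x}"

text \<open>P = P P* turns the trace into a squared norm. The positivity and definiteness that
  follow let the trace stand in for the rank.\<close>

lemma rtr_projector: "projector c P \<Longrightarrow> rtr P = P \<bullet> P"
  by (metis projector_def rtr_mprod_madj)

lemma rtr_projector_nonneg: "projector c P \<Longrightarrow> 0 \<le> rtr P"
  by (simp add: rtr_projector)

lemma rtr_projector_eq_0: "projector c P \<Longrightarrow> rtr P = 0 \<Longrightarrow> P = 0"
  by (simp add: rtr_projector)

lemma projector_diff:
  assumes "projector c P" "projector c Q" "P \<odot> Q = Q"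
  shows "projector c (P - Q)"
proof -
  have "Q \<odot> P = Q"
    using assms by (metis madj_mprod projector_def)
  with assms show ?thesis
    by (simp add: projector_def malg)
qed

lemma projector_add:
  assumes "projector c P" "projector c Q" "P \<odot> Q = 0"
  shows "projector c (P + Q)"
proof -
  have "Q \<odot> P = 0"
    using assms by (metis madj_linear(4) madj_mprod projector_def)
  with assms show ?thesis
    by (simp add: projector_def malg)
qed

lemma projector_outer: "fvec c u \<Longrightarrow> finner u u = qone \<Longrightarrow> projector c (outer u)"
  by (simp add: projector_def mproj_outer outer_idem)

lemma projector_mone: "projector c mone"
  by (simp add: projector_def)

text \<open>Splits off one vector at a time: a nonzero column of P, normalised to u, is fixed by P,
  and P - \<open>outer u\<close> is a projector whose trace is smaller by one.\<close>

lemma projector_orthonormal_basis: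
  assumes "projector c P"
  shows "\<exists>m es. orthonormal c m es \<and> P = (\<Sum>i<m. outer (es i))"
proof -
  \<comment> \<open>The trace is not yet known to be an integer, so the induction runs on a natural
    number above it.\<close>
  have "\<exists>m es. orthonormal c m es \<and> P = (\<Sum>i<m. outer (es i))" if "rtr P < real k" "projector c P" for k P
    using that
  proof (induction k arbitrary: P)
    case 0
    then show ?case using rtr_projector_nonneg[of c P] by simp
  next
    case (Suc k)
    show ?case
    proof (cases "P = 0")
      case True
      then show ?thesis
        by (intro exI[of _ 0]) (simp add: orthonormal_def)
    next
      case False
      then obtain i j where "P $ i $ j \<noteq> 0" by (auto simp: vec_eq_iff)
      define w where "w = (\<chi> i. P $ i $ j)"
      have w: "w \<noteq> 0" "fvec c w" "mv P w = w"
      proof -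
        show "w \<noteq> 0" using \<open>P $ i $ j \<noteq> 0\<close> by (auto simp: w_def vec_eq_iff)
        show "fvec c w" using Suc(3) by (simp add: w_def fvec_column projector_def)
        show "mv P w = w"
          using Suc(3) mprod_eq_iff_columns[of P P P] by (simp add: w_def projector_def)
      qed
      define u where "u = (1 / norm w) *\<^sub>R w"
      have u: "finner u u = qone" "fvec c u" "mv P u = u"
        using w by (simp_all add: u_def finner_self qreal_conv_scaleR fvec_iff
            linear_scale[OF linear_qproj] mv_scaleR)
      define Q where "Q = P - outer u"
      have Q: "projector c Q"
        unfolding Q_def using Suc(3) u by (intro projector_diff projector_outer mprod_outer_fixed)
      moreover have "rtr Q < real k"
        using Suc(2) u by (simp add: Q_def rtr_outer)
      ultimately obtain m es where es: "orthonormal c m es" "Q = (\<Sum>i<m. outer (es i))"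
        using Suc(1) by blast
      \<comment> \<open>Expanding Q u = 0 in the basis found for Q and pairing with
        \<open>es k\<close> shows that u is orthogonal to that basis.\<close>
      have "mv Q u = 0"
        by (simp add: Q_def mv_diff mv_outer u)
      then have 0: "(\<Sum>i<m. vscal (es i) (finner u (es i))) = 0"
        by (simp add: es(2) mv_sum mv_outer)
      have orth: "finner u (es k) = 0" if "k < m" for k
      proof -
        have "finner (\<Sum>i<m. vscal (es i) (finner u (es i))) (es k)
            = (\<Sum>i<m. if i = k then finner u (es i) else 0)"
          unfolding finner_sum finner_vscal
          using es(1) that by (intro sum.cong) (auto simp: orthonormal_def qmult.zero_left)
        also have "\<dots> = finner u (es k)"
          using that by simp
        finally show ?thesis
          unfolding 0 by (simp add: finner_def qmult.zero_right)
      qed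
      then have orth': "finner (es k) u = 0" if "k < m" for k
        using that qconj_finner[of u "es k"] by simp
      have "orthonormal c (Suc m) (es(m := u))"
        using es(1) u orth orth' by (auto simp: orthonormal_def less_Suc_eq)
      moreover have "P = (\<Sum>i<Suc m. outer ((es(m := u)) i))"
        using es(2) by (simp add: Q_def algebra_simps)
      ultimately show ?thesis by blast
    qed
  qed
  from this[OF _ assms] show ?thesis
    using reals_Archimedean2 by blast
qed

lemma orthonormal_projector:
  fixes es :: "nat \<Rightarrow> quat ^ 'N::finite"
  assumes "orthonormal c m es"
  shows "projector c (\<Sum>i<m. outer (es i))" "rtr (\<Sum>i<m. outer (es i)) = real m"
    "fixspace c (\<Sum>i<m. outer (es i)) = spanF c m es"
proof -
  let ?P = "\<Sum>i<m. outer (es i)"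
  have es: "\<And>i. i < m \<Longrightarrow> fvec c (es i)"
    "\<And>i j. i < m \<Longrightarrow> j < m \<Longrightarrow> finner (es i) (es j) = (if i = j then qone else 0)"
    using assms by (auto simp: orthonormal_def)
  have "?P \<odot> ?P = (\<Sum>i<m. \<Sum>j<m. outer (es i) \<odot> outer (es j))"
    by (simp only: mprod.sum_left mprod.sum_right) (rule sum.swap)
  also have "\<dots> = (\<Sum>i<m. \<Sum>j<m. if j = i then outer (es i) else 0)"
    by (intro sum.cong) (auto simp: es outer_idem outer_orthogonal)
  also have "\<dots> = ?P" by simp
  finally show "projector c ?P"
    by (simp add: projector_def linear_sum[OF linear_madj] linear_sum[OF linear_mproj] mproj_outer es)
  show "rtr ?P = real m"
    by (simp add: linear_sum[OF linear_rtr] rtr_outer es)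
  show "fixspace c ?P = spanF c m es"
  proof (intro subset_antisym subsetI)
    fix x assume "x \<in> fixspace c ?P"
    then show "x \<in> spanF c m es"
      by (auto simp: fixspace_def spanF_def mv_sum mv_outer scal_iff es qproj_finner
          intro!: exI[of _ "\<lambda>i. finner x (es i)"])
  next
    fix x assume "x \<in> spanF c m es"
    then obtain a where a: "\<And>i. i < m \<Longrightarrow> qproj c (a i) = a i" and x: "x = (\<Sum>i<m. vscal (es i) (a i))"
      by (auto simp: spanF_def scal_iff)
    have "finner x (es k) = a k" if "k < m" for k
    proof -
      have "finner x (es k) = (\<Sum>i<m. if i = k then a i else 0)"
        unfolding x finner_sum finner_vscal
        using es that by (intro sum.cong) (auto simp: qmult.zero_left)
      then show ?thesis using that by simp
    qed
    then have "mv ?P x = x"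
      by (simp add: mv_sum mv_outer x)
    then show "x \<in> fixspace c ?P"
      using es a by (auto simp: fixspace_def x intro!: fvec_sum fvec_vscal)
  qed
qed

definition proj :: "nat \<Rightarrow> nat \<Rightarrow> ('N::finite) qmat set" where
  "proj c n = {P. projector c P \<and> rtr P = real n}"

text \<open>The columns of Q lie in its fixed space, and P Q = Q is a statement about these
  columns.\<close>

lemma fixspace_subset:
  assumes "mproj c Q = Q" "Q \<odot> Q = Q" "fixspace c Q \<subseteq> fixspace c P"
  shows "P \<odot> Q = Q"
proof -
  have "mv P (\<chi> i. Q $ i $ j) = (\<chi> i. Q $ i $ j)" for j
    using assms fvec_column[OF assms(1), of j] mprod_eq_iff_columns[of Q Q Q] by (auto simp: fixspace_def)
  then show ?thesis
    by (simp add: mprod_eq_iff_columns)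
qed

lemma fixspace_inject:
  assumes "projector c P" "projector c Q" "fixspace c P = fixspace c Q"
  shows "P = Q"
proof -
  have "P \<odot> Q = Q" "Q \<odot> P = P"
    using assms by (auto intro: fixspace_subset simp: projector_def)
  then show ?thesis
    using assms by (metis madj_mprod projector_def)
qed

lemma grass_eq: "grass c n = fixspace c ` proj c n"
proof (intro subset_antisym subsetI)
  fix \<pi> :: "(quat ^ 'a) set" assume "\<pi> \<in> grass c n"
  then show "\<pi> \<in> fixspace c ` proj c n"
    using orthonormal_projector by (fastforce simp: grass_def proj_def)
next
  fix \<pi> :: "(quat ^ 'a) set" assume "\<pi> \<in> fixspace c ` proj c n"
  then obtain P where P: "projector c P" "rtr P = real n" "\<pi> = fixspace c P"
    by (auto simp: proj_def)
  obtain m es where es: "orthonormal c m es" "P = (\<Sum>i<m. outer (es i))"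
    using projector_orthonormal_basis[OF P(1)] by blast
  \<comment> \<open>Both numbers equal the trace of P.\<close>
  with P(2) have "m = n"
    using orthonormal_projector(2)[OF es(1)] by simp
  with es P(3) show "\<pi> \<in> grass c n"
    using orthonormal_projector(3)[OF es(1)] by (auto simp: grass_def)
qed

text \<open>The \<open>SOME\<close> in \<open>phi\<close> is harmless: every orthonormal basis sums
  to a projector whose range is the span, and a projector is determined by its range.\<close>

lemma phi_fixspace:
  assumes "P \<in> proj c n"
  shows "phi c n (fixspace c P) = P"
proof -
  define es where "es = (SOME es. orthonormal c n es \<and> spanF c n es = fixspace c P)"
  have "fixspace c P \<in> grass c n"
    using assms by (simp add: grass_eq)
  then have "\<exists>es. orthonormal c n es \<and> spanF c n es = fixspace c P"
    by (auto simp: grass_def)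
  then have es: "orthonormal c n es \<and> spanF c n es = fixspace c P"
    unfolding es_def by (rule someI_ex)
  then have "(\<Sum>i<n. outer (es i)) = P"
    using assms orthonormal_projector[of c n es] by (auto intro!: fixspace_inject simp: proj_def)
  then show ?thesis
    by (simp add: phi_def es_def)
qed

lemma phi_image_grass: "phi c n ` {\<pi> \<in> grass c n. R \<pi>} = {P \<in> proj c n. R (fixspace c P)}"
  by (auto simp: grass_eq phi_fixspace intro: rev_image_eqI)

text \<open>The projector onto the coordinate plane of i1 and i2, equal to the sum of the two line
  projectors \<open>dmat 1 i1 i2\<close> and \<open>dmat (- 1) i1 i2\<close>. The action of P on
  this plane singles out each critical set.\<close>

definition jmat :: "('N::finite) \<Rightarrow> 'N \<Rightarrow> 'N qmat" where
  "jmat i1 i2 = (\<chi> i j. if i = j \<and> (i = i1 \<or> i = i2) then qone else 0)"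

abbreviation dmat :: "real \<Rightarrow> ('N::finite) \<Rightarrow> 'N \<Rightarrow> 'N qmat" where
  "dmat s i1 i2 \<equiv> outer (diagv s i1 i2)"

lemma qmult_qreal: "qmult (qreal a) (qreal b) = qreal (a * b)"
  by (simp add: qmult_def qreal_def)

lemma qreal_0_1: "qreal 0 = 0" "qreal 1 = qone"
  by (simp_all add: qreal_def qone_def zero_prod_def)

lemma qreal_add_diff: "qreal a + qreal b = qreal (a + b)" "qreal a - qreal b = qreal (a - b)"
  by (simp_all add: qreal_def)

lemma dmat_sum_diff:
  assumes "i1 \<noteq> i2"
  shows "dmat 1 i1 i2 + dmat (- 1) i1 i2 = jmat i1 i2" "dmat 1 i1 i2 - dmat (- 1) i1 i2 = E12 i1 i2"
  using assms by (auto simp: vec_eq_iff outer_def diagv_def jmat_def E12_def qmult_qreal qmult.zero_left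
      qmult.zero_right qreal_add_diff qreal_0_1)

lemma fvec_diagv: "fvec c (diagv s i1 i2)"
  by (simp add: fvec_iff diagv_def)

lemma finner_diagv:
  assumes "i1 \<noteq> i2"
  shows "finner (diagv s i1 i2) (diagv t i1 i2) = qreal ((1 + s * t) / 2)"
proof -
  have "finner (diagv s i1 i2) (diagv t i1 i2)
    = (\<Sum>i\<in>UNIV. (if i = i1 then qreal (1/2) else 0) + (if i = i2 then qreal (s * t / 2) else 0))"
    unfolding finner_def using assms
    by (intro sum.cong) (auto simp: diagv_def qmult_qreal qmult.zero_left mult_ac)
  also have "\<dots> = qreal ((1 + s * t) / 2)"
    by (simp add: sum.distrib qreal_conv_scaleR add_divide_distrib flip: scaleR_add_left)
  finally show ?thesis .
qed

lemma jmat_mprod_eq_0: "jmat i1 i2 \<odot> A = 0 \<longleftrightarrow> (\<forall>j. A $ i1 $ j = 0 \<and> A $ i2 $ j = 0)"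
proof -
  have "(jmat i1 i2 \<odot> A) $ i $ j = (if i = i1 \<or> i = i2 then A $ i $ j else 0)" for i j
  proof -
    have "qmult (jmat i1 i2 $ i $ l) (A $ l $ j)
        = (if l = i then (if i = i1 \<or> i = i2 then A $ i $ j else 0) else 0)" for l
      by (auto simp: jmat_def qmult.zero_left)
    then show ?thesis by (simp add: mprod_def)
  qed
  then show ?thesis by (auto simp: vec_eq_iff)
qed

lemma mv_stdb: "mv A (stdb k) = (\<chi> i. A $ i $ k)"
proof -
  have "(\<Sum>j\<in>UNIV. qmult (A $ i $ j) (stdb k $ j)) = (\<Sum>j\<in>UNIV. if j = k then A $ i $ k else 0)" for i
    by (intro sum.cong) (auto simp: stdb_def qmult.zero_right)
  then show ?thesis by (simp add: mv_def vec_eq_iff)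
qed

lemma fvec_stdb: "fvec c (stdb k)"
  by (simp add: fvec_iff stdb_def)

lemma mprod_jmat_eq: "P \<odot> jmat i1 i2 = jmat i1 i2 \<longleftrightarrow> mv P (stdb i1) = stdb i1 \<and> mv P (stdb i2) = stdb i2"
proof -
  have "(\<chi> i. jmat i1 i2 $ i $ j) = (if j = i1 \<or> j = i2 then stdb j else 0)" for j
    by (auto simp: jmat_def stdb_def vec_eq_iff)
  then show ?thesis
    unfolding mprod_eq_iff_columns by auto
qed

lemma jmat_simps:
  "madj (jmat i1 i2) = jmat i1 i2" "mproj c (jmat i1 i2) = jmat i1 i2" "jmat i1 i2 \<odot> jmat i1 i2 = jmat i1 i2"
proof -
  show "madj (jmat i1 i2) = jmat i1 i2" "mproj c (jmat i1 i2) = jmat i1 i2"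
    by (auto simp: madj_def mproj_def jmat_def vec_eq_iff)
  show "jmat i1 i2 \<odot> jmat i1 i2 = jmat i1 i2"
    unfolding mprod_jmat_eq mv_stdb by (auto simp: jmat_def stdb_def vec_eq_iff)
qed

lemma fixspace_subset_Vsub:
  assumes "projector c P"
  shows "fixspace c P \<subseteq> Vsub c i1 i2 \<longleftrightarrow> jmat i1 i2 \<odot> P = 0"
proof
  assume "fixspace c P \<subseteq> Vsub c i1 i2"
  moreover have "(\<chi> i. P $ i $ j) \<in> fixspace c P" for j
    using assms fvec_column[of c P j] mprod_eq_iff_columns[of P P P] by (simp add: fixspace_def projector_def)
  ultimately have "(\<chi> i. P $ i $ j) \<in> Vsub c i1 i2" for j
    by blast
  then show "jmat i1 i2 \<odot> P = 0"
    by (simp add: jmat_mprod_eq_0 Vsub_def)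
next
  assume "jmat i1 i2 \<odot> P = 0"
  then have "mv P x $ i1 = 0" "mv P x $ i2 = 0" for x
    by (simp_all add: jmat_mprod_eq_0 mv_def qmult.zero_left)
  then show "fixspace c P \<subseteq> Vsub c i1 i2"
    by (auto simp: fixspace_def Vsub_def) metis+
qed

lemma fixspace_add_outer:
  assumes "projector c Q" "outer u \<odot> Q = 0" "fvec c u" "finner u u = qone"
  shows "fixspace c (outer u + Q) = line_plus c u (fixspace c Q)"
proof -
  have mvQ: "mv (outer u) (mv Q x) = 0" "mv Q (mv (outer u) x) = 0" for x
  proof -
    have "Q \<odot> outer u = 0"
      using assms(1,2) by (metis madj_linear(4) madj_mprod madj_outer projector_def)
    with assms(2) show "mv (outer u) (mv Q x) = 0" "mv Q (mv (outer u) x) = 0"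
      by (simp_all flip: mv_mprod)
  qed
  have mv_plus: "mv A (x + y) = mv A x + mv A y" for A :: "'a qmat" and x y
    by (simp add: mv_def vec_eq_iff qmult.add_right sum.distrib)
  show ?thesis
  proof (intro subset_antisym subsetI)
    fix x assume x: "x \<in> fixspace c (outer u + Q)"
    have fv: "fvec c (mv Q x)"
      using assms(1) x by (simp add: fvec_iff mv_def linear_sum[OF linear_qproj] fixspace_def projector_def
          mproj_nth qproj_qmult_left)
    have "mv Q (mv Q x) = mv Q x"
      using assms(1) by (simp add: projector_def flip: mv_mprod)
    with fv have "mv Q x \<in> fixspace c Q"
      by (simp add: fixspace_def)
    moreover have "x = vscal u (finner x u) + mv Q x"
      using x by (simp add: fixspace_def mv_add mv_outer)
    moreover have "finner x u \<in> scal c"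
      using x assms(3) by (simp add: scal_iff qproj_finner fixspace_def)
    ultimately show "x \<in> line_plus c u (fixspace c Q)"
      unfolding line_plus_def by blast
  next
    fix x assume "x \<in> line_plus c u (fixspace c Q)"
    then obtain a w where a: "qproj c a = a" "w \<in> fixspace c Q" "x = vscal u a + w"
      by (auto simp: line_plus_def scal_iff)
    have 1: "mv (outer u) (vscal u a) = vscal u a"
      by (simp add: mv_outer finner_vscal assms)
    have 2: "mv Q (vscal u a) = 0" "mv (outer u) w = 0"
      using mvQ(2)[of "vscal u a"] mvQ(1)[of w] a by (simp_all add: 1 fixspace_def)
    show "x \<in> fixspace c (outer u + Q)"
      using a 1 2 assms(3) by (simp add: fixspace_def mv_add mv_plus fvec_add fvec_vscal)
  qed
qed

text \<open>The right side says that P fixes \<open>diagv s i1 i2\<close> and annihilates the other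
  diagonal vector of the plane. Then P - \<open>dmat s i1 i2\<close> vanishes on the plane, and its
  range is the W sought.\<close>

lemma line_plus_diagv_iff:
  fixes i1 i2 :: "'N::finite"
  assumes "i1 \<noteq> i2" "s = 1 \<or> s = - 1" "P \<in> proj c n" "n \<ge> 1"
  shows "(\<exists>W \<in> grass c (n - 1). W \<subseteq> Vsub c i1 i2 \<and> fixspace c P = line_plus c (diagv s i1 i2) W)
    \<longleftrightarrow> P \<odot> jmat i1 i2 = dmat s i1 i2"
proof -
  let ?u = "diagv s i1 i2" and ?J = "jmat i1 i2"
  have u: "fvec c ?u" "finner ?u ?u = qone"
    using assms(1,2) by (auto simp: fvec_diagv finner_diagv qreal_0_1)
  have o: "dmat 1 i1 i2 \<odot> dmat (- 1) i1 i2 = 0" "dmat (- 1) i1 i2 \<odot> dmat 1 i1 i2 = 0"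
    using assms(1) by (simp_all add: outer_orthogonal finner_diagv qreal_0_1)
  have i: "dmat 1 i1 i2 \<odot> dmat 1 i1 i2 = dmat 1 i1 i2" "dmat (- 1) i1 i2 \<odot> dmat (- 1) i1 i2 = dmat (- 1) i1 i2"
    using assms(1) by (simp_all add: outer_idem finner_diagv qreal_0_1)
  have J: "outer ?u \<odot> ?J = outer ?u" "?J \<odot> outer ?u = outer ?u"
    using assms(2) unfolding dmat_sum_diff(1)[OF assms(1), symmetric] by (auto simp: malg o i)
  have P: "projector c P" "rtr P = real n" using assms(3) by (simp_all add: proj_def)
  show ?thesis
  proof
    assume "\<exists>W \<in> grass c (n - 1). W \<subseteq> Vsub c i1 i2 \<and> fixspace c P = line_plus c ?u W"
    then obtain Q where Q: "projector c Q" "fixspace c Q \<subseteq> Vsub c i1 i2"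
      "fixspace c P = line_plus c ?u (fixspace c Q)"
      by (auto simp: grass_eq proj_def)
    have JQ: "?J \<odot> Q = 0"
      using Q fixspace_subset_Vsub by blast
    then have QJ: "Q \<odot> ?J = 0"
      using Q(1) by (metis madj_linear(4) madj_mprod jmat_simps(1) projector_def)
    have uQ: "outer ?u \<odot> Q = 0"
      using mprod_assoc[of "outer ?u" ?J Q] by (simp add: J JQ mprod.zero_right)
    have "P = outer ?u + Q"
      using fixspace_add_outer[OF Q(1) uQ u] Q(3) P(1) projector_add[OF projector_outer[OF u] Q(1) uQ]
      by (intro fixspace_inject) auto
    then show "P \<odot> ?J = outer ?u"
      by (simp add: malg J QJ)
  next
    assume PJ: "P \<odot> ?J = outer ?u"
    define Q where "Q = P - outer ?u"
    have Pu: "P \<odot> outer ?u = outer ?u"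
      using mprod_extend[OF PJ, of "outer ?u"] by (simp add: J outer_idem u)
    then have Q: "projector c Q"
      unfolding Q_def by (intro projector_diff P projector_outer u)
    have "Q \<odot> ?J = 0"
      by (simp add: Q_def malg PJ J)
    then have JQ: "?J \<odot> Q = 0"
      using Q by (metis madj_linear(4) madj_mprod jmat_simps(1) projector_def)
    have "rtr Q = real (n - 1)"
      using assms(4) by (simp add: Q_def P rtr_outer u of_nat_diff)
    moreover have "outer ?u \<odot> Q = 0"
      using mprod_assoc[of "outer ?u" ?J Q] by (simp add: J JQ mprod.zero_right)
    then have "fixspace c P = line_plus c ?u (fixspace c Q)"
      using fixspace_add_outer[OF Q _ u] by (simp add: Q_def)
    ultimately show "\<exists>W \<in> grass c (n - 1). W \<subseteq> Vsub c i1 i2 \<and> fixspace c P = line_plus c ?u W"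
      using Q JQ fixspace_subset_Vsub[OF Q]
      by (intro bexI[of _ "fixspace c Q"]) (auto simp: grass_eq proj_def)
  qed
qed

section \<open>Straightening charts\<close>

lemma rational_on_madj: "rational_on U f \<Longrightarrow> rational_on U (\<lambda>x. madj (f x))"
  by (rule rational_on.compose[where L = madj]) (simp_all add: linear_conv_bounded_linear[symmetric] linear_madj)

lemmas rational_on_intros = rational_on.const rational_on.linear[OF bounded_linear_ident]
  rational_on.add rational_on_diff rational_on.mult rational_on_madj

locale graph_chart =
  fixes c :: nat and p q :: "('N::finite) qmat"
  assumes projector_p: "projector c p" and q_eq: "q = mone - p"
begin

lemma pq: "p \<odot> p = p" "q \<odot> q = q" "p \<odot> q = 0" "q \<odot> p = 0" "madj p = p" "madj q = q"
  "mproj c p = p" "mproj c q = q"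
  using projector_p by (simp_all add: projector_def q_eq malg)

lemmas pq_ext = pq(1-4)[THEN mprod_extend, unfolded mprod.zero_left]
lemmas pqs = pq pq_ext malg

lemma pq_split: "p \<odot> X + q \<odot> X = X" "X \<odot> p + X \<odot> q = X"
  by (simp_all add: q_eq malg)

text \<open>Equivalent to B = q B p: a map from the range of p to the range of q.\<close>

definition graph_block :: "'N qmat \<Rightarrow> bool" where
  "graph_block B \<longleftrightarrow> p \<odot> B = 0 \<and> B \<odot> p = B"

lemma graph_block_simps:
  assumes "graph_block B"
  shows "p \<odot> B = 0" "B \<odot> p = B" "q \<odot> B = B" "B \<odot> q = 0" "B \<odot> B = 0"
    "madj B \<odot> p = 0" "p \<odot> madj B = madj B" "madj B \<odot> q = madj B" "q \<odot> madj B = 0" "madj B \<odot> madj B = 0"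
proof -
  show B: "p \<odot> B = 0" "B \<odot> p = B"
    using assms by (simp_all add: graph_block_def)
  then show "q \<odot> B = B" "B \<odot> q = 0"
    by (simp_all add: q_eq malg)
  show BB: "B \<odot> B = 0"
    using mprod_extend[OF B(2), of B] by (simp add: B mprod.zero_right)
  show A: "madj B \<odot> p = 0" "p \<odot> madj B = madj B"
    using arg_cong[OF B(1), of madj] arg_cong[OF B(2), of madj] by (simp_all add: pq)
  then show "madj B \<odot> q = madj B" "q \<odot> madj B = 0"
    by (simp_all add: q_eq malg)
  show "madj B \<odot> madj B = 0"
    using arg_cong[OF BB, of madj] by simp
qed

text \<open>The range of the idempotent \<open>p + B\<close> is the graph of \<open>B\<close>, and \<open>e (e + e* - 1)\<inverse>\<close> is the
  orthogonal projector onto the range of an idempotent \<open>e\<close>.\<close>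

definition tmat :: "'N qmat \<Rightarrow> 'N qmat" where
  "tmat B = p + B + (p + madj B) - mone"

definition hgraph :: "'N qmat \<Rightarrow> 'N qmat" where
  "hgraph B = (p + B) \<odot> minv (tmat B)"

text \<open>2p - 1 is an involution anticommuting with B + B*, so the square of
  \<open>tmat B\<close> is 1 + B B* + B* B, which is positive definite.\<close>

lemma minvertible_tmat:
  assumes "graph_block B"
  shows "minvertible (tmat B)"
proof (rule minvertible_if_inj)
  note B = graph_block_simps[OF assms]
  fix Y assume "tmat B \<odot> Y = 0"
  then have "tmat B \<odot> (tmat B \<odot> Y) = 0"
    by (simp add: mprod.zero_right)
  moreover have "tmat B \<odot> (tmat B \<odot> Y) = Y + B \<odot> (madj B \<odot> Y) + madj B \<odot> (B \<odot> Y)"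
    by (simp add: tmat_def pqs B B[THEN mprod_extend])
  ultimately have "(Y + B \<odot> (madj B \<odot> Y) + madj B \<odot> (B \<odot> Y)) \<bullet> Y = 0"
    by simp
  then have "(norm Y)\<^sup>2 + (norm (madj B \<odot> Y))\<^sup>2 + (norm (B \<odot> Y))\<^sup>2 = 0"
    by (simp add: inner_add_left inner_madj_left power2_norm_eq_inner)
  then show "Y = 0"
    by (simp add: add_nonneg_eq_0_iff)
qed

lemma hgraph_0: "hgraph 0 = p"
proof -
  have "minv (tmat 0) = tmat 0"
    by (rule minv_unique(2)) (simp add: tmat_def pqs)
  then show ?thesis
    by (simp add: hgraph_def tmat_def pqs)
qed

text \<open>Put e = p + B and let T be \<open>tmat B\<close>. Then T e = e* e = e* T, so e
  \<open>minv T\<close> = \<open>minv T\<close> e*, which is self-adjointness. The idempotent e and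
  the projector h satisfy e h = h and h e = e, so their traces agree, and B is traceless.\<close>

lemma
  assumes B: "graph_block B"
  shows graph_mprod_hgraph: "(p + B) \<odot> hgraph B = hgraph B"
    and hgraph_mprod_graph: "hgraph B \<odot> (p + B) = p + B"
    and madj_hgraph: "madj (hgraph B) = hgraph B"
    and hgraph_idem: "hgraph B \<odot> hgraph B = hgraph B"
    and rtr_hgraph: "rtr (hgraph B) = rtr p"
proof -
  define e where "e = p + B"
  define T where "T = tmat B"
  have T: "T = e + madj e - mone" "minvertible T"
    using minvertible_tmat[OF B] by (simp_all add: T_def e_def tmat_def pq)
  have h: "hgraph B = e \<odot> minv T"
    by (simp add: hgraph_def e_def T_def)
  have ee: "e \<odot> e = e"
    by (simp add: e_def malg pq graph_block_simps[OF B])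
  then have ee': "madj e \<odot> madj e = madj e"
    by (metis madj_mprod)
  have Te: "T \<odot> e = madj e \<odot> e" "madj e \<odot> T = madj e \<odot> e"
    by (simp_all add: T malg ee ee')
  have "T \<odot> (e \<odot> minv T) = madj e"
    using mprod_extend[OF Te(1), of "minv T"] mprod_extend[OF Te(2), of "minv T"]
    by (simp add: minv_right[OF T(2)])
  then have comm: "e \<odot> minv T = minv T \<odot> madj e"
    using mprod_extend[OF minv_left[OF T(2)], of "e \<odot> minv T"] by simp
  show 1: "(p + B) \<odot> hgraph B = hgraph B"
    unfolding h e_def[symmetric] by (rule mprod_extend[OF ee])
  have "minv T \<odot> madj e \<odot> e = e"
    using mprod_extend[OF minv_left[OF T(2)], of e] by (simp add: Te(1) mprod_assoc)
  then show 2: "hgraph B \<odot> (p + B) = p + B"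
    by (simp add: h comm flip: e_def)
  have "madj T = T"
    by (simp add: T)
  then show "madj (hgraph B) = hgraph B"
    by (simp add: h madj_minv(2)[OF T(2)]) (simp add: comm)
  show "hgraph B \<odot> hgraph B = hgraph B"
    using mprod_extend[OF 2, of "minv T"] by (simp add: h e_def)
  have "rtr (hgraph B) = rtr (p + B)"
    using 1 2 rtr_commute[of "p + B" "hgraph B"] by simp
  also have "rtr B = 0"
    using rtr_commute[of p B] graph_block_simps[OF B] by simp
  then have "rtr (p + B) = rtr p" by simp
  finally show "rtr (hgraph B) = rtr p" .
qed

lemma projector_hgraph:
  assumes "graph_block B" "mproj c B = B"
  shows "projector c (hgraph B)"
proof -
  have "mproj c (hgraph B) = hgraph B"
    unfolding hgraph_def using assms
    by (intro mproj_mprod mproj_minv minvertible_tmat) (simp_all add: tmat_def pq)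
  then show ?thesis
    by (simp add: projector_def madj_hgraph[OF assms(1)] hgraph_idem[OF assms(1)])
qed

text \<open>P dominates the graph projector, so the difference is a projector; its trace is
  zero.\<close>

lemma hgraph_unique:
  assumes "graph_block B" "mproj c B = B" "projector c P" "P \<odot> (p + B) = p + B" "rtr P = rtr p"
  shows "P = hgraph B"
proof -
  have "P \<odot> hgraph B = hgraph B"
    unfolding hgraph_def by (rule mprod_extend[OF assms(4)])
  then have "projector c (P - hgraph B)"
    by (intro projector_diff projector_hgraph assms)
  moreover have "rtr (P - hgraph B) = 0"
    by (simp add: rtr_hgraph assms)
  ultimately show ?thesis
    using rtr_projector_eq_0 by fastforce
qed

text \<open>On the range of K the matrix \<open>tmat B\<close> acts as the involution 2p - 1. This
  is what keeps graphs of such B inside \<open>proj_section\<close>.\<close>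

lemma hgraph_mprod_commuting:
  assumes "graph_block B" "K \<odot> p = p \<odot> K" "K \<odot> B = 0" "B \<odot> K = 0" "madj K = K"
  shows "hgraph B \<odot> K = p \<odot> K"
proof -
  have "madj B \<odot> K = 0"
    using assms(3,5) by (metis madj_linear(4) madj_mprod)
  then have "tmat B \<odot> ((p + p - mone) \<odot> K) = K"
    by (simp add: tmat_def pqs graph_block_simps[OF assms(1)]
        graph_block_simps[OF assms(1), THEN mprod_extend] assms(4))
  then have "minv (tmat B) \<odot> K = (p + p - mone) \<odot> K"
    using mprod_extend[OF minv_left[OF minvertible_tmat[OF assms(1)]], of "(p + p - mone) \<odot> K"] by simp
  then show ?thesis
    by (simp add: hgraph_def pqs graph_block_simps[OF assms(1), THEN mprod_extend] assms(4))
qed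

lemma rational_on_hgraph:
  assumes "rational_on U f" "\<And>x. x \<in> U \<Longrightarrow> graph_block (f x)"
  shows "rational_on U (\<lambda>x. hgraph (f x))"
  unfolding hgraph_def tmat_def
  by (intro rational_on_intros rational_on.inv assms(1))
     (use assms(2) minvertible_tmat in \<open>auto simp: tmat_def\<close>)

text \<open>Pads the block p A p by the identity on the range of q, so that invertibility of the
  block becomes invertibility of a full matrix.\<close>

definition amat :: "'N qmat \<Rightarrow> 'N qmat" where
  "amat A = p \<odot> A \<odot> p + q"

definition rest :: "'N qmat \<Rightarrow> 'N qmat" where
  "rest A = A - q \<odot> A \<odot> p"

text \<open>The range of A p is the graph of this map wherever the block p A p is
  invertible.\<close>

definition slope :: "'N qmat \<Rightarrow> 'N qmat" where
  "slope A = q \<odot> A \<odot> p \<odot> minv (amat A)"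

text \<open>A projector P with the trace of p and invertible block p P p equals
  \<open>hgraph (slope P)\<close>, so the bracket vanishes and P goes to its slope. For other
  matrices the three blocks apart from q A p record the deviation, which makes this a chart of the
  ambient space.\<close>

definition chart :: "'N qmat \<Rightarrow> 'N qmat" where
  "chart A = slope A + (rest A - rest (hgraph (slope A)))"

text \<open>First half of the inverse of \<open>chart\<close>: the block q y p is the slope, so the
  subtracted correction can be added back. This determines \<open>amat A\<close>, and slope times
  \<open>amat A\<close> is the missing block q A p, which \<open>unchart\<close> inserts.\<close>

definition chart_rest :: "'N qmat \<Rightarrow> 'N qmat" where
  "chart_rest y = rest y + rest (hgraph (q \<odot> y \<odot> p))"

definition unchart :: "'N qmat \<Rightarrow> 'N qmat" where
  "unchart y = chart_rest y + q \<odot> y \<odot> p \<odot> amat (chart_rest y)"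

lemma graph_block_corner: "graph_block (q \<odot> y \<odot> p)"
  by (simp add: graph_block_def pqs)

lemma amat_simps: "p \<odot> amat A = amat A \<odot> p" "q \<odot> amat A = q" "amat A \<odot> q = q" "p \<odot> amat A = p \<odot> A \<odot> p"
  by (simp_all add: amat_def pqs)

lemma minv_amat:
  assumes "minvertible (amat A)"
  shows "minv (amat A) \<odot> p = p \<odot> minv (amat A)" "minv (amat A) \<odot> q = q" "q \<odot> minv (amat A) = q"
proof -
  show "minv (amat A) \<odot> p = p \<odot> minv (amat A)"
    using assms by (rule minv_commute) (simp add: amat_simps(1))
  show "minv (amat A) \<odot> q = q"
    using mprod_extend[OF minv_left[OF assms], of q] by (simp add: amat_simps)
  show "q \<odot> minv (amat A) = q"
    using mprod_extend[OF amat_simps(2)[of A], of "minv (amat A)"] by (simp add: minv_right assms)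
qed

lemma graph_block_slope: "minvertible (amat A) \<Longrightarrow> graph_block (slope A)"
  by (simp add: graph_block_def slope_def pqs minv_amat)

lemma slope_mprod_amat: "minvertible (amat A) \<Longrightarrow> slope A \<odot> amat A = q \<odot> A \<odot> p"
  by (simp add: slope_def mprod_assoc minv_left)

lemma rest_graph_block: "graph_block B \<Longrightarrow> rest B = 0"
  by (simp add: rest_def graph_block_simps malg)

lemma rest_simps: "rest (A + B) = rest A + rest B" "rest (A - B) = rest A - rest B" "rest (rest A) = rest A"
  "q \<odot> rest A \<odot> p = 0" "p \<odot> rest A = p \<odot> A"
  by (simp_all add: rest_def pqs algebra_simps)

lemma amat_cong: "p \<odot> A = p \<odot> B \<Longrightarrow> amat A = amat B"
  by (simp add: amat_def)

lemma
  assumes A: "minvertible (amat A)"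
  shows corner_chart: "q \<odot> chart A \<odot> p = slope A"
    and chart_rest_chart: "chart_rest (chart A) = rest A"
    and unchart_chart: "unchart (chart A) = A"
proof -
  note B = graph_block_slope[OF A]
  show 1: "q \<odot> chart A \<odot> p = slope A"
    using rest_simps(4) by (simp add: chart_def graph_block_simps[OF B] malg)
  show 2: "chart_rest (chart A) = rest A"
    unfolding chart_rest_def 1 by (simp add: chart_def rest_simps rest_graph_block[OF B])
  have "amat (rest A) = amat A"
    by (rule amat_cong) (simp add: rest_simps)
  then show "unchart (chart A) = A"
    unfolding unchart_def 1 2 by (simp add: slope_mprod_amat[OF A]) (simp add: rest_def)
qed

lemma
  assumes y: "minvertible (amat (chart_rest y))"
  shows amat_unchart: "amat (unchart y) = amat (chart_rest y)"
    and chart_unchart: "chart (unchart y) = y"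
proof -
  define B where "B = q \<odot> y \<odot> p"
  define r where "r = chart_rest y"
  have B: "graph_block B"
    unfolding B_def by (rule graph_block_corner)
  have u: "unchart y = r + B \<odot> amat r"
    by (simp add: unchart_def B_def r_def)
  have r: "r = rest y + rest (hgraph B)"
    by (simp add: r_def chart_rest_def B_def)
  show 1: "amat (unchart y) = amat (chart_rest y)"
    by (rule amat_cong) (simp add: u r_def[symmetric] mprod.add_right mprod_extend[OF graph_block_simps(1)[OF B]] mprod.zero_left)
  have gB: "graph_block (B \<odot> amat r)"
    by (simp add: graph_block_def mprod_extend[OF graph_block_simps(1)[OF B]] mprod.zero_left mprod_assoc
        flip: amat_simps(1)) (simp add: mprod_extend[OF graph_block_simps(2)[OF B]])
  have qr: "q \<odot> r \<odot> p = 0"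
    by (simp add: r mprod.add_left mprod.add_right rest_simps)
  have "q \<odot> unchart y \<odot> p = B \<odot> amat r"
    using qr graph_block_simps[OF gB] by (simp add: u mprod.add_left mprod.add_right)
  then have s: "slope (unchart y) = B"
    unfolding slope_def 1 r_def[symmetric] using minv_right[OF y] by (simp add: mprod_assoc r_def)
  have "rest (unchart y) = r"
    by (simp add: u rest_simps rest_graph_block[OF gB]) (simp add: r rest_simps)
  then show "chart (unchart y) = y"
    by (simp add: chart_def s r) (simp add: rest_def B_def)
qed

definition chart_dom :: "'N qmat set" where
  "chart_dom = {A. minvertible (amat A)}"

definition chart_cod :: "'N qmat set" where
  "chart_cod = {y. minvertible (amat (chart_rest y))}"

lemma rational_on_amat: "rational_on U f \<Longrightarrow> rational_on U (\<lambda>x. amat (f x))"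
  unfolding amat_def by (intro rational_on_intros)

lemma rational_on_rest: "rational_on U f \<Longrightarrow> rational_on U (\<lambda>x. rest (f x))"
  unfolding rest_def by (intro rational_on_intros)

lemma rational_on_chart_rest: "rational_on U chart_rest"
  unfolding chart_rest_def
  by (intro rational_on.add rational_on_rest rational_on_hgraph graph_block_corner rational_on_intros)

lemma open_if_rational:
  assumes "rational_on UNIV f"
  shows "open {x. minvertible (f x)}"
  using open_vimage[OF open_minvertible, of f] rational_on_continuous[OF assms]
  by (simp add: vimage_def)

lemma open_chart_dom: "open chart_dom"
  unfolding chart_dom_def by (intro open_if_rational rational_on_amat rational_on_intros)

lemma open_chart_cod: "open chart_cod"
  unfolding chart_cod_def by (intro open_if_rational rational_on_amat rational_on_chart_rest)

lemma rational_on_slope: "rational_on chart_dom slope"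
  unfolding slope_def
  by (intro rational_on_intros rational_on.inv rational_on_amat) (simp add: chart_dom_def)

lemma smooth_on_chart: "smooth_on chart_dom chart"
  unfolding chart_def
  by (intro smooth_on_rational open_chart_dom rational_on.add rational_on_diff rational_on_slope
      rational_on_rest rational_on_hgraph rational_on.linear[OF bounded_linear_ident])
     (simp add: graph_block_slope chart_dom_def)

lemma smooth_on_unchart: "smooth_on chart_cod unchart"
  unfolding unchart_def
  by (intro smooth_on_rational open_chart_cod rational_on.add rational_on.mult rational_on_amat
      rational_on_chart_rest rational_on.const rational_on.linear[OF bounded_linear_ident])

lemma chart_image: "chart ` chart_dom = chart_cod"
proof (intro subset_antisym subsetI)
  fix y assume "y \<in> chart ` chart_dom"
  then obtain A where A: "minvertible (amat A)" "y = chart A"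
    by (auto simp: chart_dom_def)
  have "amat (rest A) = amat A"
    by (rule amat_cong) (simp add: rest_simps)
  with A show "y \<in> chart_cod"
    by (simp add: chart_cod_def chart_rest_chart)
next
  fix y assume "y \<in> chart_cod"
  then show "y \<in> chart ` chart_dom"
    by (intro image_eqI[of _ _ "unchart y"]) (simp_all add: chart_cod_def chart_dom_def chart_unchart amat_unchart)
qed

end

section \<open>Sections of the space of projectors\<close>

definition corner_space :: "nat \<Rightarrow> ('N::finite) qmat \<Rightarrow> 'N qmat \<Rightarrow> 'N qmat set" where
  "corner_space c q p = {X. mproj c X = X \<and> q \<odot> X = X \<and> X \<odot> p = X}"

lemma subspace_corner_space: "subspace (corner_space c q p)"
  by (auto simp: subspace_def corner_space_def malg)

text \<open>K = Z = 0 gives the whole Grassmannian; K the plane projector and Z = a D1 + b D2 gives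
  the critical sets.\<close>

definition proj_section :: "nat \<Rightarrow> nat \<Rightarrow> ('N::finite) qmat \<Rightarrow> 'N qmat \<Rightarrow> 'N qmat set" where
  "proj_section c n K Z = {P \<in> proj c n. P \<odot> K = Z}"

text \<open>Fixing the values of \<open>P\<close> on the range of a projector \<open>K\<close> commuting with \<open>p\<close> amounts, in the chart at \<open>p\<close>,
  to the linear condition that \<open>B\<close> has its initial and final spaces orthogonal to the range of \<open>K\<close>.\<close>

lemma chart_proj_section:
  assumes p: "p \<in> proj_section c n K Z" and K: "projector c K" and Z: "madj Z = Z"
  defines "q \<equiv> mone - p"
  shows "graph_chart.chart p q ` (proj_section c n K Z \<inter> graph_chart.chart_dom p q)
    = corner_space c (q \<odot> (mone - K)) (p \<odot> (mone - K)) \<inter> graph_chart.chart_cod p q"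
proof -
  interpret graph_chart c p q
    using p by unfold_locales (simp_all add: q_def proj_section_def proj_def)
  have pK: "p \<odot> K = Z" and tr: "rtr p = real n"
    using p by (simp_all add: proj_section_def proj_def)
  have adjK: "madj K = K" "mproj c K = K" "K \<odot> K = K"
    using K by (simp_all add: projector_def)
  have Kp: "K \<odot> p = Z"
    using arg_cong[OF pK, of madj] by (simp add: Z adjK pq)
  have qK: "K \<odot> q = q \<odot> K"
    by (simp add: q_eq malg pK Kp)
  have Z_simps: "p \<odot> Z = Z" "Z \<odot> p = Z" "q \<odot> Z = 0" "Z \<odot> q = 0"
    unfolding atomize_conj using mprod_extend[OF pq(1), of K] mprod_assoc[of K p p]
    by (simp add: q_eq malg pK Kp pq)
  note Ks = pK Kp Z_simps pK[THEN mprod_extend] Kp[THEN mprod_extend] Z_simps[THEN mprod_extend]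
  have L: "X \<in> corner_space c (q \<odot> (mone - K)) (p \<odot> (mone - K)) \<longleftrightarrow>
      mproj c X = X \<and> graph_block X \<and> K \<odot> X = 0 \<and> X \<odot> K = 0" (is "?l \<longleftrightarrow> ?r") for X
  proof
    assume ?l
    then have X: "mproj c X = X" "q \<odot> ((mone - K) \<odot> X) = X" "X \<odot> (p \<odot> (mone - K)) = X"
      by (simp_all add: corner_space_def mprod_assoc)
    have "p \<odot> X = 0"
      using arg_cong[OF X(2), of "\<lambda>A. p \<odot> A"] by (simp add: pq_ext)
    moreover have "p \<odot> (mone - K) \<odot> p = p \<odot> (mone - K)"
      by (simp add: malg pq Ks)
    then have "X \<odot> p = X"
      using mprod_assoc[of X "p \<odot> (mone - K)" p] X(3) by (simp only:)
    moreover have "K \<odot> (q \<odot> (mone - K)) = 0"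
      by (simp add: malg qK mprod_extend[OF qK] adjK)
    then have "K \<odot> X = 0"
      using mprod_extend[of K "q \<odot> (mone - K)" 0 X] X(2) by (simp add: mprod_assoc mprod.zero_left)
    moreover have "X \<odot> K = 0"
      using arg_cong[OF X(3), of "\<lambda>A. A \<odot> K"] by (simp add: malg adjK)
    ultimately show ?r
      using X(1) by (simp add: graph_block_def)
  next
    assume r: ?r
    then have "X \<odot> (p \<odot> K) = 0"
      by (simp add: graph_block_simps flip: mprod_assoc)
    with r show ?l
      by (simp add: corner_space_def malg graph_block_simps mprod.zero_right)
  qed
  show ?thesis
  proof (intro subset_antisym subsetI)
    fix y assume "y \<in> chart ` (proj_section c n K Z \<inter> chart_dom)"
    then obtain P where P: "projector c P" "rtr P = real n" "P \<odot> K = Z" "minvertible (amat P)" "y = chart P"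
      by (auto simp: proj_section_def proj_def chart_dom_def)
    let ?B = "slope P"
    have KP: "K \<odot> P = Z"
      using arg_cong[OF P(3), of madj] P(1) by (simp add: Z adjK projector_def)
    have B: "graph_block ?B" "mproj c ?B = ?B"
    proof -
      show "graph_block ?B" by (rule graph_block_slope[OF P(4)])
      have "mproj c (minv (amat P)) = minv (amat P)"
        using P by (intro mproj_minv) (simp_all add: amat_def mproj_mprod pq projector_def)
      then show "mproj c ?B = ?B"
        unfolding slope_def using P by (intro mproj_mprod) (simp_all add: pq projector_def)
    qed
    \<comment> \<open>Hence P fixes p + B; as the traces of P and p agree, P is the graph projector,
      and the correction in \<open>chart\<close> cancels.\<close>
    have "p + ?B = P \<odot> (p \<odot> minv (amat P))"
    proof -
      have "P \<odot> (p \<odot> minv (amat P)) = p \<odot> (P \<odot> (p \<odot> minv (amat P))) + q \<odot> (P \<odot> (p \<odot> minv (amat P)))"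
        by (simp add: pq_split)
      also have "p \<odot> (P \<odot> (p \<odot> minv (amat P))) = p \<odot> amat P \<odot> minv (amat P)"
        by (simp add: amat_simps(4) mprod_assoc)
      also have "\<dots> = p"
        by (simp add: mprod_assoc minv_right P)
      finally show ?thesis by (simp add: slope_def mprod_assoc)
    qed
    then have "P \<odot> (p + ?B) = p + ?B"
      using P(1) by (simp add: projector_def flip: mprod_assoc)
    then have h: "P = hgraph ?B"
      using B P tr by (intro hgraph_unique) simp_all
    have y: "y = ?B"
      unfolding P(5) chart_def h[symmetric] by simp
    have PZ: "P \<odot> Z = Z" "Z \<odot> P = Z"
      unfolding atomize_conj using mprod_assoc[of P P K] mprod_assoc[of K P P] P(1,3)
      by (simp add: KP projector_def)
    \<comment> \<open>P and p agree on the range of K, so \<open>amat P\<close> and its inverse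
      commute with K, and q P p K = q Z = 0.\<close>
    have Ka: "amat P \<odot> K = K \<odot> amat P"
      by (simp add: amat_def pqs qK KP P(3) Ks PZ KP[THEN mprod_extend] P(3)[THEN mprod_extend]
          PZ[THEN mprod_extend])
    have Km: "minv (amat P) \<odot> K = K \<odot> minv (amat P)"
      by (rule minv_commute[OF P(4) Ka])
    have BK: "?B \<odot> K = 0"
      by (simp add: slope_def mprod_assoc Km Ks PZ[THEN mprod_extend] mprod.zero_left)
    have "K \<odot> ?B = 0"
      by (simp add: slope_def mprod_assoc mprod_extend[OF qK] KP[THEN mprod_extend] Ks mprod.zero_left)
    with BK B have "y \<in> corner_space c (q \<odot> (mone - K)) (p \<odot> (mone - K))"
      unfolding L y by simp
    moreover have "y \<in> chart_cod"
      using chart_image P(4,5) by (auto simp: chart_dom_def)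
    ultimately show "y \<in> corner_space c (q \<odot> (mone - K)) (p \<odot> (mone - K)) \<inter> chart_cod" by blast
  next
    fix y assume "y \<in> corner_space c (q \<odot> (mone - K)) (p \<odot> (mone - K)) \<inter> chart_cod"
    then have y: "mproj c y = y" "graph_block y" "K \<odot> y = 0" "y \<odot> K = 0" "minvertible (amat (chart_rest y))"
      unfolding L Int_iff by (simp_all add: chart_cod_def)
    have "chart_rest y = rest (hgraph y)"
      using rest_graph_block[OF y(2)] graph_block_simps[OF y(2)] by (simp add: chart_rest_def)
    then have "amat (chart_rest y) = amat (hgraph y)"
      by (intro amat_cong) (simp add: rest_simps)
    have P: "hgraph y \<in> proj_section c n K Z"
      using projector_hgraph[OF y(2,1)] rtr_hgraph[OF y(2)] hgraph_mprod_commuting[of y K] y pK Kp tr adjK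
      by (simp add: proj_section_def proj_def)
    \<comment> \<open>For h = \<open>hgraph y\<close> this computes q h p = y \<open>amat h\<close>,
      so that \<open>unchart\<close> returns h.\<close>
    have "q \<odot> hgraph y \<odot> p = q \<odot> ((p + y) \<odot> hgraph y) \<odot> p"
      by (simp add: graph_mprod_hgraph[OF y(2)])
    also have "\<dots> = y \<odot> (hgraph y \<odot> p)"
      by (simp add: pqs graph_block_simps[OF y(2)] mprod_extend[OF graph_block_simps(3)[OF y(2)]])
    also have "\<dots> = y \<odot> amat (hgraph y)"
      by (simp add: amat_def malg graph_block_simps[OF y(2)] mprod_extend[OF graph_block_simps(2)[OF y(2)]])
    finally have "unchart y = hgraph y"
      using \<open>amat (chart_rest y) = amat (hgraph y)\<close> \<open>chart_rest y = rest (hgraph y)\<close> graph_block_simps[OF y(2)]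
      by (simp add: unchart_def) (simp add: rest_def)
    then have "chart (hgraph y) = y"
      using chart_unchart[OF y(5)] by simp
    moreover have "hgraph y \<in> chart_dom"
      using y(5) \<open>amat (chart_rest y) = amat (hgraph y)\<close> by (simp add: chart_dom_def)
    ultimately show "y \<in> chart ` (proj_section c n K Z \<inter> chart_dom)"
      using P by (intro image_eqI[of _ _ "hgraph y"]) simp_all
  qed
qed

section \<open>Submanifolds, tangent spaces and Hessians\<close>

text \<open>The right side is the trace of \<pi>. Expanding \<pi> b in an orthonormal basis of the
  range and swapping the sums evaluates it by Parseval.\<close>

lemma dim_range_orthogonal_projection:
  fixes \<pi> :: "'a::euclidean_space \<Rightarrow> 'a"
  assumes "linear \<pi>" and idem: "\<And>x. \<pi> (\<pi> x) = \<pi> x" and adj: "\<And>x y. \<pi> x \<bullet> y = x \<bullet> \<pi> y"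
  shows "real (dim (range \<pi>)) = (\<Sum>b\<in>Basis. \<pi> b \<bullet> b)"
proof -
  have sub: "subspace (range \<pi>)"
    by (rule linear_subspace_image[OF assms(1)]) simp
  obtain B where B: "B \<subseteq> range \<pi>" "pairwise orthogonal B" "\<And>x. x \<in> B \<Longrightarrow> norm x = 1"
      "independent B" "card B = dim (range \<pi>)" "span B = range \<pi>"
    using orthonormal_basis_subspace[OF sub] by metis
  have fin: "finite B"
    using B(4) independent_imp_finite by blast
  have "\<pi> b \<bullet> b = (\<Sum>u\<in>B. (b \<bullet> u)\<^sup>2)" for b
  proof -
    have "\<pi> b = (\<Sum>u\<in>B. (\<pi> b \<bullet> u) *\<^sub>R u)"
      using B fin by (intro orthonormal_basis_expand[symmetric]) auto
    also have "\<dots> = (\<Sum>u\<in>B. (b \<bullet> u) *\<^sub>R u)"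
      using B(1) idem by (intro sum.cong) (auto simp: adj)
    finally show ?thesis
      by (simp add: inner_sum_left power2_eq_square inner_commute[of b])
  qed
  then have "(\<Sum>b\<in>Basis. \<pi> b \<bullet> b) = (\<Sum>b\<in>Basis. \<Sum>u\<in>B. (b \<bullet> u)\<^sup>2)"
    by simp
  also have "\<dots> = (\<Sum>u\<in>B. \<Sum>b\<in>Basis. (b \<bullet> u)\<^sup>2)"
    by (rule sum.swap)
  also have "\<dots> = (\<Sum>u\<in>B. 1)"
  proof (rule sum.cong[OF refl])
    fix u assume "u \<in> B"
    then have "u \<bullet> u = 1" using B(3) by (simp add: dot_square_norm)
    then show "(\<Sum>b\<in>Basis. (b \<bullet> u)\<^sup>2) = 1"
      by (subst (asm) euclidean_inner) (simp add: power2_eq_square inner_commute)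
  qed
  finally show ?thesis by (simp add: B)
qed

lemma sum_Basis_vec:
  fixes f :: "'a::euclidean_space ^ 'n::finite \<Rightarrow> real"
  shows "(\<Sum>b\<in>Basis. f b) = (\<Sum>i\<in>UNIV. \<Sum>u\<in>Basis. f (axis i u))"
proof -
  have B: "Basis = (\<lambda>(i, u). axis i u) ` (UNIV \<times> (Basis :: 'a set))"
    by (auto simp: Basis_vec_def)
  have "inj_on (\<lambda>(i, u). axis i u) ((UNIV :: 'n set) \<times> (Basis :: 'a set))"
    by (auto simp: inj_on_def axis_eq_axis)
  then have "(\<Sum>b\<in>Basis. f b) = (\<Sum>(i, u)\<in>UNIV \<times> Basis. f (axis i u))"
    unfolding B by (simp only: sum.reindex comp_def case_prod_unfold)
  then show ?thesis
    by (simp only: sum.cartesian_product)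
qed

text \<open>Self-adjointness makes diagonal entries real, hence central; this lets the trace in
  \<open>dim_corner_space\<close> split into a product.\<close>

lemma projector_diagonal:
  assumes "projector c P"
  shows "P $ i $ i = qreal (qre (P $ i $ i))"
proof -
  have "qconj (P $ i $ i) = P $ i $ i"
    using assms by (simp add: projector_def madj_def vec_eq_iff)
  then show ?thesis
    by (cases "P $ i $ i") (auto simp: qconj_def qreal_def qre_def complex_eq_iff)
qed

text \<open>The corner is the range of an orthogonal projection, X \<mapsto> q X p composed with
  \<open>mproj c\<close>. Its trace is the sum over positions (i, j) of the i-th diagonal entry of q
  times the j-th of p times the trace c of \<open>qproj c\<close>.\<close>

lemma dim_corner_space:
  fixes p q :: "'N::finite qmat"
  assumes c: "c \<in> {1, 2, 4}" and q: "projector c q" and p: "projector c p"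
  shows "real (dim (corner_space c q p)) = real c * rtr q * rtr p"
proof -
  define \<pi> where "\<pi> X = q \<odot> mproj c X \<odot> p" for X
  have pq: "q \<odot> q = q" "p \<odot> p = p" "madj q = q" "madj p = p" "mproj c q = q" "mproj c p = p"
    using p q by (simp_all add: projector_def)
  have "linear \<pi>"
    by (intro linearI) (simp_all add: \<pi>_def malg)
  moreover have "\<pi> (\<pi> X) = \<pi> X" for X
    by (simp add: \<pi>_def malg mproj_mprod_left mproj_mprod_right pq mprod_extend[OF pq(1)])
  moreover have "\<pi> X \<bullet> Y = X \<bullet> \<pi> Y" for X Y
  proof -
    have "\<pi> X \<bullet> Y = mproj c X \<bullet> (q \<odot> Y \<odot> p)"
      using inner_madj_right[of "q \<odot> mproj c X" p Y] inner_madj_left[of q "mproj c X" "Y \<odot> p"]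
      by (simp add: \<pi>_def pq mprod_assoc)
    also have "\<dots> = X \<bullet> \<pi> Y"
      by (simp add: inner_mproj \<pi>_def mproj_mprod_left mproj_mprod_right pq mprod_assoc)
    finally show ?thesis .
  qed
  ultimately have "real (dim (range \<pi>)) = (\<Sum>b\<in>Basis. \<pi> b \<bullet> b)"
    by (intro dim_range_orthogonal_projection)
  moreover have "range \<pi> = corner_space c q p"
  proof (intro subset_antisym subsetI)
    fix X assume "X \<in> corner_space c q p"
    then have "X = \<pi> X" by (simp add: \<pi>_def corner_space_def)
    then show "X \<in> range \<pi>" by blast
  next
    fix X assume "X \<in> range \<pi>"
    then show "X \<in> corner_space c q p"
      by (auto simp: \<pi>_def corner_space_def malg mproj_mprod_left mproj_mprod_right pq mprod_extend[OF pq(1)])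
  qed
  moreover have "(\<Sum>b\<in>Basis. \<pi> b \<bullet> b) = real c * rtr q * rtr p"
  proof -
    have entry: "\<pi> (axis i (axis j e)) \<bullet> axis i (axis j e) = qre (q $ i $ i) * qre (p $ j $ j) * (norm (qproj c e))\<^sup>2"
      for i j e
    proof -
      have ax: "mproj c (axis i (axis j e)) $ k $ l = (if l = j then if k = i then qproj c e else 0 else 0)" for k l
        by (simp add: mproj_def axis_def)
      have "(\<Sum>k\<in>UNIV. qmult (q $ i $ k) (mproj c (axis i (axis j e)) $ k $ l)) = (if l = j then qmult (q $ i $ i) (qproj c e) else 0)" for l
      proof -
        have "(\<Sum>k\<in>UNIV. qmult (q $ i $ k) (mproj c (axis i (axis j e)) $ k $ l))
            = (\<Sum>k\<in>UNIV. if k = i then (if l = j then qmult (q $ i $ i) (qproj c e) else 0) else 0)"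
          by (intro sum.cong) (auto simp: ax qmult.zero_right)
        then show ?thesis by simp
      qed
      then have "\<pi> (axis i (axis j e)) $ i $ j
          = (\<Sum>l\<in>UNIV. qmult (if l = j then qmult (q $ i $ i) (qproj c e) else 0) (p $ l $ j))"
        by (simp add: \<pi>_def mprod_def)
      also have "\<dots> = (\<Sum>l\<in>UNIV. if l = j then qmult (qmult (q $ i $ i) (qproj c e)) (p $ j $ j) else 0)"
        by (intro sum.cong) (auto simp: qmult.zero_left)
      also have "\<dots> = (qre (q $ i $ i) * qre (p $ j $ j)) *\<^sub>R qproj c e"
        by (simp, subst projector_diagonal[OF q], subst projector_diagonal[OF p])
           (simp add: qreal_scaleR qmult.scaleR_left mult_ac)
      finally show ?thesis
        by (simp add: inner_axis inner_qproj_self)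
    qed
    have "(\<Sum>e\<in>Basis. \<pi> (axis i (axis j e)) \<bullet> axis i (axis j e)) = qre (q $ i $ i) * qre (p $ j $ j) * real c" for i j
      by (simp add: entry sum_Basis_qproj[OF c] flip: sum_distrib_left)
    then have "(\<Sum>b\<in>Basis. \<pi> b \<bullet> b) = (\<Sum>i\<in>UNIV. \<Sum>j\<in>UNIV. qre (q $ i $ i) * qre (p $ j $ j) * real c)"
      by (simp only: sum_Basis_vec)
    also have "\<dots> = rtr q * rtr p * real c"
      unfolding rtr_def sum_product by (simp only: sum_distrib_right)
    finally show ?thesis by (simp add: mult_ac)
  qed
  ultimately show ?thesis by simp
qed

text \<open>A single k must serve every point, so \<open>dimL\<close> expresses the dimension of the
  model space through quantities that do not depend on p. For an empty section k is
  arbitrary.\<close>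

lemma submanifold_proj_section:
  fixes K Z :: "'N::finite qmat"
  assumes c: "c \<in> {1, 2, 4}" and K: "projector c K" and Z: "madj Z = Z"
  shows "\<exists>k. submanifold k (proj_section c n K Z)"
proof -
  let ?L = "\<lambda>p. corner_space c ((mone - p) \<odot> (mone - K)) (p \<odot> (mone - K))"
  have dimL: "real (dim (?L p)) = c * (real CARD('N) - n - rtr K + rtr Z) * (n - rtr Z)"
    if "p \<in> proj_section c n K Z" for p
  proof -
    have p: "p \<odot> K = Z" "projector c p" "rtr p = n"
      using that by (simp_all add: proj_section_def proj_def)
    have Kp: "K \<odot> p = Z"
      using arg_cong[OF p(1), of madj] p(2) K Z by (simp add: projector_def)
    have pZ: "p \<odot> Z = Z" "K \<odot> Z = Z"
      using mprod_assoc[of p p K] mprod_assoc[of K K p] p K Kp by (simp_all add: projector_def)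
    have projZ: "projector c Z"
      using K p(2) Z mprod_assoc[of p K Z] mproj_mprod[of c p K] by (simp add: projector_def p(1) pZ)
    have "projector c ((mone - p) \<odot> (mone - K))"
    proof -
      have "(mone - p) \<odot> (mone - K) = (mone - p) - (K - Z)"
        by (simp add: malg p)
      moreover have "projector c (K - Z)"
        by (intro projector_diff K projZ pZ)
      ultimately show ?thesis
        using projector_diff[OF projector_diff[OF projector_mone p(2)], of "K - Z"] by (simp add: malg p pZ)
    qed
    moreover have "projector c (p \<odot> (mone - K))"
    proof -
      have "p \<odot> (mone - K) = p - Z"
        by (simp add: malg p)
      then show ?thesis
        using p(2) projZ by (simp only:) (intro projector_diff; simp add: pZ)
    qed
    ultimately show ?thesis
      by (simp add: dim_corner_space[OF c] malg p Kp algebra_simps)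
  qed
  show ?thesis
  proof (cases "proj_section c n K Z = {}")
    case True
    then show ?thesis by (simp add: submanifold_def)
  next
    case False
    then obtain p0 where p0: "p0 \<in> proj_section c n K Z" by blast
    have "submanifold (dim (?L p0)) (proj_section c n K Z)"
      unfolding submanifold_def
    proof
      fix p assume p: "p \<in> proj_section c n K Z"
      interpret graph_chart c p "mone - p"
        using p by unfold_locales (simp_all add: proj_section_def proj_def)
      have "amat p = mone"
        by (simp add: amat_def pq)
      then have dom: "p \<in> chart_dom"
        by (simp add: chart_dom_def minv_unique(1)[of mone mone])
      have dims: "dim (?L p) = dim (?L p0)"
        using dimL[OF p] dimL[OF p0] by simp
      show "\<exists>U V (\<psi> :: 'N qmat \<Rightarrow> 'N qmat) \<psi>' L. open U \<and> p \<in> U \<and> open V \<and> smooth_on U \<psi> \<and> smooth_on V \<psi>' \<and>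
          \<psi> ` U = V \<and> (\<forall>x\<in>U. \<psi>' (\<psi> x) = x) \<and> subspace L \<and> dim L = dim (?L p0) \<and>
          \<psi> ` (proj_section c n K Z \<inter> U) = L \<inter> V"
      proof (rule exI[of _ chart_dom], rule exI[of _ chart_cod], rule exI[of _ chart],
            rule exI[of _ unchart], rule exI[of _ "?L p"], intro conjI)
        show "\<forall>x\<in>chart_dom. unchart (chart x) = x"
          using unchart_chart by (simp add: chart_dom_def)
      qed (use dom dims open_chart_dom open_chart_cod smooth_on_chart smooth_on_unchart chart_image
          subspace_corner_space chart_proj_section[OF p K Z] in simp_all)
    qed
    then show ?thesis by blast
  qed
qed

lemma closed_proj_section: "closed (proj_section c n K (Z :: 'N::finite qmat))"
proof -
  have lin: "continuous_on UNIV f" if "linear f" for f :: "'N qmat \<Rightarrow> 'b::euclidean_space"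
    using that by (simp add: linear_continuous_on linear_conv_bounded_linear)
  have "proj_section c n K Z = {P. mproj c P = P} \<inter> {P. madj P = P} \<inter> {P. P \<odot> P = P} \<inter> {P. rtr P = n} \<inter> {P. P \<odot> K = Z}"
    by (auto simp: proj_section_def proj_def projector_def)
  then show ?thesis
    by (simp only:) (intro closed_Int closed_Collect_eq lin[OF linear_mproj] lin[OF linear_madj]
        lin[OF linear_rtr] mprod.continuous_on continuous_on_id continuous_on_const)
qed

text \<open>The linearisation at p of the equations of \<open>proj_section\<close>. The third
  condition says that the diagonal blocks p v p and (1 - p) v (1 - p) vanish.\<close>

definition tangent_section :: "nat \<Rightarrow> ('N::finite) qmat \<Rightarrow> 'N qmat \<Rightarrow> 'N qmat set" where
  "tangent_section c K p = {v. mproj c v = v \<and> madj v = v \<and> p \<odot> v + v \<odot> p = v \<and> v \<odot> K = 0}"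

lemma subspace_tangent_section: "subspace (tangent_section c K p)"
  unfolding subspace_def tangent_section_def by (auto simp: malg algebra_simps simp flip: scaleR_add_right)

lemma smooth_curve_derivs:
  assumes "smooth_curve S p \<gamma>"
  obtains e \<gamma>1 a where "e > 0" "\<gamma> 0 = p"
    "\<And>t. t \<in> ball 0 e \<Longrightarrow> \<gamma> t \<in> S \<and> (\<gamma> has_vector_derivative \<gamma>1 t) (at t)"
    "(\<gamma>1 has_vector_derivative a) (at 0)"
proof -
  from assms obtain e where e: "e > 0" "smooth_on (ball 0 e) \<gamma>" "\<gamma> ` ball 0 e \<subseteq> S" "\<gamma> 0 = p"
    unfolding smooth_curve_def by blast
  show ?thesis
    using e smooth_on_real_deriv[OF e(2)]
    by (intro that[of e "ddiff [1] \<gamma>" "ddiff [1, 1] \<gamma> 0"]) (auto simp del: ddiff.simps)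
qed

lemma vector_derivative_locally_const:
  assumes "open U" "t \<in> U" "\<And>s. s \<in> U \<Longrightarrow> f s = C" "(f has_vector_derivative d) (at t)"
  shows "d = 0"
proof -
  have "(f has_vector_derivative 0) (at t)"
    by (rule has_vector_derivative_transform_within_open[OF has_vector_derivative_const assms(1,2)])
       (simp add: assms(3))
  then show ?thesis
    using assms(4) vector_derivative_unique_at by blast
qed

lemma linear_has_vector_derivative:
  fixes f :: "'a::euclidean_space \<Rightarrow> 'b::real_normed_vector"
  assumes "linear f" "(\<gamma> has_vector_derivative d) (at t)"
  shows "((\<lambda>t. f (\<gamma> t)) has_vector_derivative f d) (at t)"
  using assms bounded_linear.has_vector_derivative linear_conv_bounded_linear by blast

lemma mprod_has_vector_derivative:
  "(f has_vector_derivative f') (at t) \<Longrightarrow> (h has_vector_derivative h') (at t) \<Longrightarrow>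
    ((\<lambda>t. f t \<odot> h t) has_vector_derivative f t \<odot> h' + f' \<odot> h t) (at t)"
  by (rule mprod.has_vector_derivative)

lemma proj_section_velocity:
  assumes "open U" "t \<in> U" "\<And>s. s \<in> U \<Longrightarrow> \<gamma> s \<in> proj_section c n K Z" "(\<gamma> has_vector_derivative v) (at t)"
  shows "v \<in> tangent_section c K (\<gamma> t)"
proof -
  note loc = vector_derivative_locally_const[OF assms(1,2)]
  note lin = linear_has_vector_derivative[OF _ assms(4)]
  have s: "mproj c (\<gamma> s) - \<gamma> s = 0" "madj (\<gamma> s) - \<gamma> s = 0" "\<gamma> s \<odot> \<gamma> s - \<gamma> s = 0" "\<gamma> s \<odot> K = Z" if "s \<in> U" for s
    using assms(3)[OF that] by (simp_all add: proj_section_def proj_def projector_def)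
  have "mproj c v - v = 0"
    by (rule loc[OF s(1) has_vector_derivative_diff[OF lin[OF linear_mproj] assms(4)]])
  moreover have "madj v - v = 0"
    by (rule loc[OF s(2) has_vector_derivative_diff[OF lin[OF linear_madj] assms(4)]])
  moreover have "\<gamma> t \<odot> v + v \<odot> \<gamma> t - v = 0"
    by (rule loc[OF s(3) has_vector_derivative_diff[OF mprod_has_vector_derivative[OF assms(4,4)] assms(4)]])
  moreover have "\<gamma> t \<odot> 0 + v \<odot> K = 0"
    by (rule loc[OF s(4) mprod_has_vector_derivative[OF assms(4) has_vector_derivative_const]])
  ultimately show ?thesis
    by (simp add: tangent_section_def mprod.zero_right)
qed

text \<open>One inclusion differentiates the equations along the curve. For the other, v = B + B*
  with B = v p is the velocity at 0 of the curve of graphs of t B, and K B = B K = 0 keeps that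
  curve in the section.\<close>

lemma tangent_space_proj_section:
  assumes p: "p \<in> proj_section c n K Z" and K: "projector c K" and Z: "madj Z = Z"
  shows "tangent_space (proj_section c n K Z) p = tangent_section c K p"
proof (intro subset_antisym subsetI)
  fix v assume "v \<in> tangent_space (proj_section c n K Z) p"
  then obtain \<gamma> where \<gamma>: "smooth_curve (proj_section c n K Z) p \<gamma>" "v = vector_derivative \<gamma> (at 0)"
    by (auto simp: tangent_space_def)
  from smooth_curve_derivs[OF \<gamma>(1)] obtain e \<gamma>1 where e: "e > 0" "\<gamma> 0 = p"
    "\<And>t. t \<in> ball 0 e \<Longrightarrow> \<gamma> t \<in> proj_section c n K Z \<and> (\<gamma> has_vector_derivative \<gamma>1 t) (at t)"
    by metis
  have "\<gamma>1 0 \<in> tangent_section c K (\<gamma> 0)"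
    using e by (intro proj_section_velocity[of "ball 0 e"]) auto
  moreover have "v = \<gamma>1 0"
    using e \<gamma>(2) by (simp add: vector_derivative_at)
  ultimately show "v \<in> tangent_section c K p"
    using e(2) by simp
next
  fix v assume "v \<in> tangent_section c K p"
  then have v: "mproj c v = v" "madj v = v" "p \<odot> v + v \<odot> p = v" "v \<odot> K = 0"
    by (simp_all add: tangent_section_def)
  interpret graph_chart c p "mone - p"
    using p by unfold_locales (simp_all add: proj_section_def proj_def)
  have pK: "p \<odot> K = Z" and tr: "rtr p = real n"
    using p by (simp_all add: proj_section_def proj_def)
  have adjK: "madj K = K"
    using K by (simp add: projector_def)
  have Kp: "K \<odot> p = Z"
    using arg_cong[OF pK, of madj] by (simp add: Z adjK pq)
  have Kv: "K \<odot> v = 0"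
    using madj_mprod[of v K] by (simp add: v adjK)
  define B where "B = v \<odot> p"
  have pvp: "p \<odot> (v \<odot> p) = 0"
    using arg_cong[OF v(3), of "\<lambda>A. p \<odot> A \<odot> p"] by (simp add: pqs)
  have B: "graph_block B" "mproj c B = B" "K \<odot> B = 0" "B \<odot> K = 0" "madj B = p \<odot> v"
    using pvp Kv v(1,2) by (simp_all add: graph_block_def B_def pq malg mproj_mprod mprod_extend[of K v 0]
        mprod.zero_left pK) (simp add: v(4) mprod_extend[of v K 0] mprod.zero_left flip: Kp)
  have vB: "v = B + madj B"
    unfolding B(5) using v(3) by (simp add: B_def add.commute)
  have tB: "graph_block (t *\<^sub>R B)" "mproj c (t *\<^sub>R B) = t *\<^sub>R B" "K \<odot> (t *\<^sub>R B) = 0" "t *\<^sub>R B \<odot> K = 0" for t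
    using B by (simp_all add: graph_block_def malg)
  define \<gamma> where "\<gamma> t = hgraph (t *\<^sub>R B)" for t :: real
  have "\<gamma> t \<in> proj_section c n K Z" for t
    using projector_hgraph[OF tB(1,2)] rtr_hgraph[OF tB(1)] tr
      hgraph_mprod_commuting[OF tB(1) _ tB(3,4) adjK] pK Kp
    by (simp add: \<gamma>_def proj_section_def proj_def)
  moreover have "smooth_on (ball 0 1) \<gamma>"
    unfolding \<gamma>_def by (intro smooth_on_rational rational_on_hgraph tB rational_on.linear)
      (auto intro: bounded_linear_scaleR_left)
  moreover have "\<gamma> 0 = p"
    by (simp add: \<gamma>_def hgraph_0)
  ultimately have "smooth_curve (proj_section c n K Z) p \<gamma>"
    unfolding smooth_curve_def by (auto intro!: exI[of _ 1])
  moreover have "vector_derivative \<gamma> (at 0) = v"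
  proof -
    define T where "T t = tmat (t *\<^sub>R B)" for t :: real
    have idt: "((\<lambda>t. t *\<^sub>R X) has_vector_derivative X) (at 0)" for X :: "'a qmat"
      using has_vector_derivative_scaleR[OF DERIV_ident has_vector_derivative_const, of X 0 UNIV] by simp
    have eq: "T = (\<lambda>t. (p + p - mone) + t *\<^sub>R v)" "\<gamma> = (\<lambda>t. (p + t *\<^sub>R B) \<odot> minv (T t))"
      by (auto simp: T_def tmat_def vB algebra_simps \<gamma>_def hgraph_def)
    have T': "(T has_vector_derivative v) (at 0)"
      unfolding eq using has_vector_derivative_add[OF has_vector_derivative_const idt] by simp
    have e': "((\<lambda>t. p + t *\<^sub>R B) has_vector_derivative B) (at 0)"
      using has_vector_derivative_add[OF has_vector_derivative_const idt] by simp
    have T0: "T 0 \<odot> T 0 = mone"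
      by (simp add: eq pqs)
    note T0' = minv_unique[OF T0]
    have "((\<lambda>t. minv (T t)) has_vector_derivative - (T 0 \<odot> (v \<odot> T 0))) (at 0)"
      using vector_derivative_diff_chain_within[of T v 0 UNIV minv] T' minv_has_derivative[OF T0'(1)] T0'(2)
      by (auto simp: comp_def intro: has_derivative_at_withinI)
    from mprod_has_vector_derivative[OF e' this]
    have "(\<gamma> has_vector_derivative (p \<odot> - (T 0 \<odot> (v \<odot> T 0)) + B \<odot> T 0)) (at 0)"
      by (simp add: eq(2) T0')
    \<comment> \<open>T 0 = 2p - 1 is an involution anticommuting with v, so the left side is p v +
      v p.\<close>
    also have "p \<odot> - (T 0 \<odot> (v \<odot> T 0)) + B \<odot> T 0 = v"
      by (simp add: eq(1) pqs B_def pvp pvp[THEN mprod_extend]) (simp add: v)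
    finally show ?thesis by (rule vector_derivative_at)
  qed
  ultimately show "v \<in> tangent_space (proj_section c n K Z) p"
    unfolding tangent_space_def by blast
qed

lemma proj_eq_proj_section: "proj c n = proj_section c n 0 0"
  by (simp add: proj_section_def mprod.zero_right)

lemma tangent_space_proj:
  assumes "p \<in> proj c n"
  shows "tangent_space (proj c n) p = tangent_section c 0 p"
  unfolding proj_eq_proj_section using assms
  by (intro tangent_space_proj_section) (simp_all add: proj_section_def projector_def mprod.zero_right)

section \<open>Critical points and Hessians of linear functions\<close>

lemma linear_hinner: "linear (\<lambda>P. hinner P E)"
  by (intro linearI) (simp_all add: hinner_eq_rtr malg)

lemma hinner_inner: "madj w = w \<Longrightarrow> hinner u w = u \<bullet> w"
  by (metis hinner_eq_rtr rtr_mprod_madj)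

lemma tangent_corner:
  assumes "p \<odot> p = p" "v \<in> tangent_section c K p"
  shows "p \<odot> (v \<odot> p) = 0"
proof -
  have "p \<odot> (p \<odot> v + v \<odot> p) \<odot> p = p \<odot> v \<odot> p"
    using assms(2) by (simp add: tangent_section_def)
  then show ?thesis
    by (simp add: malg assms(1) mprod_extend[OF assms(1)])
qed

text \<open>E is block diagonal with respect to p, while v is off-diagonal.\<close>

lemma hinner_tangent_commuting:
  assumes "p \<odot> p = p" "v \<in> tangent_section c K p" "p \<odot> E = E \<odot> p"
  shows "hinner v E = 0"
proof -
  have pvp: "p \<odot> v \<odot> p = 0"
    using tangent_corner[OF assms(1,2)] by (simp add: mprod_assoc)
  have "rtr (p \<odot> v \<odot> E) = rtr (p \<odot> v \<odot> (E \<odot> p))"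
    using rtr_commute[of p "p \<odot> v \<odot> E"] by (simp add: mprod_extend[OF assms(1)] mprod_assoc)
  also have "\<dots> = 0"
    using mprod_extend[OF pvp, of E] by (simp add: mprod_assoc mprod.zero_left flip: assms(3))
  finally have 1: "rtr (p \<odot> v \<odot> E) = 0" .
  have "rtr (v \<odot> p \<odot> E) = rtr (p \<odot> v \<odot> E)"
    using rtr_commute[of "v \<odot> E" p] by (simp add: mprod_assoc assms(3))
  moreover have "v = p \<odot> v + v \<odot> p"
    using assms(2) by (simp add: tangent_section_def)
  then have "rtr (v \<odot> E) = rtr (p \<odot> v \<odot> E) + rtr (v \<odot> p \<odot> E)"
    by (metis mprod.add_left rtr_linear(1))
  ultimately show ?thesis
    using 1 by (simp add: hinner_eq_rtr)
qed

lemma critical_set_hinner: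
  assumes E: "mproj c E = E" "madj E = E"
  shows "critical_set (\<lambda>P. hinner P E) (proj c n) = {p \<in> proj c n. p \<odot> E = E \<odot> p}"
proof (intro subset_antisym subsetI)
  fix p assume "p \<in> critical_set (\<lambda>P. hinner P E) (proj c n)"
  then have p: "p \<in> proj c n" and
    crit: "\<And>\<gamma>. smooth_curve (proj c n) p \<gamma> \<Longrightarrow> vector_derivative ((\<lambda>P. hinner P E) \<circ> \<gamma>) (at 0) = 0"
    by (auto simp: critical_set_def)
  interpret graph_chart c p "mone - p"
    using p by unfold_locales (simp_all add: proj_def)
  define q where "q = mone - p"
  have pq': "p \<odot> q = 0" "q \<odot> p = 0" "q \<odot> q = q" "madj q = q" "mproj c q = q" "p + q = mone"
    unfolding q_def by (simp_all add: pq)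
  \<comment> \<open>The tangential part of E, that is, the gradient of the linear function at
    p.\<close>
  define v where "v = q \<odot> E \<odot> p + p \<odot> E \<odot> q"
  have "v \<in> tangent_section c 0 p"
    by (simp add: v_def tangent_section_def malg pq' pq E mproj_mprod pq(1)[THEN mprod_extend]
        pq'(1)[THEN mprod_extend] mprod.zero_right mprod.zero_left)
  then obtain \<gamma> where \<gamma>: "smooth_curve (proj c n) p \<gamma>" "v = vector_derivative \<gamma> (at 0)"
    unfolding tangent_space_proj[OF p, symmetric] tangent_space_def by blast
  from smooth_curve_derivs[OF \<gamma>(1)] have "(\<gamma> has_vector_derivative v) (at 0)"
    using \<gamma>(2) by (metis centre_in_ball vector_derivative_at)
  from linear_has_vector_derivative[OF linear_hinner this, of E] crit[OF \<gamma>(1)]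
  have "hinner v E = 0"
    by (simp add: comp_def vector_derivative_at)
  moreover have "hinner v E = 2 * (norm (q \<odot> E \<odot> p))\<^sup>2"
  proof -
    have 1: "rtr (q \<odot> E \<odot> p \<odot> E) = (norm (q \<odot> E \<odot> p))\<^sup>2"
    proof -
      have "(norm (q \<odot> E \<odot> p))\<^sup>2 = rtr (q \<odot> E \<odot> p \<odot> madj (q \<odot> E \<odot> p))"
        by (simp only: rtr_mprod_madj power2_norm_eq_inner)
      also have "\<dots> = rtr (q \<odot> E \<odot> p \<odot> E \<odot> q)"
        by (simp add: pq pq' E mprod_assoc pq(1)[THEN mprod_extend])
      also have "\<dots> = rtr (q \<odot> E \<odot> p \<odot> E)"
        by (subst rtr_commute) (simp add: mprod_assoc pq'(3)[THEN mprod_extend])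
      finally show ?thesis by simp
    qed
    have "rtr (p \<odot> E \<odot> q \<odot> E) = rtr (q \<odot> E \<odot> p \<odot> E)"
      using rtr_commute[of "p \<odot> E" "q \<odot> E"] by (simp add: mprod_assoc)
    with 1 show ?thesis
      by (simp add: hinner_eq_rtr v_def mprod.add_left)
  qed
  ultimately have z: "q \<odot> E \<odot> p = 0" by simp
  have "madj (q \<odot> E \<odot> p) = 0"
    unfolding z by simp
  then have z': "p \<odot> E \<odot> q = 0"
    by (simp add: pq pq' E mprod_assoc)
  have "p \<odot> E = p \<odot> E \<odot> (p + q)" "E \<odot> p = (p + q) \<odot> (E \<odot> p)"
    by (simp_all add: pq')
  with z z' p show "p \<in> {p \<in> proj c n. p \<odot> E = E \<odot> p}"
    by (simp add: mprod.add_left mprod.add_right mprod_assoc)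
next
  fix p assume p: "p \<in> {p \<in> proj c n. p \<odot> E = E \<odot> p}"
  then have pp: "p \<odot> p = p" by (simp add: proj_def projector_def)
  have "vector_derivative ((\<lambda>P. hinner P E) \<circ> \<gamma>) (at 0) = 0" if \<gamma>: "smooth_curve (proj c n) p \<gamma>" for \<gamma>
  proof -
    from smooth_curve_derivs[OF \<gamma>] obtain v where v: "(\<gamma> has_vector_derivative v) (at 0)"
      by (metis centre_in_ball)
    then have "v \<in> tangent_space (proj c n) p"
      unfolding tangent_space_def using \<gamma> vector_derivative_at[OF v, symmetric] by blast
    then have "hinner v E = 0"
      using p pp tangent_space_proj hinner_tangent_commuting by blast
    then show ?thesis
      using linear_has_vector_derivative[OF linear_hinner v, of E] by (simp add: comp_def vector_derivative_at)
  qed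
  with p show "p \<in> critical_set (\<lambda>P. hinner P E) (proj c n)"
    by (simp add: critical_set_def)
qed

text \<open>Differentiating \<open>\<gamma> \<gamma> = \<gamma>\<close> twice determines the diagonal blocks of the acceleration; the
  off-diagonal blocks are tangent, so they do not contribute at a critical point.\<close>

lemma curve_second_derivative:
  assumes \<gamma>: "smooth_curve (proj c n) p \<gamma>" and p: "p \<in> proj c n" "p \<odot> E = E \<odot> p"
    and v: "v = vector_derivative \<gamma> (at 0)"
  shows "vector_derivative (\<lambda>t. vector_derivative ((\<lambda>P. hinner P E) \<circ> \<gamma>) (at t)) (at 0)
    = 2 * rtr (v \<odot> v \<odot> (mone - p - p) \<odot> E)"
proof -
  have pp: "p \<odot> p = p" using p by (simp add: proj_def projector_def)
  from smooth_curve_derivs[OF \<gamma>] obtain e \<gamma>1 a where e: "e > 0" "\<gamma> 0 = p"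
    "\<And>t. t \<in> ball 0 e \<Longrightarrow> \<gamma> t \<in> proj c n \<and> (\<gamma> has_vector_derivative \<gamma>1 t) (at t)"
    "(\<gamma>1 has_vector_derivative a) (at 0)"
    by metis
  have \<gamma>10: "\<gamma>1 0 = v"
    using e(1) vector_derivative_at[OF conjunct2[OF e(3)[of 0]]] v by simp
  have tang: "\<gamma>1 t \<in> tangent_section c 0 (\<gamma> t)" if "t \<in> ball 0 e" for t
    using e(3) that by (intro proj_section_velocity[of "ball 0 e" _ _ _ n _ 0]) (auto simp flip: proj_eq_proj_section)
  have v_tan: "v \<in> tangent_section c 0 p"
    using tang[of 0] e \<gamma>10 by simp
  have \<gamma>': "(\<gamma> has_vector_derivative v) (at 0)"
    using e \<gamma>10 by auto
  have "\<gamma> t \<odot> \<gamma>1 t + \<gamma>1 t \<odot> \<gamma> t - \<gamma>1 t = 0" if "t \<in> ball 0 e" for t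
    using tang[OF that] by (simp add: tangent_section_def)
  moreover note has_vector_derivative_diff[OF has_vector_derivative_add[OF mprod_has_vector_derivative[OF \<gamma>' e(4)]
        mprod_has_vector_derivative[OF e(4) \<gamma>']] e(4)]
  ultimately have "(\<gamma> 0 \<odot> a + v \<odot> \<gamma>1 0) + (\<gamma>1 0 \<odot> v + a \<odot> \<gamma> 0) - a = 0"
    using e(1) by (intro vector_derivative_locally_const[of "ball 0 e" 0]) auto
  then have a: "p \<odot> a + 2 *\<^sub>R (v \<odot> v) + a \<odot> p = a"
    by (simp add: e \<gamma>10 algebra_simps scaleR_2)
  \<comment> \<open>v exchanges the ranges of p and 1 - p, so its square preserves them.\<close>
  have vv: "p \<odot> (v \<odot> v) = v \<odot> (v \<odot> p)"
  proof -
    have "p \<odot> v = v - v \<odot> p" "v \<odot> p = v - p \<odot> v"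
      using v_tan by (auto simp: tangent_section_def algebra_simps)
    then show ?thesis
      by (metis mprod.diff_left mprod.diff_right mprod_assoc)
  qed
  have pap: "p \<odot> a \<odot> p = - (2 *\<^sub>R (v \<odot> v \<odot> p))"
  proof -
    have "p \<odot> (p \<odot> a + 2 *\<^sub>R (v \<odot> v) + a \<odot> p) \<odot> p = p \<odot> a \<odot> p" by (simp add: a)
    moreover have "p \<odot> (v \<odot> (v \<odot> p)) = v \<odot> (v \<odot> p)"
      using mprod_extend[OF vv, of p] by (simp add: mprod_assoc pp)
    ultimately show ?thesis
      by (simp add: malg pp pp[THEN mprod_extend] algebra_simps add_eq_0_iff)
  qed
  \<comment> \<open>Since E commutes with p, only the block p a p enters this trace.\<close>
  have "rtr (p \<odot> a \<odot> E) = rtr (p \<odot> a \<odot> p \<odot> E)"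
    using rtr_commute[of p "p \<odot> a \<odot> E"] by (simp add: mprod_assoc pp[THEN mprod_extend] p(2))
  also have "\<dots> = - 2 * rtr (v \<odot> v \<odot> p \<odot> E)"
    by (simp only: pap) (simp add: malg)
  finally have 1: "rtr (p \<odot> a \<odot> E) = - 2 * rtr (v \<odot> v \<odot> p \<odot> E)" .
  moreover have "rtr (a \<odot> p \<odot> E) = rtr (p \<odot> a \<odot> E)"
    using rtr_commute[of "a \<odot> E" p] by (simp add: mprod_assoc p(2))
  moreover have "rtr (a \<odot> E) = rtr (p \<odot> a \<odot> E) + 2 * rtr (v \<odot> v \<odot> E) + rtr (a \<odot> p \<odot> E)"
    using arg_cong[OF a, of "\<lambda>A. rtr (A \<odot> E)"] by (simp add: malg)
  ultimately have hE: "hinner a E = 2 * rtr (v \<odot> v \<odot> (mone - p - p) \<odot> E)"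
    by (simp add: hinner_eq_rtr malg)
  have "vector_derivative ((\<lambda>P. hinner P E) \<circ> \<gamma>) (at t) = hinner (\<gamma>1 t) E" if "t \<in> ball 0 e" for t
    using e(3)[OF that] linear_has_vector_derivative[OF linear_hinner, of \<gamma> "\<gamma>1 t" t E]
    by (simp add: comp_def vector_derivative_at)
  moreover have "((\<lambda>t. hinner (\<gamma>1 t) E) has_vector_derivative hinner a E) (at 0)"
    by (rule linear_has_vector_derivative[OF linear_hinner e(4)])
  ultimately have "((\<lambda>t. vector_derivative ((\<lambda>P. hinner P E) \<circ> \<gamma>) (at t)) has_vector_derivative hinner a E) (at 0)"
    using e(1) by (elim has_vector_derivative_transform_within_open[where S = "ball 0 e"]) auto
  then show ?thesis
    by (simp add: vector_derivative_at hE)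
qed

text \<open>The choice in \<open>hessQ\<close> is unambiguous at a critical point: every curve with
  velocity v has the same second derivative, and such a curve exists because v is tangent.\<close>

lemma hessQ_hinner:
  assumes p: "p \<in> proj c n" "p \<odot> E = E \<odot> p" and v: "v \<in> tangent_section c 0 p"
  shows "hessQ (\<lambda>P. hinner P E) (proj c n) p v = 2 * rtr (v \<odot> v \<odot> (mone - p - p) \<odot> E)"
  unfolding hessQ_def
proof (rule someI2_ex)
  show "\<exists>h \<gamma>. smooth_curve (proj c n) p \<gamma> \<and> vector_derivative \<gamma> (at 0) = v \<and>
      h = vector_derivative (\<lambda>t. vector_derivative ((\<lambda>P. hinner P E) \<circ> \<gamma>) (at t)) (at 0)"
    using v unfolding tangent_space_proj[OF p(1), symmetric] tangent_space_def by blast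
qed (use curve_second_derivative[OF _ p] in auto)

text \<open>1 - 2p is the reflection equal to -1 on the range of p and to 1 on that of 1 - p, and v
  exchanges these ranges.\<close>

lemma tangent_section_anticommute:
  assumes "v \<in> tangent_section c K p"
  shows "v \<odot> (mone - p - p) = - ((mone - p - p) \<odot> v)"
proof -
  have "v \<odot> (mone - p - p) + (mone - p - p) \<odot> v = 2 *\<^sub>R (v - (p \<odot> v + v \<odot> p))"
    by (simp add: malg algebra_simps scaleR_2)
  also have "\<dots> = 0"
    using assms by (simp add: tangent_section_def)
  finally show ?thesis by (simp add: add_eq_0_iff2)
qed

text \<open>Polarises the quadratic form of \<open>hessQ_hinner\<close>. Moving the reflection past
  u costs a sign, which turns the two terms into a commutator with E.\<close>

lemma hessB_hinner:
  assumes p: "p \<in> proj c n" "p \<odot> E = E \<odot> p" and u: "u \<in> tangent_section c 0 p" and w: "w \<in> tangent_section c 0 p"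
  shows "hessB (\<lambda>P. hinner P E) (proj c n) p u w = ((mone - p - p) \<odot> (E \<odot> u - u \<odot> E)) \<bullet> w"
proof -
  let ?S = "mone - p - p"
  have "u + w \<in> tangent_section c 0 p"
    using u w by (rule subspace_add[OF subspace_tangent_section])
  then have "hessB (\<lambda>P. hinner P E) (proj c n) p u w = rtr (u \<odot> w \<odot> ?S \<odot> E) + rtr (w \<odot> u \<odot> ?S \<odot> E)"
    unfolding hessB_def by (simp add: hessQ_hinner[OF p] u w) (simp add: mprod.add_left mprod.add_right)
  also have "rtr (u \<odot> w \<odot> ?S \<odot> E) = rtr (?S \<odot> (E \<odot> u) \<odot> w)"
  proof -
    have "rtr (u \<odot> (w \<odot> (?S \<odot> E))) = rtr (w \<odot> (?S \<odot> E) \<odot> u)" by (rule rtr_commute)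
    also have "\<dots> = rtr (w \<odot> (?S \<odot> (E \<odot> u)))" by (simp only: mprod_assoc)
    also have "\<dots> = rtr (?S \<odot> (E \<odot> u) \<odot> w)" by (rule rtr_commute)
    finally show ?thesis by (simp only: mprod_assoc)
  qed
  also have "rtr (w \<odot> u \<odot> ?S \<odot> E) = - rtr (?S \<odot> (u \<odot> E) \<odot> w)"
  proof -
    have "w \<odot> u \<odot> ?S \<odot> E = w \<odot> (u \<odot> ?S \<odot> E)" by (simp only: mprod_assoc)
    also have "\<dots> = - (w \<odot> (?S \<odot> (u \<odot> E)))"
      by (simp only: tangent_section_anticommute[OF u] mprod.minus_left mprod.minus_right mprod_assoc)
    finally show ?thesis
      by (simp only: rtr_linear rtr_commute[of w])
  qed
  also have "rtr (?S \<odot> (E \<odot> u) \<odot> w) + - rtr (?S \<odot> (u \<odot> E) \<odot> w) = rtr (?S \<odot> (E \<odot> u - u \<odot> E) \<odot> w)"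
    by (simp only: mprod.diff_right mprod.diff_left[of "?S \<odot> (E \<odot> u)"] rtr_linear)
  also have "\<dots> = (?S \<odot> (E \<odot> u - u \<odot> E)) \<bullet> w"
    using w rtr_mprod_madj[of "?S \<odot> (E \<odot> u - u \<odot> E)" w] by (simp add: tangent_section_def)
  finally show ?thesis .
qed

section \<open>The normal Hessian at a critical point\<close>

lemma inner_sandwich: "madj k = k \<Longrightarrow> x \<bullet> (k \<odot> y \<odot> k) = (k \<odot> x \<odot> k) \<bullet> y"
  using inner_madj_right[of "k \<odot> y" k x] inner_madj_left[of k y "x \<odot> k"]
  by (simp add: inner_commute mprod_assoc)

text \<open>The range of D1 lies in that of p if a = 1 and is orthogonal to it if a = 0; likewise D2
  and b. With a and b as parameters, all four manifolds are treated at once until the index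
  count.\<close>

locale critical_point = graph_chart c p q for c and p q :: "'N::finite qmat" +
  fixes n :: nat and D1 D2 :: "'N qmat" and a b :: real
  assumes p_proj: "p \<in> proj c n"
    and D: "projector c D1" "projector c D2" "D1 \<odot> D2 = 0"
    and pD: "p \<odot> D1 = a *\<^sub>R D1" "p \<odot> D2 = b *\<^sub>R D2"
    and ab: "a \<in> {0, 1}" "b \<in> {0, 1}"
begin

definition "E = D1 - D2"
definition "J = D1 + D2"
definition "Z = a *\<^sub>R D1 + b *\<^sub>R D2"
text \<open>The projector onto the kernel of E, which in the theorem is V.\<close>

definition "k = mone - J"
definition "S = mone - p - p"

lemma Ds: "D1 \<odot> D1 = D1" "D2 \<odot> D2 = D2" "D1 \<odot> D2 = 0" "D2 \<odot> D1 = 0"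
  "madj D1 = D1" "madj D2 = D2" "mproj c D1 = D1" "mproj c D2 = D2"
  "p \<odot> D1 = a *\<^sub>R D1" "p \<odot> D2 = b *\<^sub>R D2" "D1 \<odot> p = a *\<^sub>R D1" "D2 \<odot> p = b *\<^sub>R D2"
proof -
  show *: "D1 \<odot> D1 = D1" "D2 \<odot> D2 = D2" "D1 \<odot> D2 = 0" "madj D1 = D1" "madj D2 = D2"
      "mproj c D1 = D1" "mproj c D2 = D2" "p \<odot> D1 = a *\<^sub>R D1" "p \<odot> D2 = b *\<^sub>R D2"
    using D pD by (simp_all add: projector_def)
  show "D2 \<odot> D1 = 0" "D1 \<odot> p = a *\<^sub>R D1" "D2 \<odot> p = b *\<^sub>R D2"
    using madj_mprod[of D1 D2] madj_mprod[of p D1] madj_mprod[of p D2] by (simp_all add: * pq)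
qed

lemma qDs: "q \<odot> D1 = (1 - a) *\<^sub>R D1" "q \<odot> D2 = (1 - b) *\<^sub>R D2"
    "D1 \<odot> q = (1 - a) *\<^sub>R D1" "D2 \<odot> q = (1 - b) *\<^sub>R D2"
  by (simp_all add: q_eq malg Ds algebra_simps)

lemmas D_ext = Ds(1-4,9-12)[THEN mprod_extend] qDs[THEN mprod_extend]
lemmas Dalg = Ds qDs D_ext pqs

lemma EJ: "E \<odot> E = J" "madj E = E" "mproj c E = E" "p \<odot> E = E \<odot> p" "p \<odot> J = Z" "J \<odot> p = Z" "madj Z = Z"
  "projector c J"
  using D by (auto simp: E_def J_def Z_def Dalg projector_add)

lemma ks: "madj k = k" "k \<odot> k = k" "mproj c k = k" "k \<odot> p = p \<odot> k" "k \<odot> E = 0" "E \<odot> k = 0"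
    "k \<odot> J = 0" "k \<odot> D1 = 0" "D1 \<odot> k = 0" "k \<odot> D2 = 0" "D2 \<odot> k = 0"
  by (simp_all add: k_def J_def E_def Dalg)

lemma in_section: "p \<in> proj_section c n J Z"
  using p_proj by (simp add: proj_section_def EJ)

abbreviation "T \<equiv> tangent_section c 0 p"

text \<open>Tangent vectors w of the critical manifold satisfy w J = J w = 0, that is, w = k w k;
  orthogonality to all of them means that the block k u k vanishes.\<close>

definition "nset = {u \<in> T. k \<odot> u \<odot> k = 0}"

lemma subspace_nset: "subspace nset"
  using subspace_tangent_section[of c 0 p]
  by (auto simp: subspace_def nset_def malg)

lemma normal_space_eq: "normal_space hinner (proj c n) (proj_section c n J Z) p = nset"
proof -
  have "(\<forall>w\<in>tangent_section c J p. hinner u w = 0) \<longleftrightarrow> k \<odot> u \<odot> k = 0" if u: "u \<in> T" for u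
  proof
    assume *: "\<forall>w\<in>tangent_section c J p. hinner u w = 0"
    \<comment> \<open>This block is itself tangent to the critical manifold, so it serves as its own
      test vector.\<close>
    define w where "w = k \<odot> u \<odot> k"
    have u': "mproj c u = u" "madj u = u" "p \<odot> u + u \<odot> p = u"
      using u by (simp_all add: tangent_section_def)
    have w: "mproj c w = w" "madj w = w" "w \<odot> J = 0"
      unfolding w_def by (simp_all add: mproj_mprod ks u' mprod_assoc mprod.zero_right)
    have "p \<odot> w + w \<odot> p = k \<odot> (p \<odot> u + u \<odot> p) \<odot> k"
      by (simp add: w_def malg ks mprod_extend[OF ks(4)])
    with w have "w \<in> tangent_section c J p"
      by (simp add: tangent_section_def u' w_def)
    then have "u \<bullet> w = 0"
      using * hinner_inner[OF w(2)] by metis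
    moreover have "k \<odot> w \<odot> k = w"
      by (simp add: w_def mprod_assoc ks mprod_extend[OF ks(2)])
    ultimately have "w \<bullet> w = 0"
      using inner_sandwich[of k u w] by (simp add: ks w_def)
    then show "k \<odot> u \<odot> k = 0" by (simp add: w_def)
  next
    assume u0: "k \<odot> u \<odot> k = 0"
    show "\<forall>w\<in>tangent_section c J p. hinner u w = 0"
    proof
      fix w assume "w \<in> tangent_section c J p"
      then have w: "madj w = w" "w \<odot> J = 0" by (simp_all add: tangent_section_def)
      then have "J \<odot> w = 0"
        using madj_mprod[of w J] EJ(8) by (simp add: projector_def)
      with w have "k \<odot> w \<odot> k = w"
        by (simp add: k_def malg mprod.zero_right)
      then show "hinner u w = 0"
        using inner_sandwich[of k u w] u0 by (simp add: ks hinner_inner w)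
    qed
  qed
  then show ?thesis
    unfolding normal_space_def tangent_space_proj[OF p_proj]
      tangent_space_proj_section[OF in_section EJ(8,7)] nset_def by auto
qed

definition "hess u = S \<odot> (E \<odot> u - u \<odot> E)"

lemma hessB_eq: "u \<in> T \<Longrightarrow> w \<in> T \<Longrightarrow> hessB (\<lambda>P. hinner P E) (proj c n) p u w = hess u \<bullet> w"
  unfolding hess_def S_def by (rule hessB_hinner[OF p_proj EJ(4)])

lemma S_simps: "S \<odot> S = mone" "madj S = S" "mproj c S = S" "S \<odot> E = E \<odot> S" "k \<odot> S = S \<odot> k"
  using ks(4) EJ(4) by (simp_all add: S_def pqs)

text \<open>Since k E = E k = 0, the block k (hess u) k vanishes. Thus \<open>hess\<close> restricts
  to an endomorphism of \<open>nset\<close>: nondegeneracy becomes injectivity, and the weak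
  eigenvectors in \<open>crit_index\<close> become genuine ones.\<close>

lemma hess_nset:
  assumes "u \<in> T"
  shows "hess u \<in> nset"
proof -
  have u: "mproj c u = u" "madj u = u"
    using assms by (simp_all add: tangent_section_def)
  have uS: "u \<odot> S = - (S \<odot> u)"
    unfolding S_def using assms by (rule tangent_section_anticommute)
  have hS: "hess u \<odot> S + S \<odot> hess u = 0"
    by (simp add: hess_def malg uS S_simps(1)[THEN mprod_extend] S_simps(4)[symmetric]
        S_simps(4)[symmetric, THEN mprod_extend] uS[THEN mprod_extend])
  moreover have "hess u \<odot> S + S \<odot> hess u = 2 *\<^sub>R (hess u - (p \<odot> hess u + hess u \<odot> p))"
    by (simp add: S_def malg algebra_simps scaleR_2)
  ultimately have "p \<odot> hess u + hess u \<odot> p = hess u"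
    by simp
  moreover have "madj (hess u) = hess u"
    by (simp add: hess_def malg u EJ(2) S_simps(2) S_simps(4)[symmetric] uS uS[THEN mprod_extend]
        S_simps(4)[symmetric, THEN mprod_extend])
  moreover have "mproj c (hess u) = hess u"
    by (simp add: hess_def mproj_mprod u EJ S_simps)
  moreover have "k \<odot> hess u \<odot> k = 0"
    by (simp add: hess_def malg S_simps(5)[THEN mprod_extend] ks ks(5)[THEN mprod_extend] mprod.zero_right mprod.zero_left)
  ultimately show ?thesis
    by (simp add: nset_def tangent_section_def mprod.zero_right)
qed

text \<open>The vanishing means that u commutes with E, hence with J = E E and with D1, D2. Each of
  these lies inside p or is orthogonal to it, so off-diagonality of u kills D u D = D u, and u = k u
  k = 0 remains.\<close>

lemma hess_eq_0:
  assumes u: "u \<in> nset" and "hess u = 0"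
  shows "u = 0"
proof -
  have "S \<odot> hess u = E \<odot> u - u \<odot> E"
    by (simp add: hess_def S_simps(1)[THEN mprod_extend])
  then have Eu: "E \<odot> u = u \<odot> E"
    using assms(2) by (simp add: mprod.zero_right)
  have Ju: "J \<odot> u = u \<odot> J"
    by (simp add: Eu mprod_assoc mprod_extend[OF Eu] flip: EJ(1))
  have *: "D \<odot> u = 0" if D: "D = (1/2) *\<^sub>R (J + E) \<or> D = (1/2) *\<^sub>R (J - E)" "D \<odot> D = D"
      "D \<odot> p = s *\<^sub>R D" "p \<odot> D = s *\<^sub>R D" "s \<in> {0, 1}" for D s
  proof -
    have "D \<odot> u = u \<odot> D"
      using D(1) by (auto simp: malg Eu Ju)
    moreover have "D \<odot> (p \<odot> u + u \<odot> p) \<odot> D = D \<odot> u \<odot> D"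
      using u by (simp add: nset_def tangent_section_def)
    \<comment> \<open>This reads 2 s D u D = D u D, and 2 s is 0 or 2.\<close>
    then have "s *\<^sub>R (D \<odot> (u \<odot> D)) + s *\<^sub>R (D \<odot> (u \<odot> D)) = D \<odot> (u \<odot> D)"
      by (simp add: malg D(4) D(3)[THEN mprod_extend])
    then have "D \<odot> (u \<odot> D) = 0"
      using D(5) by auto
    ultimately show ?thesis
      using mprod_extend[OF D(2), of u] by simp
  qed
  have "D1 \<odot> u = 0"
    by (rule *[of D1 a]) (use ab in \<open>simp_all add: Ds E_def J_def scaleR_2[symmetric]\<close>)
  moreover have "D2 \<odot> u = 0"
    by (rule *[of D2 b]) (use ab in \<open>simp_all add: Ds E_def J_def scaleR_2[symmetric]\<close>)
  ultimately have "J \<odot> u = 0"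
    by (simp add: J_def mprod.add_left)
  then have "k \<odot> u \<odot> k = u"
    using Ju by (simp add: k_def malg)
  then show "u = 0"
    using u by (simp add: nset_def)
qed

text \<open>\<open>hess u\<close> is itself a normal vector and is used as w.\<close>

lemma nondegenerate:
  assumes "u \<in> normal_space hinner (proj c n) (proj_section c n J Z) p"
    "\<forall>w\<in>normal_space hinner (proj c n) (proj_section c n J Z) p. hessB (\<lambda>P. hinner P E) (proj c n) p u w = 0"
  shows "u = 0"
proof -
  have u: "u \<in> nset" "\<And>w. w \<in> nset \<Longrightarrow> hessB (\<lambda>P. hinner P E) (proj c n) p u w = 0"
    using assms unfolding normal_space_eq by auto
  then have uT: "u \<in> T" by (simp add: nset_def)
  then have h: "hess u \<in> nset" by (rule hess_nset)
  then have "hess u \<bullet> hess u = 0"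
    using u(2)[OF h] hessB_eq[OF uT, of "hess u"] by (simp add: nset_def)
  then show ?thesis
    using hess_eq_0 u(1) by simp
qed

text \<open>A normal vector \<open>u\<close> is determined by its block \<open>X = u p = q u p\<close>, on which the Hessian acts as the
  commutator with \<open>E\<close>.\<close>

definition "blocks = {X \<in> corner_space c q p. k \<odot> X \<odot> k = 0}"
definition "hsym X = X + madj X" for X :: "'N qmat"
definition "neg_blocks = {X \<in> blocks. \<exists>lam<0. E \<odot> X - X \<odot> E = lam *\<^sub>R X}"

lemma corner_space_graph_block: "X \<in> corner_space c q p \<longleftrightarrow> mproj c X = X \<and> graph_block X"
proof -
  have "p \<odot> X = 0 \<longleftrightarrow> q \<odot> X = X" for X
    by (simp add: q_eq malg)
  then show ?thesis
    by (auto simp: corner_space_def graph_block_def)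
qed

lemma hsym_mprod_p: "X \<in> corner_space c q p \<Longrightarrow> hsym X \<odot> p = X"
  unfolding corner_space_graph_block hsym_def by (auto simp: malg graph_block_simps)

lemma nset_eq: "nset = hsym ` blocks"
proof (intro subset_antisym subsetI)
  fix u assume "u \<in> nset"
  then have u: "mproj c u = u" "madj u = u" "p \<odot> u + u \<odot> p = u" "k \<odot> u \<odot> k = 0" "u \<in> T"
    by (simp_all add: nset_def tangent_section_def)
  have pup: "p \<odot> (u \<odot> p) = 0"
    by (rule tangent_corner[OF pq(1) u(5)])
  have "u \<odot> p \<in> blocks"
    using u(1,4) pup by (simp add: blocks_def corner_space_graph_block graph_block_def mproj_mprod pq mprod_assoc
        flip: ks(4)) (simp add: mprod_extend[of "u" k] flip: mprod_assoc, simp add: mprod.zero_left)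
  moreover have "u = hsym (u \<odot> p)"
    using u(3) by (simp add: hsym_def u pq add.commute)
  ultimately show "u \<in> hsym ` blocks" by blast
next
  fix u assume "u \<in> hsym ` blocks"
  then obtain X where X: "mproj c X = X" "graph_block X" "k \<odot> X \<odot> k = 0" "u = X + madj X"
    by (auto simp: blocks_def corner_space_graph_block hsym_def)
  have "madj (k \<odot> X \<odot> k) = 0"
    unfolding X(3) by simp
  then have "k \<odot> madj X \<odot> k = 0"
    by (simp add: ks mprod_assoc)
  with X show "u \<in> nset"
    by (simp add: nset_def tangent_section_def malg graph_block_simps)
qed

text \<open>The difference of \<open>hess u\<close> and lam u lies in \<open>nset\<close> and can be
  tested against itself, so the weak eigenvalue equation is a genuine one. Multiplication by p on
  the right restricts it to the block X, and \<open>hsym\<close> recovers it.\<close>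

lemma eigen_iff:
  assumes X: "X \<in> blocks"
  shows "(\<forall>w\<in>nset. hessB (\<lambda>P. hinner P E) (proj c n) p (hsym X) w = lam * hinner (hsym X) w)
    \<longleftrightarrow> E \<odot> X - X \<odot> E = lam *\<^sub>R X"
proof -
  define u where "u = hsym X"
  have u: "u \<in> nset" "u \<in> T"
    using X nset_eq by (auto simp: u_def nset_def)
  have gX: "graph_block X" and Xc: "X \<in> corner_space c q p"
    using X by (simp_all add: blocks_def corner_space_graph_block)
  have pEX: "p \<odot> (E \<odot> X - X \<odot> E) = 0"
    using EJ(4)[THEN mprod_extend, of X]
    by (simp add: malg graph_block_simps[OF gX] graph_block_simps(1)[OF gX, THEN mprod_extend])
  have "hess u \<odot> p = S \<odot> (E \<odot> (u \<odot> p) - u \<odot> p \<odot> E)"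
    by (simp add: hess_def malg EJ(4))
  \<comment> \<open>S is the identity on the range of q, where E X - X E takes its values.\<close>
  also have "\<dots> = E \<odot> X - X \<odot> E"
    using pEX by (simp add: u_def hsym_mprod_p[OF Xc] S_def mprod.diff_left)
  finally have hp: "hess u \<odot> p = E \<odot> X - X \<odot> E" .
  have hsym_hp: "hsym (hess u \<odot> p) = hess u"
    using hess_nset[OF u(2)] by (simp add: hsym_def nset_def tangent_section_def pq add.commute)
  have "(\<forall>w\<in>nset. hess u \<bullet> w = lam * (u \<bullet> w)) \<longleftrightarrow> hess u = lam *\<^sub>R u"
  proof
    assume *: "\<forall>w\<in>nset. hess u \<bullet> w = lam * (u \<bullet> w)"
    have "hess u - lam *\<^sub>R u \<in> nset"
      using hess_nset[OF u(2)] u(1) subspace_nset by (simp add: subspace_diff subspace_scale)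
    then have "(hess u - lam *\<^sub>R u) \<bullet> (hess u - lam *\<^sub>R u) = 0"
      using * by (simp add: inner_diff_left)
    then show "hess u = lam *\<^sub>R u" by simp
  qed simp
  moreover have "hess u = lam *\<^sub>R u \<longleftrightarrow> E \<odot> X - X \<odot> E = lam *\<^sub>R X"
  proof
    assume "hess u = lam *\<^sub>R u"
    then show "E \<odot> X - X \<odot> E = lam *\<^sub>R X"
      using hp by (simp add: mprod.scaleR_left u_def hsym_mprod_p[OF Xc])
  next
    assume "E \<odot> X - X \<odot> E = lam *\<^sub>R X"
    then have "hess u = hsym (lam *\<^sub>R X)"
      using hp hsym_hp by simp
    then show "hess u = lam *\<^sub>R u"
      by (simp add: hsym_def u_def scaleR_add_right)
  qed
  moreover have "hessB (\<lambda>P. hinner P E) (proj c n) p u w = hess u \<bullet> w" "hinner u w = u \<bullet> w" if "w \<in> nset" for w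
    using that hessB_eq[OF u(2)] by (auto simp: nset_def tangent_section_def hinner_inner)
  ultimately show ?thesis
    unfolding u_def[symmetric] by auto
qed

lemma crit_index_eq: "crit_index hinner (\<lambda>P. hinner P E) (proj c n) (proj_section c n J Z) p = dim neg_blocks"
proof -
  have "{u \<in> nset. \<exists>lam<0. \<forall>w\<in>nset. hessB (\<lambda>P. hinner P E) (proj c n) p u w = lam * hinner u w} = hsym ` neg_blocks"
    unfolding neg_blocks_def using eigen_iff by (auto simp: nset_eq)
  then have "crit_index hinner (\<lambda>P. hinner P E) (proj c n) (proj_section c n J Z) p = dim (hsym ` neg_blocks)"
    unfolding crit_index_def normal_space_eq by simp
  also have "\<dots> = dim neg_blocks"
  proof (rule dim_image_eq)
    show "linear hsym"
      by (intro linearI) (simp_all add: hsym_def algebra_simps)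
    \<comment> \<open>On the corner space, right multiplication by p inverts
      \<open>hsym\<close>.\<close>
    have "span neg_blocks \<subseteq> corner_space c q p"
      by (rule span_minimal) (auto simp: neg_blocks_def blocks_def subspace_corner_space)
    then show "inj_on hsym (span neg_blocks)"
      by (intro inj_onI) (metis subsetD hsym_mprod_p)
  qed
  finally show ?thesis .
qed

text \<open>X maps the range of p to that of q, so D1 X can be nonzero only for a = 0 and X D1 only
  for a = 1, likewise for D2 and b; the scalar factors say this for all cases together. The fifth
  equation is k X k = 0 multiplied out.\<close>

lemma blocks_D:
  assumes "X \<in> blocks"
  shows "q \<odot> X = X" "X \<odot> p = X" "p \<odot> X = 0" "mproj c X = X"
    "X - J \<odot> X - X \<odot> J + J \<odot> X \<odot> J = 0" "D1 \<odot> X = (1 - a) *\<^sub>R (D1 \<odot> X)" "D2 \<odot> X = (1 - b) *\<^sub>R (D2 \<odot> X)"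
    "X \<odot> D1 = a *\<^sub>R (X \<odot> D1)" "X \<odot> D2 = b *\<^sub>R (X \<odot> D2)"
proof -
  show X: "q \<odot> X = X" "X \<odot> p = X" "p \<odot> X = 0" "mproj c X = X"
    using assms by (auto simp: blocks_def corner_space_graph_block graph_block_simps)
  show "X - J \<odot> X - X \<odot> J + J \<odot> X \<odot> J = 0"
    using assms by (simp add: blocks_def k_def malg algebra_simps)
  show "D1 \<odot> X = (1 - a) *\<^sub>R (D1 \<odot> X)" "D2 \<odot> X = (1 - b) *\<^sub>R (D2 \<odot> X)"
    using mprod_assoc[of D1 q X] mprod_assoc[of D2 q X] by (simp_all add: X qDs mprod.scaleR_left)
  show "X \<odot> D1 = a *\<^sub>R (X \<odot> D1)" "X \<odot> D2 = b *\<^sub>R (X \<odot> D2)"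
    using mprod_assoc[of X p D1] mprod_assoc[of X p D2] by (simp_all add: X Ds mprod.scaleR_right)
qed

section \<open>Negative eigenspaces in the four cases\<close>

lemma eigen_cancel: "lam *\<^sub>R Y = s *\<^sub>R Y \<Longrightarrow> lam < 0 \<Longrightarrow> s \<ge> 0 \<Longrightarrow> Y = (0 :: 'N qmat)"
  by (auto simp: scaleR_cancel_right)

text \<open>Here X = X D1 + X D2 and E X - X E = X D2 - X D1, so the negative eigenvalue is -1, on X
  = X D1.\<close>

lemma neg_blocks_11:
  assumes "a = 1" "b = 1"
  shows "neg_blocks = corner_space c q D1"
proof (intro subset_antisym subsetI)
  fix X assume "X \<in> neg_blocks"
  then obtain lam where X: "X \<in> blocks" "lam < 0" "E \<odot> X - X \<odot> E = lam *\<^sub>R X"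
    by (auto simp: neg_blocks_def)
  note B = blocks_D[OF X(1)]
  have DX: "D1 \<odot> X = 0" "D2 \<odot> X = 0"
    using B(6,7) assms by simp_all
  have "X \<odot> D2 - X \<odot> D1 = lam *\<^sub>R X"
    using X(3) by (simp add: E_def malg DX)
  from arg_cong[OF this, of "\<lambda>A. A \<odot> D2"] have "lam *\<^sub>R (X \<odot> D2) = 1 *\<^sub>R (X \<odot> D2)"
    by (simp add: malg Ds)
  then have "X \<odot> D2 = 0"
    using X(2) by (rule eigen_cancel) simp
  then have "X \<odot> D1 = X"
    using B(5) by (simp add: J_def malg DX DX[THEN mprod_extend] mprod.zero_left)
  then show "X \<in> corner_space c q D1"
    using B by (simp add: corner_space_def)
next
  fix X assume "X \<in> corner_space c q D1"
  then have X: "mproj c X = X" "q \<odot> X = X" "X \<odot> D1 = X"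
    by (simp_all add: corner_space_def)
  have "X \<odot> p = X" "X \<odot> k = 0" "X \<odot> D2 = 0"
    using mprod_assoc[of X D1 p] mprod_assoc[of X D1 k] mprod_assoc[of X D1 D2]
    by (simp_all add: X Ds assms ks mprod.zero_right)
  moreover have "D1 \<odot> X = 0" "D2 \<odot> X = 0"
    using mprod_assoc[of D1 q X] mprod_assoc[of D2 q X] by (simp_all add: X qDs assms mprod.zero_left)
  ultimately show "X \<in> neg_blocks"
    using X by (auto simp: neg_blocks_def blocks_def corner_space_def E_def malg mprod.zero_right intro!: exI[of _ "-1"])
qed

text \<open>Here X = D1 X + D2 X and E X - X E = D1 X - D2 X, so the negative eigenvalue is -1, on X
  = D2 X.\<close>

lemma neg_blocks_00:
  assumes "a = 0" "b = 0"
  shows "neg_blocks = corner_space c D2 p"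
proof (intro subset_antisym subsetI)
  fix X assume "X \<in> neg_blocks"
  then obtain lam where X: "X \<in> blocks" "lam < 0" "E \<odot> X - X \<odot> E = lam *\<^sub>R X"
    by (auto simp: neg_blocks_def)
  note B = blocks_D[OF X(1)]
  have XD: "X \<odot> D1 = 0" "X \<odot> D2 = 0"
    using B(8,9) assms by simp_all
  have "D1 \<odot> X - D2 \<odot> X = lam *\<^sub>R X"
    using X(3) by (simp add: E_def malg XD)
  from arg_cong[OF this, of "\<lambda>A. D1 \<odot> A"] have "lam *\<^sub>R (D1 \<odot> X) = 1 *\<^sub>R (D1 \<odot> X)"
    by (simp add: malg D_ext mprod.zero_left)
  then have "D1 \<odot> X = 0"
    using X(2) by (rule eigen_cancel) simp
  then have "D2 \<odot> X = X"
    using B(5) by (simp add: J_def malg XD)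
  then show "X \<in> corner_space c D2 p"
    using B by (simp add: corner_space_def)
next
  fix X assume "X \<in> corner_space c D2 p"
  then have X: "mproj c X = X" "D2 \<odot> X = X" "X \<odot> p = X"
    by (simp_all add: corner_space_def)
  have "q \<odot> X = X" "k \<odot> X = 0" "D1 \<odot> X = 0"
    using mprod_assoc[of q D2 X] mprod_assoc[of k D2 X] mprod_assoc[of D1 D2 X]
    by (simp_all add: X Ds qDs assms ks mprod.zero_left)
  moreover have "X \<odot> D1 = 0" "X \<odot> D2 = 0"
    using mprod_assoc[of X p D1] mprod_assoc[of X p D2] by (simp_all add: X Ds assms mprod.zero_right)
  ultimately show "X \<in> neg_blocks"
    using X mprod_extend[of k X 0 k]
    by (auto simp: neg_blocks_def blocks_def corner_space_def E_def malg mprod.zero_left intro!: exI[of _ "-1"])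
qed

text \<open>Here E X - X E = D1 X + X D2, whose eigenvalues can only be 1 and 2, the latter on D1 X
  D2.\<close>

lemma neg_blocks_01:
  assumes "a = 0" "b = 1"
  shows "neg_blocks = {0}"
proof (intro subset_antisym subsetI)
  fix X assume "X \<in> neg_blocks"
  then obtain lam where X: "X \<in> blocks" "lam < 0" "E \<odot> X - X \<odot> E = lam *\<^sub>R X"
    by (auto simp: neg_blocks_def)
  note B = blocks_D[OF X(1)]
  have 0: "D2 \<odot> X = 0" "X \<odot> D1 = 0"
    using B(7,8) assms by simp_all
  have eq: "D1 \<odot> X + X \<odot> D2 = lam *\<^sub>R X"
    using X(3) by (simp add: E_def malg 0)
  from arg_cong[OF eq, of "\<lambda>A. D1 \<odot> A"] have eq1: "lam *\<^sub>R (D1 \<odot> X) = D1 \<odot> X + D1 \<odot> (X \<odot> D2)"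
    by (simp add: malg D_ext)
  from arg_cong[OF eq1, of "\<lambda>A. A \<odot> D2"] have "lam *\<^sub>R (D1 \<odot> (X \<odot> D2)) = 2 *\<^sub>R (D1 \<odot> (X \<odot> D2))"
    by (simp add: malg Ds scaleR_2)
  then have 12: "D1 \<odot> (X \<odot> D2) = 0"
    using X(2) by (rule eigen_cancel) simp
  with eq1 have "lam *\<^sub>R (D1 \<odot> X) = 1 *\<^sub>R (D1 \<odot> X)" by simp
  then have D1X: "D1 \<odot> X = 0"
    using X(2) by (rule eigen_cancel) simp
  from arg_cong[OF eq, of "\<lambda>A. A \<odot> D2"] have "lam *\<^sub>R (X \<odot> D2) = 1 *\<^sub>R (X \<odot> D2)"
    by (simp add: malg Ds 12)
  then have "X \<odot> D2 = 0"
    using X(2) by (rule eigen_cancel) simp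
  with D1X eq X(2) show "X \<in> {0}" by simp
next
  fix X assume "X \<in> {0 :: 'N qmat}"
  then show "X \<in> neg_blocks"
    by (auto simp: neg_blocks_def blocks_def corner_space_def malg intro!: exI[of _ "-1"])
qed

text \<open>Here E X - X E = - (D2 X + X D1), so every normal direction is negative, with eigenvalue
  -2 on D2 X D1 and -1 otherwise. Eigenvectors for two eigenvalues need not form a subspace, hence
  the span. The summands are X D1 and D2 X (1 - D1).\<close>

lemma neg_blocks_10:
  assumes "a = 1" "b = 0"
  shows "span neg_blocks = {x + y |x y. x \<in> corner_space c q D1 \<and> y \<in> corner_space c D2 (p - D1)}"
    (is "_ = ?R")
proof (intro subset_antisym)
  have sub: "subspace ?R"
    by (intro subspace_sums subspace_corner_space)
  have D_blocks: "D1 \<odot> X = 0" "X \<odot> D2 = 0" "X = D2 \<odot> X + X \<odot> D1 - D2 \<odot> (X \<odot> D1)" if "X \<in> blocks" for X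
  proof -
    note B = blocks_D[OF that]
    show 0: "D1 \<odot> X = 0" "X \<odot> D2 = 0"
      using B(6,9) assms by simp_all
    show "X = D2 \<odot> X + X \<odot> D1 - D2 \<odot> (X \<odot> D1)"
      using B(5) by (simp add: J_def malg 0 0[THEN mprod_extend] mprod.zero_left algebra_simps)
  qed
  have "neg_blocks \<subseteq> ?R"
  proof
    fix X assume "X \<in> neg_blocks"
    then have X: "X \<in> blocks" by (simp add: neg_blocks_def)
    note B = blocks_D[OF X] note DB = D_blocks[OF X]
    have "X \<odot> D1 \<in> corner_space c q D1"
      using B by (simp add: corner_space_def mproj_mprod Ds malg mprod_extend[OF B(1)])
    moreover have "D2 \<odot> X - D2 \<odot> (X \<odot> D1) \<in> corner_space c D2 (p - D1)"
      using B by (simp add: corner_space_def mproj_mprod Ds malg D_ext assms)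
    ultimately show "X \<in> ?R"
      using DB(3) by (intro CollectI exI[of _ "X \<odot> D1"] exI[of _ "D2 \<odot> X - D2 \<odot> (X \<odot> D1)"])
        (simp add: algebra_simps)
  qed
  then show "span neg_blocks \<subseteq> ?R"
    by (rule span_minimal[OF _ sub])
  have neg: "X \<in> neg_blocks" if "mproj c X = X" "q \<odot> X = X" "X \<odot> p = X" "k \<odot> X \<odot> k = 0"
      "E \<odot> X - X \<odot> E = lam *\<^sub>R X" "lam < 0" for X lam
    using that by (auto simp: neg_blocks_def blocks_def corner_space_def)
  show "?R \<subseteq> span neg_blocks"
  proof
    fix X assume "X \<in> ?R"
    then obtain x y where x: "mproj c x = x" "q \<odot> x = x" "x \<odot> D1 = x"
      and y: "mproj c y = y" "D2 \<odot> y = y" "y \<odot> (p - D1) = y" and X: "X = x + y"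
      by (auto simp: corner_space_def)
    have x': "x \<odot> p = x" "x \<odot> k = 0" "x \<odot> D2 = 0" "D1 \<odot> x = 0"
      using mprod_assoc[of x D1 p] mprod_assoc[of x D1 k] mprod_assoc[of x D1 D2] mprod_assoc[of D1 q x]
      by (simp_all add: x Ds qDs assms ks mprod.zero_right mprod.zero_left)
    have y': "q \<odot> y = y" "k \<odot> y = 0" "D1 \<odot> y = 0" "y \<odot> D1 = 0" "y \<odot> D2 = 0" "y \<odot> p = y"
      using mprod_assoc[of q D2 y] mprod_assoc[of k D2 y] mprod_assoc[of D1 D2 y]
        mprod_assoc[of y "p - D1" D1] mprod_assoc[of y "p - D1" D2] mprod_assoc[of y "p - D1" p]
      by (simp_all add: y Ds qDs assms ks mprod.zero_left mprod.diff_left mprod.zero_right pq)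
    \<comment> \<open>x splits into D2 x, with eigenvalue -2, and x - D2 x, with eigenvalue
      -1.\<close>
    have "D2 \<odot> x \<in> neg_blocks"
      by (rule neg[of _ "-2"])
        (simp_all add: mproj_mprod x x' Ds E_def malg D_ext qDs assms ks mprod.zero_right scaleR_2 mprod.zero_left)
    moreover have "x - D2 \<odot> x \<in> neg_blocks"
      by (rule neg[of _ "-1"])
        (simp_all add: mproj_mprod x x' Ds E_def malg D_ext qDs assms ks mprod.zero_right mprod.zero_left)
    moreover have "y \<in> neg_blocks"
      by (rule neg[of _ "-1"]) (simp_all add: y y' E_def malg mprod.zero_left)
    moreover have "X = D2 \<odot> x + (x - D2 \<odot> x) + y" by (simp add: X)
    ultimately show "X \<in> span neg_blocks"
      by (metis span_add span_base)
  qed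
qed

lemma dim_neg_blocks_10:
  assumes "a = 1" "b = 0"
  shows "dim neg_blocks = dim (corner_space c q D1) + dim (corner_space c D2 (p - D1))"
proof -
  have "corner_space c q D1 \<inter> corner_space c D2 (p - D1) = {0}"
  proof (intro subset_antisym subsetI)
    fix X assume "X \<in> corner_space c q D1 \<inter> corner_space c D2 (p - D1)"
    then have X: "X \<odot> D1 = X" "X \<odot> (p - D1) = X" by (simp_all add: corner_space_def)
    have "D1 \<odot> (p - D1) = 0"
      by (simp add: malg Ds assms)
    then show "X \<in> {0}"
      using mprod_assoc[of X D1 "p - D1"] by (simp add: X mprod.zero_right)
  qed (auto simp: corner_space_def malg)
  then have "dim (span neg_blocks) = dim (corner_space c q D1) + dim (corner_space c D2 (p - D1))"
    unfolding neg_blocks_10[OF assms]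
    using dim_sums_Int[OF subspace_corner_space subspace_corner_space, of c q D1 c D2 "p - D1"] by simp
  then show ?thesis by simp
qed

end

section \<open>Traces and compressions of projectors\<close>

lemma rtr_mprod_projectors:
  assumes "projector c P" "projector c D"
  shows "rtr (P \<odot> D) = (norm (P \<odot> D))\<^sup>2"
proof -
  have PD: "P \<odot> P = P" "madj P = P" "D \<odot> D = D" "madj D = D"
    using assms by (simp_all add: projector_def)
  have "(norm (P \<odot> D))\<^sup>2 = rtr (P \<odot> D \<odot> madj (P \<odot> D))"
    by (simp only: rtr_mprod_madj power2_norm_eq_inner)
  also have "\<dots> = rtr (P \<odot> D \<odot> P)"
    by (simp add: PD mprod_assoc PD(3)[THEN mprod_extend])
  also have "\<dots> = rtr (P \<odot> D)"
    by (subst rtr_commute) (simp add: PD PD(1)[THEN mprod_extend])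
  finally show ?thesis by simp
qed

text \<open>Each \<open>outer e\<close> in P contributes the scalar
  \<open>(norm (finner e u))\<^sup>2\<close>, which is real and so can be moved past quaternionic
  entries.\<close>

lemma outer_sandwich_projector:
  assumes "projector c P"
  shows "\<exists>s. outer u \<odot> P \<odot> outer u = s *\<^sub>R outer u"
proof -
  obtain m :: nat and es where "P = (\<Sum>i<m. outer (es i))"
    using projector_orthonormal_basis[OF assms] by blast
  moreover have "outer u \<odot> outer e \<odot> outer u = (norm (finner e u))\<^sup>2 *\<^sub>R outer u" for e
  proof -
    have "(outer u \<odot> outer e \<odot> outer u) $ i $ j
        = qmult (u $ i) (qmult (finner e u) (qmult (finner u e) (qconj (u $ j))))" for i j
      unfolding outer_mprod_outer
      by (simp add: mprod_def outer_def finner_def[of u e] qmult.sum_left qmult.sum_right qmult_assoc)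
    also have "\<dots> i j = (norm (finner e u))\<^sup>2 *\<^sub>R qmult (u $ i) (qconj (u $ j))" for i j
    proof -
      have "qmult (finner e u) (finner u e) = qreal ((norm (finner e u))\<^sup>2)"
        using qmult_qconj_self(2)[of "finner e u"] by (simp add: qconj_finner)
      then show ?thesis
        by (simp add: qreal_scaleR qmult.scaleR_right flip: qmult_assoc[of "finner e u"])
    qed
    finally show ?thesis by (simp add: vec_eq_iff outer_def)
  qed
  ultimately have "outer u \<odot> P \<odot> outer u = (\<Sum>i<m. (norm (finner (es i) u))\<^sup>2) *\<^sub>R outer u"
    by (simp add: mprod.sum_left mprod.sum_right scaleR_sum_left)
  then show ?thesis by blast
qed

section \<open>The four critical submanifolds\<close>

lemma projector_eigenvalue:
  assumes P: "projector c P" and u: "finner u u = qone" and comm: "P \<odot> outer u = outer u \<odot> P"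
  obtains s :: real where "s \<in> {0, 1}" "P \<odot> outer u = s *\<^sub>R outer u"
proof -
  have uu: "outer u \<odot> outer u = outer u" "rtr (outer u) = 1"
    using u by (simp_all add: outer_idem rtr_outer)
  have PP: "P \<odot> P = P"
    using P by (simp add: projector_def)
  obtain s where "outer u \<odot> P \<odot> outer u = s *\<^sub>R outer u"
    using outer_sandwich_projector[OF P] by blast
  then have s: "P \<odot> outer u = s *\<^sub>R outer u"
    by (simp add: mprod_assoc uu flip: comm)
  have "s *\<^sub>R outer u = P \<odot> (P \<odot> outer u)"
    by (rule trans[OF s[symmetric] PP[THEN mprod_extend, symmetric]])
  also have "\<dots> = (s * s) *\<^sub>R outer u"
    by (simp add: s mprod.scaleR_right)
  \<comment> \<open>Taking traces strips off \<open>outer u\<close>, of trace 1, and leaves s = s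
    s.\<close>
  finally have "rtr (s *\<^sub>R outer u) = rtr ((s * s) *\<^sub>R outer u)"
    by (rule arg_cong)
  then have "s \<in> {0, 1}"
    by (simp add: uu)
  then show ?thesis
    using s by (rule that)
qed

text \<open>The traces of P D and of (1 - P) D are squared norms and add up to the trace of D. Their
  vanishing gives the equality cases, from which the level sets of g are read off.\<close>

lemma rtr_mprod_projectors_bounds:
  assumes P: "projector c P" and D: "projector c D"
  shows "0 \<le> rtr (P \<odot> D)" "rtr (P \<odot> D) \<le> rtr D" "rtr (P \<odot> D) = 0 \<longleftrightarrow> P \<odot> D = 0"
    "rtr (P \<odot> D) = rtr D \<longleftrightarrow> P \<odot> D = D"
proof -
  have PD: "rtr (P \<odot> D) = (norm (P \<odot> D))\<^sup>2"
    by (rule rtr_mprod_projectors[OF P D])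
  have "projector c (mone - P)"
    by (rule projector_diff[OF projector_mone P]) simp
  from rtr_mprod_projectors[OF this D] have QD: "rtr D - rtr (P \<odot> D) = (norm (D - P \<odot> D))\<^sup>2"
    by (simp add: malg)
  show "0 \<le> rtr (P \<odot> D)" "rtr (P \<odot> D) = 0 \<longleftrightarrow> P \<odot> D = 0"
    by (simp_all add: PD)
  show "rtr (P \<odot> D) \<le> rtr D"
    using QD zero_le_power2[of "norm (D - P \<odot> D)"] by linarith
  show "rtr (P \<odot> D) = rtr D \<longleftrightarrow> P \<odot> D = D"
    using QD by auto
qed

theorem theorem3p5:
  fixes c n :: nat and i1 i2 :: "'N::finite"
  defines "M \<equiv> (phi c n ` grass c n :: 'N qmat set)"
      and "g \<equiv> gfun i1 i2"
      and "Ca \<equiv> phi c n ` {\<pi> \<in> grass c n. stdb i1 \<in> \<pi> \<and> stdb i2 \<in> \<pi>}"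
      and "Cb \<equiv> phi c n ` {\<pi> \<in> grass c n. \<pi> \<subseteq> Vsub c i1 i2}"
      and "Cc \<equiv> phi c n ` {\<pi> \<in> grass c n. \<exists>W \<in> grass c (n - 1).
                  W \<subseteq> Vsub c i1 i2 \<and> \<pi> = line_plus c (diagv (-1) i1 i2) W}"
      and "Cd \<equiv> phi c n ` {\<pi> \<in> grass c n. \<exists>W \<in> grass c (n - 1).
                  W \<subseteq> Vsub c i1 i2 \<and> \<pi> = line_plus c (diagv 1 i1 i2) W}"
  assumes "c \<in> {1, 2, 4}" and "i1 \<noteq> i2" and "n \<ge> 2" and "CARD('N) \<ge> n + 2"
  shows "(\<forall>P\<in>M. g P \<in> {-1..1})
     \<and> critical_set g M = Ca \<union> Cb \<union> Cc \<union> Cd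
     \<and> Ca \<inter> Cb = {} \<and> Ca \<inter> Cc = {} \<and> Ca \<inter> Cd = {}
     \<and> Cb \<inter> Cc = {} \<and> Cb \<inter> Cd = {} \<and> Cc \<inter> Cd = {}
     \<and> (\<forall>C\<in>{Ca, Cb, Cc, Cd}. closed C \<and> (\<exists>k. submanifold k C) \<and> nondegenerate_crit hinner g M C)
     \<and> (\<forall>P\<in>Ca. g P = 0 \<and> crit_index hinner g M Ca P = c * (CARD('N) - n))
     \<and> (\<forall>P\<in>Cb. g P = 0 \<and> crit_index hinner g M Cb P = c * n)
     \<and> {P \<in> M. g P = -1} = Cc \<and> (\<forall>P\<in>Cc. crit_index hinner g M Cc P = 0)
     \<and> {P \<in> M. g P = 1} = Cd \<and> (\<forall>P\<in>Cd. crit_index hinner g M Cd P = c * (CARD('N) - 1))"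
proof -
  define D1 where "D1 = dmat 1 i1 i2"
  define D2 where "D2 = dmat (- 1) i1 i2"
  define J where "J = jmat i1 i2"
  define E where "E = E12 i1 i2"
  note ne = \<open>i1 \<noteq> i2\<close>
  have u: "finner (diagv 1 i1 i2) (diagv 1 i1 i2) = qone" "finner (diagv (- 1) i1 i2) (diagv (- 1) i1 i2) = qone"
    using ne by (simp_all add: finner_diagv qreal_0_1)
  have D: "projector c D1" "projector c D2" "D1 \<odot> D2 = 0" "D2 \<odot> D1 = 0" "rtr D1 = 1" "rtr D2 = 1"
    using ne by (simp_all add: D1_def D2_def projector_outer fvec_diagv u rtr_outer outer_orthogonal finner_diagv qreal_0_1)
  have DD: "D1 \<odot> D1 = D1" "D2 \<odot> D2 = D2" "madj D1 = D1" "madj D2 = D2" "mproj c D1 = D1" "mproj c D2 = D2"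
    using D by (simp_all add: projector_def)
  have J: "J = D1 + D2" and E: "E = D1 - D2"
    using dmat_sum_diff[OF ne] by (simp_all add: J_def E_def D1_def D2_def)
  have M: "M = proj c n"
    unfolding M_def using phi_image_grass[of c n "\<lambda>_. True"] by simp
  have g: "g = (\<lambda>P. hinner P E)"
    by (rule ext) (simp add: g_def gfun_def E_def)
  \<comment> \<open>The sets (a), (b), (c), (d) are \<open>sec 1 1\<close>, \<open>sec 0 0\<close>,
    \<open>sec 0 1\<close> and \<open>sec 1 0\<close>.\<close>
  define sec where "sec a b = proj_section c n J (a *\<^sub>R D1 + b *\<^sub>R D2)" for a b :: real
  have sec_iff: "P \<in> sec a b \<longleftrightarrow> P \<in> proj c n \<and> P \<odot> D1 = a *\<^sub>R D1 \<and> P \<odot> D2 = b *\<^sub>R D2" for P a b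
  proof
    assume "P \<in> sec a b"
    then have P: "P \<in> proj c n" and PJ: "P \<odot> J = a *\<^sub>R D1 + b *\<^sub>R D2"
      by (simp_all add: sec_def proj_section_def)
    have "J \<odot> D1 = D1" "J \<odot> D2 = D2"
      by (simp_all add: J malg D DD)
    with mprod_extend[OF PJ, of D1] mprod_extend[OF PJ, of D2] P
    show "P \<in> proj c n \<and> P \<odot> D1 = a *\<^sub>R D1 \<and> P \<odot> D2 = b *\<^sub>R D2"
      by (simp add: malg D DD)
  qed (simp add: sec_def proj_section_def J malg)
  have Ca: "Ca = sec 1 1"
  proof -
    have "stdb i1 \<in> fixspace c P \<and> stdb i2 \<in> fixspace c P \<longleftrightarrow> P \<odot> J = J" for P
      by (simp add: J_def mprod_jmat_eq fixspace_def fvec_stdb)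
    then show ?thesis
      unfolding Ca_def phi_image_grass by (simp add: sec_def proj_section_def flip: J)
  qed
  have Cb: "Cb = sec 0 0"
  proof -
    have "fixspace c P \<subseteq> Vsub c i1 i2 \<longleftrightarrow> P \<odot> J = 0" if "P \<in> proj c n" for P
    proof -
      have P: "projector c P" using that by (simp add: proj_def)
      then have "madj (J \<odot> P) = P \<odot> J"
        by (simp add: J_def jmat_simps projector_def)
      then show ?thesis
        unfolding fixspace_subset_Vsub[OF P] J_def[symmetric]
        by (metis madj_linear(4) madj_madj)
    qed
    then show ?thesis
      unfolding Cb_def phi_image_grass by (auto simp: sec_def proj_section_def)
  qed
  have Cc: "Cc = sec 0 1" and Cd: "Cd = sec 1 0"
    unfolding Cc_def Cd_def phi_image_grass
    using line_plus_diagv_iff[OF ne, of "- 1" _ c n] line_plus_diagv_iff[OF ne, of 1 _ c n] \<open>n \<ge> 2\<close>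
    by (simp_all add: sec_def proj_section_def J_def D1_def D2_def cong: conj_cong)
  have gP: "g P = rtr (P \<odot> D1) - rtr (P \<odot> D2)" for P
    by (simp add: g E hinner_eq_rtr malg)
  have g_sec: "g P = a - b" if "P \<in> sec a b" for P a b
    using that by (simp add: gP sec_iff D)
  have bounds: "rtr (P \<odot> D1) \<in> {0..1}" "rtr (P \<odot> D2) \<in> {0..1}" if "P \<in> M" for P
    using that rtr_mprod_projectors_bounds[of c P D1] rtr_mprod_projectors_bounds[of c P D2]
    by (simp_all add: M proj_def D)
  have disj: "sec a b \<inter> sec a' b' = {}" if "(a, b) \<noteq> (a', b')" for a b a' b'
  proof -
    have "a *\<^sub>R D1 = a' *\<^sub>R D1 \<longleftrightarrow> a = a'" "b *\<^sub>R D2 = b' *\<^sub>R D2 \<longleftrightarrow> b = b'"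
      using D(5,6) by auto
    then show ?thesis
      using that by (auto simp: sec_iff)
  qed
  have crit: "critical_set g M = sec 1 1 \<union> sec 0 0 \<union> sec 0 1 \<union> sec 1 0"
  proof -
    have "critical_set g M = {P \<in> proj c n. P \<odot> E = E \<odot> P}"
      unfolding g M by (rule critical_set_hinner) (simp_all add: E DD)
    also have "\<dots> = sec 1 1 \<union> sec 0 0 \<union> sec 0 1 \<union> sec 1 0"
    proof (intro subset_antisym subsetI)
      fix P assume "P \<in> {P \<in> proj c n. P \<odot> E = E \<odot> P}"
      then have P: "P \<in> proj c n" "projector c P" and PE: "P \<odot> E = E \<odot> P"
        by (simp_all add: proj_def)
      \<comment> \<open>J is the square of E, so D1 and D2 are polynomials in E and P commutes with
        them as well.\<close>
      have EE: "E \<odot> E = J"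
        by (simp add: E J malg D DD)
      have "P \<odot> J = J \<odot> P"
        by (simp add: PE mprod_assoc mprod_extend[OF PE] flip: EE)
      moreover have "D1 = (1/2) *\<^sub>R (J + E)" "D2 = (1/2) *\<^sub>R (J - E)"
        by (simp_all add: J E flip: scaleR_2)
      ultimately have "P \<odot> D1 = D1 \<odot> P" "P \<odot> D2 = D2 \<odot> P"
        using PE by (simp_all add: malg)
      then obtain a b where "a \<in> {0, 1}" "P \<odot> D1 = a *\<^sub>R D1" "b \<in> {0, 1}" "P \<odot> D2 = b *\<^sub>R D2"
        unfolding D1_def D2_def by (metis projector_eigenvalue[OF P(2)] u)
      with P(1) show "P \<in> sec 1 1 \<union> sec 0 0 \<union> sec 0 1 \<union> sec 1 0"
        by (auto simp: sec_iff)
    next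
      fix P assume "P \<in> sec 1 1 \<union> sec 0 0 \<union> sec 0 1 \<union> sec 1 0"
      then obtain a b where "P \<in> sec a b" by blast
      then have P: "projector c P" "P \<in> proj c n" and PD: "P \<odot> D1 = a *\<^sub>R D1" "P \<odot> D2 = b *\<^sub>R D2"
        by (simp_all add: sec_iff proj_def)
      have "D1 \<odot> P = a *\<^sub>R D1" "D2 \<odot> P = b *\<^sub>R D2"
        using madj_mprod[of P D1] madj_mprod[of P D2] P by (simp_all add: PD DD projector_def)
      with PD P show "P \<in> {P \<in> proj c n. P \<odot> E = E \<odot> P}"
        by (simp add: E malg)
    qed
    finally show ?thesis .
  qed
  have point: "critical_point c P (mone - P) n D1 D2 a b" if "P \<in> sec a b" "a \<in> {0, 1}" "b \<in> {0, 1}" for P a b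
    using that D by unfold_locales (simp_all add: sec_iff proj_def)
  \<comment> \<open>The locale builds its E, J and Z from D1 and D2; they are matched here with
    \<open>E12\<close>, \<open>jmat\<close> and \<open>sec\<close>.\<close>
  have local_eq: "critical_point.E D1 D2 = E" "critical_point.J D1 D2 = J"
      "proj_section c n J (critical_point.Z D1 D2 a b) = sec a b" if "P \<in> sec a b" "a \<in> {0, 1}" "b \<in> {0, 1}" for P a b
    using point[OF that] by (simp_all add: critical_point.E_def critical_point.J_def critical_point.Z_def E J sec_def)
  have nondeg: "nondegenerate_crit hinner g M (sec a b)" if "a \<in> {0, 1}" "b \<in> {0, 1}" for a b
    unfolding nondegenerate_crit_def g M
    using critical_point.nondegenerate[OF point[OF _ that]] local_eq[OF _ that] by auto
  have projJ: "projector c J"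
    unfolding J by (rule projector_add[OF D(1-3)])
  have sub: "closed (sec a b)" "\<exists>k. submanifold k (sec a b)" for a b
    unfolding sec_def using assms(7) projJ
    by (auto intro!: closed_proj_section submanifold_proj_section simp: DD)
  have ind: "crit_index hinner g M (sec a b) P = dim (critical_point.neg_blocks c P (mone - P) D1 D2)"
    if "P \<in> sec a b" "a \<in> {0, 1}" "b \<in> {0, 1}" for P a b
    unfolding g M using critical_point.crit_index_eq[OF point[OF that]] local_eq[OF that] by simp
  have dims: "real (dim (corner_space c (mone - P) A)) = c * (real CARD('N) - n) * rtr A"
      "real (dim (corner_space c A P)) = c * n * rtr A"
    if "P \<in> proj c n" "projector c A" for P A :: "'N qmat"
  proof -
    have P: "projector c P" "rtr P = n" using that by (simp_all add: proj_def)
    have "projector c (mone - P)"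
      by (rule projector_diff[OF projector_mone P(1)]) simp
    then show "real (dim (corner_space c (mone - P) A)) = c * (real CARD('N) - n) * rtr A"
      "real (dim (corner_space c A P)) = c * n * rtr A"
      using assms(7) P that by (simp_all add: dim_corner_space)
  qed
  have ia: "crit_index hinner g M (sec 1 1) P = c * (CARD('N) - n)" if "P \<in> sec 1 1" for P
  proof -
    have "real (dim (corner_space c (mone - P) D1)) = real (c * (CARD('N) - n))"
      using dims(1)[of P D1] that D \<open>CARD('N) \<ge> n + 2\<close> by (simp add: sec_iff of_nat_diff)
    then show ?thesis
      unfolding of_nat_eq_iff using ind[OF that] critical_point.neg_blocks_11[OF point[OF that]] by simp
  qed
  have ib: "crit_index hinner g M (sec 0 0) P = c * n" if "P \<in> sec 0 0" for P
  proof -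
    have "real (dim (corner_space c D2 P)) = real (c * n)"
      using dims(2)[of P D2] that D by (simp add: sec_iff)
    then show ?thesis
      unfolding of_nat_eq_iff using ind[OF that] critical_point.neg_blocks_00[OF point[OF that]] by simp
  qed
  have ic: "crit_index hinner g M (sec 0 1) P = 0" if "P \<in> sec 0 1" for P
    using ind[OF that] critical_point.neg_blocks_01[OF point[OF that]] by simp
  have id: "crit_index hinner g M (sec 1 0) P = c * (CARD('N) - 1)" if "P \<in> sec 1 0" for P
  proof -
    have P: "P \<in> proj c n" "projector c P" "P \<odot> D1 = D1" "rtr P = n"
      using that by (simp_all add: sec_iff proj_def)
    have "projector c (P - D1)"
      by (rule projector_diff[OF P(2) D(1) P(3)])
    then have "real (dim (corner_space c D2 (P - D1))) = c * (real n - 1)"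
      using assms(7) D P(4) by (simp add: dim_corner_space)
    moreover have "real (dim (corner_space c (mone - P) D1)) = c * (real CARD('N) - n)"
      using dims(1)[OF P(1) D(1)] D by simp
    \<comment> \<open>The two dimensions are c (N - n) and c (n - 1).\<close>
    ultimately have "real (dim (corner_space c (mone - P) D1) + dim (corner_space c D2 (P - D1)))
        = real (c * (CARD('N) - 1))"
      using \<open>CARD('N) \<ge> n + 2\<close> by (simp add: of_nat_diff algebra_simps)
    then show ?thesis
      unfolding of_nat_eq_iff using ind[OF that] critical_point.dim_neg_blocks_10[OF point[OF that]] by simp
  qed
  have level: "{P \<in> M. g P = -1} = sec 0 1" "{P \<in> M. g P = 1} = sec 1 0"
  proof -
    have eq: "rtr (P \<odot> Di) = 0 \<longleftrightarrow> P \<odot> Di = 0" "rtr (P \<odot> Di) = 1 \<longleftrightarrow> P \<odot> Di = Di"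
      if "P \<in> M" "Di \<in> {D1, D2}" for P Di
      using that rtr_mprod_projectors_bounds(3,4)[of c P Di] D by (auto simp: M proj_def)
    \<comment> \<open>Both traces lie in [0, 1], so their difference reaches -1 or 1 only at
      opposite end points.\<close>
    have "g P = - 1 \<longleftrightarrow> rtr (P \<odot> D1) = 0 \<and> rtr (P \<odot> D2) = 1"
      "g P = 1 \<longleftrightarrow> rtr (P \<odot> D1) = 1 \<and> rtr (P \<odot> D2) = 0" if "P \<in> M" for P
      using bounds[OF that] by (auto simp: gP)
    then show "{P \<in> M. g P = -1} = sec 0 1" "{P \<in> M. g P = 1} = sec 1 0"
      using eq by (auto simp: sec_iff simp flip: M)
  qed
  have "g P \<in> {-1..1}" if "P \<in> M" for P
    using bounds[OF that] by (simp add: gP)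
  then show ?thesis
    unfolding Ca Cb Cc Cd
    using crit disj sub nondeg g_sec ia ib ic id level by simp
qed

end
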